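(* Let $F(z)=A+Bz+\int\frac{1+zs}{s-z}\,d\mu(s)$ be a non-rational Nevanlinna-Pick function ($A\in\mathbb{R}$, $B\ge0$, $\mu$ a finite Borel measure on $\mathbb{R}$), and let $[a,b]$, $a<b$, be a compact interval disjoint from $\operatorname{supp}\mu$. Let $(a_{\max},b_{\max})$ be the largest open interval containing $[a,b]$ that is disjoint from $\operatorname{supp}\mu$. (1) Let $n\ge 1$, let $\nu_n$ be a finite Borel measure with $\operatorname{supp}\nu_n\subseteq[a,b]$ and $\#\operatorname{supp}\nu_n\ge n$, let $T_n=\{a\le t_1<\cdots<t_n\le b\}$, and let $R_n=Q_n/P_n$ be the AAA approximant of $F$ corresponding to $(\nu_n,T_n)$. Then $R_n$ is irreducible, that is, $P_n$ and $Q_n$ have no common zeros. Moreover, all the zeros of $P_n$, equivalently the poles of $R_n$, belong to $(-\infty,a_{\max}]\cup[b_{\max},\infty)$. (2) Let $\{R_n\}_{n\ge1}$ be a sequence of AAA approximants of $F$ associated with a sequence of pairs $\{(\nu_n,T_n)\}_{n\ge1}$ as in (1). Then for every compact set $K\subset\mathbb{C}\setminus\big((-\infty,a_{\max}]\cup[b_{\max},\infty)\big)$ there exists a constant $0<q_K<1$ such that $$|F(z)-R_n(z)|\le q_K^n$$ for all sufficiently large $n$ and all $z\in K$.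
   Context: Nevanlinna-Pick function: an analytic function on the upper half-plane mapping it into itself; such functions are characterized by the representation in the claim, and the integral formula is used to define $F$ on $\mathbb{C}\setminus\operatorname{supp}\mu$. $F$ is real on $[a,b]$ and analytic in a neighborhood of it. If $a_{\max}=-\infty$ (resp. $b_{\max}=\infty$), the set $(-\infty,a_{\max}]$ (resp. $[b_{\max},\infty)$) is empty. Loewner kernel: $K_F(x,y):=\frac{F(x)-F(y)}{x-y}$ on $[a,b]\times[a,b]$, with $K_F(x,x)=F'(x)$. AAA approximant of $F$ corresponding to $(\nu_n,T_n)$: the rational function $R_n=Q_n/P_n$, where $$P_n(z)=\sum_{k=1}^nb_kL_k(z),\quad Q_n(z)=\sum_{k=1}^nb_kF(t_k)L_k(z),\quad L_k(z)=\prod_{i\ne k}(z-t_i),$$ and the real weights $b_k$ satisfy $b_1^2+\cdots+b_n^2=1$, the non-zero $b_k$ with the smallest index is positive, and $$\int\Big(\sum_{k=1}^nb_kK_F(x,t_k)\Big)^2d\nu_n(x)=\min_{c_1^2+\cdots+c_n^2=1}\int\Big(\sum_{k=1}^nc_kK_F(x,t_k)\Big)^2d\nu_n(x).$$ *)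

theory Defs
  imports
    "HOL-Probability.Probability"
    "HOL-Complex_Analysis.Complex_Analysis"
    "HOL-Computational_Algebra.Polynomial"
begin

definition msupp :: "real measure \<Rightarrow> real set" where
  "msupp M = {x. \<forall>U. open U \<longrightarrow> x \<in> U \<longrightarrow> emeasure M U > 0}"

definition nevanlinna_pick :: "(complex \<Rightarrow> complex) \<Rightarrow> bool" where
  "nevanlinna_pick F \<longleftrightarrow>
     F holomorphic_on {z. Im z > 0} \<and> F ` {z. Im z > 0} \<subseteq> {z. Im z > 0}"

definition np_representation ::
    "(complex \<Rightarrow> complex) \<Rightarrow> real \<Rightarrow> real \<Rightarrow> real measure \<Rightarrow> bool" where
  "np_representation F A B \<mu> \<longleftrightarrow>
     B \<ge> 0 \<and> finite_borel_measure \<mu> \<and>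
     (\<forall>z \<in> - (complex_of_real ` msupp \<mu>).
        F z = of_real A + of_real B * z +
          (LINT s|\<mu>. (1 + z * of_real s) / (of_real s - z)))"

definition rational_on :: "(complex \<Rightarrow> complex) \<Rightarrow> complex set \<Rightarrow> bool" where
  "rational_on F S \<longleftrightarrow>
     (\<exists>p q :: complex poly. q \<noteq> 0 \<and>
        (\<forall>z\<in>S. poly q z \<noteq> 0 \<longrightarrow> F z = poly p z / poly q z))"

definition largest_gap ::
    "real measure \<Rightarrow> real \<Rightarrow> real \<Rightarrow> ereal \<Rightarrow> ereal \<Rightarrow> bool" where
  "largest_gap \<mu> a b a\<^sub>m b\<^sub>m \<longleftrightarrow>
     {a..b} \<subseteq> einterval a\<^sub>m b\<^sub>m \<and> einterval a\<^sub>m b\<^sub>m \<inter> msupp \<mu> = {} \<and>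
     (\<forall>c d. {a..b} \<subseteq> einterval c d \<and> einterval c d \<inter> msupp \<mu> = {} \<longrightarrow>
        einterval c d \<subseteq> einterval a\<^sub>m b\<^sub>m)"

definition rays :: "ereal \<Rightarrow> ereal \<Rightarrow> complex set" where
  "rays a\<^sub>m b\<^sub>m = complex_of_real ` ({x. ereal x \<le> a\<^sub>m} \<union> {x. b\<^sub>m \<le> ereal x})"

text \<open>The functions considered take real values on \<open>[a, b]\<close>, so that \<^const>\<open>Re\<close> below only
  changes the type of the values.\<close>

definition loewner_kernel :: "(complex \<Rightarrow> complex) \<Rightarrow> real \<Rightarrow> real \<Rightarrow> real" where
  "loewner_kernel F x y =
     (if x = y then Re (deriv F (of_real x))
      else (Re (F (of_real x)) - Re (F (of_real y))) / (x - y))"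

definition aaa_pair ::
    "real \<Rightarrow> real \<Rightarrow> nat \<Rightarrow> real measure \<Rightarrow> (nat \<Rightarrow> real) \<Rightarrow> bool" where
  "aaa_pair a b n \<nu> t \<longleftrightarrow>
     finite_borel_measure \<nu> \<and> msupp \<nu> \<subseteq> {a..b} \<and>
     (infinite (msupp \<nu>) \<or> n \<le> card (msupp \<nu>)) \<and>
     strict_mono_on {1..n} t \<and> t ` {1..n} \<subseteq> {a..b}"

text \<open>The kernel is only meaningful on \<open>[a, b] \<times> [a, b]\<close>, and \<open>\<nu>\<close> is carried by \<open>[a, b]\<close>. The
  integral is restricted to this interval because \<open>F\<close> is arbitrary, possibly not even measurable,
  on the support of its representing measure.\<close>

definition aaa_objective ::
    "(complex \<Rightarrow> complex) \<Rightarrow> real \<Rightarrow> real \<Rightarrow> nat \<Rightarrow> real measure \<Rightarrow> (nat \<Rightarrow> real) \<Rightarrow>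
      (nat \<Rightarrow> real) \<Rightarrow> real" where
  "aaa_objective F a b n \<nu> t c =
     (LINT x:{a..b}|\<nu>. (\<Sum>k=1..n. c k * loewner_kernel F x (t k))\<^sup>2)"

definition aaa_weights ::
    "(complex \<Rightarrow> complex) \<Rightarrow> real \<Rightarrow> real \<Rightarrow> nat \<Rightarrow> real measure \<Rightarrow> (nat \<Rightarrow> real) \<Rightarrow>
      (nat \<Rightarrow> real) \<Rightarrow> bool" where
  "aaa_weights F a b n \<nu> t w \<longleftrightarrow>
     (\<Sum>k=1..n. (w k)\<^sup>2) = 1 \<and>
     (\<exists>k\<in>{1..n}. w k > 0 \<and> (\<forall>j\<in>{1..<k}. w j = 0)) \<and>
     (\<forall>c. (\<Sum>k=1..n. (c k)\<^sup>2) = 1 \<longrightarrow>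
        aaa_objective F a b n \<nu> t w \<le> aaa_objective F a b n \<nu> t c)"

definition aaa_L :: "nat \<Rightarrow> (nat \<Rightarrow> real) \<Rightarrow> nat \<Rightarrow> complex poly" where
  "aaa_L n t k = (\<Prod>i\<in>{1..n} - {k}. [:- of_real (t i), 1:])"

definition aaa_P :: "nat \<Rightarrow> (nat \<Rightarrow> real) \<Rightarrow> (nat \<Rightarrow> real) \<Rightarrow> complex poly" where
  "aaa_P n t w = (\<Sum>k=1..n. smult (of_real (w k)) (aaa_L n t k))"

definition aaa_Q ::
    "(complex \<Rightarrow> complex) \<Rightarrow> nat \<Rightarrow> (nat \<Rightarrow> real) \<Rightarrow> (nat \<Rightarrow> real) \<Rightarrow> complex poly" where
  "aaa_Q F n t w = (\<Sum>k=1..n. smult (of_real (w k) * F (of_real (t k))) (aaa_L n t k))"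

definition aaa_R ::
    "(complex \<Rightarrow> complex) \<Rightarrow> nat \<Rightarrow> (nat \<Rightarrow> real) \<Rightarrow> (nat \<Rightarrow> real) \<Rightarrow> complex \<Rightarrow> complex" where
  "aaa_R F n t w z = poly (aaa_Q F n t w) z / poly (aaa_P n t w) z"

end

theory Submission
  imports Defs
begin

text \<open>Fix \<open>\<theta>\<close> between \<open>b\<close> and the next point of the support. In the coordinate \<open>u = 1 / (\<theta> - x)\<close> the
  support of \<open>\<mu>\<close> lies in a compact interval to the left of the image of \<open>[a, b]\<close>, and up to the factor
  \<open>u v\<close> the Loewner kernel becomes \<open>k(u, v) = \<Lambda>(1 / ((u - \<cdot>) (v - \<cdot>)))\<close> for a strictly positive
  functional \<open>\<Lambda>\<close> on that interval.

  If a combination of \<open>n\<close> kernels \<open>k(\<cdot>, v)\<close> vanishes at \<open>n - 1\<close> points, then \<open>\<Lambda>\<close> (with a positive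
  weight) makes the numerator of \<open>\<Sum>\<^sub>v d\<^sub>v / (v - \<cdot>)\<close> orthogonal to all polynomials of degree less than
  \<open>n - 1\<close>. So that numerator, which is the denominator \<open>P\<^sub>n\<close> of the approximant, has \<open>n - 1\<close> simple
  zeros in the interval, its weights \<open>d\<^sub>v\<close> alternate in sign, and the residues of the approximant have a
  fixed sign. The weights that minimise the AAA objective form an eigenvector of a Gram matrix, and a
  Perron--Frobenius argument shows that the corresponding combination has indeed \<open>n - 1\<close> zeros.

  Since the residues have a fixed sign and the approximant interpolates \<open>F\<close>, their sum is bounded
  independently of \<open>n\<close>. Hence the errors are uniformly bounded on compact subsets of the
  complement of the rays. They have \<open>n\<close> zeros in \<open>[a, b]\<close>, so after a Riemann map they are
  geometrically small, by dividing out Blaschke factors.\<close>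

section \<open>Linear systems, sign changes and node polynomials\<close>

text \<open>The coordinate sends infinity to 0. The linear term \<open>B * z\<close> thereby becomes
  a point mass at 0 and an unbounded support becomes compact, so both are treated by one functional,
  with \<open>al\<close> \<le> 0 \<le> \<open>be\<close>. Two nondegeneracy hypotheses turn into
  strict positivity: a non-rational \<open>F\<close> has infinite support, so \<open>Lam\<close> is
  positive on nonnegative continuous functions with finitely many zeros; a support of \<nu> with at
  least \<open>n\<close> points gives the same for fewer than \<open>n\<close> zeros. One obstacle
  is that the minimiser belongs to the smallest eigenvalue of a matrix with positive entries, where
  Perron's theorem says nothing directly. Its inverse is the right object: it sends weakly
  alternating vectors to strictly alternating ones. The other obstacle is that \<nu> may vary with
  \<open>n\<close> without any regularity. Uniformity in \<open>n\<close> is therefore drawn from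
  positivity alone: the residues are masses of one sign, and a single interpolation condition at a
  second node bounds their sum by a value of the kernel.\<close>

lemma homogeneous_system:
  fixes M :: "'e \<Rightarrow> 'v \<Rightarrow> real"
  assumes "finite E" "finite V" "card E < card V"
  shows "\<exists>c. (\<exists>v\<in>V. c v \<noteq> 0) \<and> (\<forall>e\<in>E. (\<Sum>v\<in>V. c v * M e v) = 0)"
  using assms
proof (induction E arbitrary: V M rule: finite_induct)
  case empty
  then obtain v where "v \<in> V" by (metis card.empty card_gt_0_iff ex_in_conv)
  then show ?case by (intro exI[of _ "\<lambda>_. 1"]) auto
next
  case (insert e E)
  show ?case
  proof (cases "\<forall>v\<in>V. M e v = 0")
    case True
    obtain c where "\<exists>v\<in>V. c v \<noteq> 0" "\<forall>e\<in>E. (\<Sum>v\<in>V. c v * M e v) = 0"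
      using insert.IH[of V M] insert.prems insert.hyps by auto
    then show ?thesis using True by (intro exI[of _ c]) auto
  next
    case False
    then obtain p where p: "p \<in> V" "M e p \<noteq> 0" by auto
    \<comment> \<open>Gaussian elimination: subtracting a multiple of row \<open>e\<close> clears
      the column of the pivot \<open>p\<close> from the other rows.\<close>
    define M' where "M' = (\<lambda>f v. M f v - M f p * M e v / M e p)"
    have "card E < card (V - {p})"
      using insert.prems insert.hyps p(1) by simp
    then obtain c where c: "\<exists>v\<in>V - {p}. c v \<noteq> 0"
        "\<forall>f\<in>E. (\<Sum>v\<in>V - {p}. c v * M' f v) = 0"
      using insert.IH[of "V - {p}" M'] insert.prems by auto
    define T where "T = (\<Sum>v\<in>V - {p}. c v * M e v)"
    \<comment> \<open>Back substitution: the value at \<open>p\<close> is the one that solves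
      equation \<open>e\<close>.\<close>
    define c' where "c' = c(p := - T / M e p)"
    have eq: "(\<Sum>v\<in>V. c' v * M f v) = (\<Sum>v\<in>V - {p}. c v * M f v) - T / M e p * M f p" for f
    proof -
      have "(\<Sum>v\<in>V. c' v * M f v) = c' p * M f p + (\<Sum>v\<in>V - {p}. c' v * M f v)"
        using insert.prems(1) p(1) by (rule sum.remove)
      also have "(\<Sum>v\<in>V - {p}. c' v * M f v) = (\<Sum>v\<in>V - {p}. c v * M f v)"
        by (rule sum.cong) (auto simp: c'_def)
      finally show ?thesis by (simp add: c'_def)
    qed
    have "(\<Sum>v\<in>V. c' v * M f v) = 0" if "f \<in> insert e E" for f
    proof (cases "f = e")
      case True
      then show ?thesis using p eq[of e] by (simp add: T_def)
    next
      case False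
      then have "(\<Sum>v\<in>V - {p}. c v * M' f v) = 0" using c that by auto
      moreover have "(\<Sum>v\<in>V - {p}. c v * M' f v) = (\<Sum>v\<in>V - {p}. c v * M f v) - T / M e p * M f p"
        unfolding M'_def T_def sum_divide_distrib sum_distrib_right sum_subtractf[symmetric]
        by (rule sum.cong) (auto simp: field_simps)
      ultimately show ?thesis using eq by simp
    qed
    moreover have "\<exists>v\<in>V. c' v \<noteq> 0" using c(1) by (auto simp: c'_def)
    ultimately show ?thesis by blast
  qed
qed

lemma continuous_nonzero_same_sign:
  fixes f :: "real \<Rightarrow> real"
  assumes "continuous_on I f" "is_interval I" "\<And>x. x \<in> I \<Longrightarrow> f x \<noteq> 0" "x \<in> I" "y \<in> I"
  shows "f x * f y > 0"
proof -
  have conn: "connected (f ` I)"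
    using assms by (intro connected_continuous_image is_interval_connected)
  have "0 \<notin> f ` I" using assms(3) by force
  then have "\<not> (f x \<le> 0 \<and> 0 \<le> f y)" "\<not> (f y \<le> 0 \<and> 0 \<le> f x)"
    using conn assms(4,5) unfolding connected_iff_interval by blast+
  then show ?thesis by (auto simp: zero_less_mult_iff)
qed

text \<open>\<open>S\<close> collects the points of \<open>Z\<close> at which \<open>f\<close>
  really changes sign. The induction removes the largest point \<open>m\<close>: the induction
  hypothesis covers the left of \<open>m\<close>, the sign of \<open>f\<close> is constant on the
  right, and \<open>m\<close> joins \<open>S\<close> exactly when this constant sign disagrees with
  \<open>e\<close>.\<close>

lemma sign_changes_aux:
  fixes f :: "real \<Rightarrow> real"
  assumes "finite Z" "continuous_on I f" "is_interval I" "\<And>x. x \<in> I - Z \<Longrightarrow> f x \<noteq> 0"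
  shows "\<exists>S\<subseteq>Z. \<exists>e\<in>{-1,1::real}. \<forall>x\<in>I - Z. e * f x * (\<Prod>s\<in>S. x - s) > 0"
  using assms
proof (induction Z arbitrary: I rule: finite_linorder_max_induct)
  case empty
  show ?case
  proof (cases "I = {}")
    case False
    then obtain y where y: "y \<in> I" by auto
    have *: "f y * f x > 0" if "x \<in> I" for x
      using continuous_nonzero_same_sign[OF empty.prems(1,2)] empty.prems(3) y that by blast
    show ?thesis
      by (rule exI[of _ "{}"], simp, cases "f y > 0")
        (use * in \<open>auto simp: zero_less_mult_iff\<close>)
  qed auto
next
  case (insert m Z)
  let ?I = "I \<inter> {..<m}" and ?J = "I \<inter> {m<..}"
  have "continuous_on ?I f" "is_interval ?I"
    by (rule continuous_on_subset[OF insert.prems(1)], blast)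
      (intro is_interval_Int insert.prems is_interval_io)
  moreover have "f x \<noteq> 0" if "x \<in> ?I - Z" for x using insert.prems(3) that by auto
  ultimately obtain S e where S: "S \<subseteq> Z" "e \<in> {-1,1}"
      "\<And>x. x \<in> ?I - Z \<Longrightarrow> e * f x * (\<Prod>s\<in>S. x - s) > 0"
    using insert.IH[of ?I] by blast
  have finS: "finite S" "m \<notin> S" using S(1) insert.hyps finite_subset by auto
  have prod_pos: "(\<Prod>s\<in>S. x - s) > 0" if "x > m" for x
    using S(1) insert.hyps(2) that by (intro prod_pos) fastforce
  have J: "continuous_on ?J f" "is_interval ?J"
    by (rule continuous_on_subset[OF insert.prems(1)], blast)
      (intro is_interval_Int insert.prems is_interval_oi)
  have nz: "f x \<noteq> 0" if "x \<in> ?J" for x using insert.prems(3) insert.hyps(2) that by fastforce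
  show ?case
  proof (cases "\<forall>x\<in>?J. e * f x > 0")
    case True
    have "e * f x * (\<Prod>s\<in>S. x - s) > 0" if "x \<in> I - insert m Z" for x
      using that S(3)[of x] True prod_pos[of x] by (cases "x < m") auto
    then show ?thesis using S by blast
  next
    case False
    then obtain y where y: "y \<in> ?J" "\<not> e * f y > 0" by auto
    have neg: "e * f x < 0" if "x \<in> ?J" for x
      using continuous_nonzero_same_sign[OF J nz y(1) that] y(2) S(2)
      by (auto simp: zero_less_mult_iff not_less)
    \<comment> \<open>To the left of \<open>m\<close> the new factor \<open>x - m\<close> is
      negative, which the change from \<open>e\<close> to \<open>- e\<close> compensates.\<close>
    have "- e * f x * (\<Prod>s\<in>insert m S. x - s) > 0" if "x \<in> I - insert m Z" for x
    proof (cases "x < m")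
      case True
      then have "e * f x * (\<Prod>s\<in>S. x - s) * (m - x) > 0" using S(3)[of x] that by simp
      then show ?thesis using finS by (simp add: algebra_simps)
    next
      case False
      then have "e * f x * (x - m) * (\<Prod>s\<in>S. x - s) < 0"
        using neg[of x] prod_pos[of x] that by (simp add: mult_less_0_iff)
      then show ?thesis using finS by (simp add: algebra_simps)
    qed
    moreover have "insert m S \<subseteq> insert m Z" "- e \<in> {-1,1}" using S by auto
    ultimately show ?thesis by blast
  qed
qed

lemma sign_changes:
  fixes f :: "real \<Rightarrow> real"
  assumes "finite {x \<in> {l..r}. f x = 0}" "continuous_on {l..r} f"
  obtains S e where "S \<subseteq> {x \<in> {l..r}. f x = 0}" "e \<in> {-1,1::real}"
    "\<And>x. x \<in> {l..r} \<Longrightarrow> f x \<noteq> 0 \<Longrightarrow> e * f x * (\<Prod>s\<in>S. x - s) > 0"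
proof -
  obtain S e where "S \<subseteq> {x \<in> {l..r}. f x = 0}" "e \<in> {-1,1::real}"
      "\<forall>x\<in>{l..r} - {x \<in> {l..r}. f x = 0}. e * f x * (\<Prod>s\<in>S. x - s) > 0"
    using sign_changes_aux[OF assms] is_interval_cc by blast
  then show ?thesis using that by blast
qed

section \<open>Polynomials in partial fraction form\<close>

definition node_prod :: "real set \<Rightarrow> real \<Rightarrow> real" where
  "node_prod V u = (\<Prod>v\<in>V. v - u)"

text \<open>The numerator of the sum of the fractions \<open>d v / (v - u)\<close> over the common
  denominator \<open>node_prod V u\<close>; equivalently, a Lagrange interpolant with unnormalised
  weights. The orientation \<open>v - u\<close> is positive to the left of all nodes, where the
  functional lives.\<close>

definition node_poly :: "real set \<Rightarrow> (real \<Rightarrow> real) \<Rightarrow> real poly" where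
  "node_poly V d = (\<Sum>v\<in>V. smult (d v) (\<Prod>y\<in>V - {v}. [:y, -1:]))"

lemma poly_node_poly: "poly (node_poly V d) u = (\<Sum>v\<in>V. d v * node_prod (V - {v}) u)"
  by (simp add: node_poly_def node_prod_def poly_sum poly_prod)

lemma degree_node_poly: "finite V \<Longrightarrow> V \<noteq> {} \<Longrightarrow> degree (node_poly V d) < card V"
proof -
  assume V: "finite V" "V \<noteq> {}"
  have "degree (node_poly V d) \<le> card V - 1"
    unfolding node_poly_def
  proof (rule degree_sum_le[OF V(1)])
    fix v assume "v \<in> V"
    have "degree (smult (d v) (\<Prod>y\<in>V - {v}. [:y, -1:])) \<le> degree (\<Prod>y\<in>V - {v}. [:y, -1:])"
      by (rule degree_smult_le)
    also have "\<dots> \<le> sum (degree \<circ> (\<lambda>y. [:y, -1:])) (V - {v})"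
      by (rule degree_prod_sum_le) (use V in auto)
    also have "\<dots> \<le> card V - 1" using V \<open>v \<in> V\<close> by simp
    finally show "degree (smult (d v) (\<Prod>y\<in>V - {v}. [:y, -1:])) \<le> card V - 1" .
  qed
  moreover have "card V > 0" using V by (simp add: card_gt_0_iff)
  ultimately show ?thesis by linarith
qed

lemma node_prod_nonzero: "finite V \<Longrightarrow> u \<notin> V \<Longrightarrow> node_prod V u \<noteq> 0"
  by (auto simp: node_prod_def)

lemma node_prod_remove: "finite V \<Longrightarrow> v \<in> V \<Longrightarrow> node_prod V u = (v - u) * node_prod (V - {v}) u"
  by (simp add: node_prod_def prod.remove)

lemma poly_node_poly_node:
  assumes "finite V" "v \<in> V"
  shows "poly (node_poly V d) v = d v * node_prod (V - {v}) v"
proof -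
  have "poly (node_poly V d) v = d v * node_prod (V - {v}) v
      + (\<Sum>y\<in>V - {v}. d y * node_prod (V - {y}) v)"
    unfolding poly_node_poly using assms by (rule sum.remove)
  also have "(\<Sum>y\<in>V - {v}. d y * node_prod (V - {y}) v) = 0"
    using assms by (intro sum.neutral) (auto simp: node_prod_def)
  finally show ?thesis by simp
qed

lemma partial_fractions_node_poly:
  assumes "finite V" "u \<notin> V"
  shows "(\<Sum>v\<in>V. d v / (v - u)) = poly (node_poly V d) u / node_prod V u"
  unfolding poly_node_poly sum_divide_distrib
proof (rule sum.cong[OF refl])
  fix v assume v: "v \<in> V"
  then have "v - u \<noteq> 0" "node_prod (V - {v}) u \<noteq> 0"
    using assms node_prod_nonzero[of "V - {v}"] by auto
  then show "d v / (v - u) = d v * node_prod (V - {v}) u / node_prod V u"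
    using node_prod_remove[OF assms(1) v] by simp
qed

lemma poly_eq_0_of_card_zeros:
  fixes p :: "real poly"
  assumes "finite X" "degree p < card X" "\<And>x. x \<in> X \<Longrightarrow> poly p x = 0"
  shows "p = 0"
proof (rule ccontr)
  assume "p \<noteq> 0"
  then have "card X \<le> card {x. poly p x = 0}"
    using assms by (intro card_mono poly_roots_finite) auto
  then show False using card_poly_roots_bound[OF \<open>p \<noteq> 0\<close>] assms(2) by linarith
qed

text \<open>Lagrange interpolation. Together with \<open>partial_fractions_node_poly\<close> it
  splits \<open>r / node_prod X\<close> into simple fractions, which is how zeros of a trace become
  orthogonality relations.\<close>

lemma node_poly_interpolation:
  assumes "finite X" "degree r < card X"
  obtains c where "r = node_poly X c"
proof
  define c where "c = (\<lambda>x. poly r x / node_prod (X - {x}) x)"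
  have "X \<noteq> {}" using assms by auto
  have "r - node_poly X c = 0"
  proof (rule poly_eq_0_of_card_zeros[OF assms(1)])
    show "degree (r - node_poly X c) < card X"
      using degree_node_poly[OF assms(1) \<open>X \<noteq> {}\<close>] assms(2)
      by (rule degree_diff_less[rotated])
    fix x assume "x \<in> X"
    then show "poly (r - node_poly X c) x = 0"
      using node_prod_nonzero[of "X - {x}" x] assms(1) by (simp add: poly_node_poly_node c_def)
  qed
  then show "r = node_poly X c" by simp
qed

lemma poly_factor_of_zeros:
  fixes p :: "'a::field poly"
  assumes "finite S" "degree p \<le> card S" "\<And>s. s \<in> S \<Longrightarrow> poly p s = 0"
  shows "\<exists>\<kappa>. p = smult \<kappa> (\<Prod>s\<in>S. [:s, -1:])"
  using assms
proof (induction S arbitrary: p rule: finite_induct)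
  case empty
  then have "degree p = 0" by simp
  then obtain c where "p = [:c:]" by (rule degree_eq_zeroE)
  then show ?case by (intro exI[of _ c]) simp
next
  case (insert z S)
  then have "[:- z, 1:] dvd p" by (simp add: poly_eq_0_iff_dvd)
  then obtain q' where "p = [:- z, 1:] * q'" by auto
  then have q: "p = [:z, -1:] * (- q')" by simp
  show ?case
  proof (cases "q' = 0")
    case False
    then have "degree p = Suc (degree (- q'))" unfolding q by (subst degree_mult_eq) auto
    moreover have "poly (- q') s = 0" if "s \<in> S" for s
      using insert.prems(2)[of s] insert.hyps that unfolding q by auto
    ultimately obtain \<kappa> where "- q' = smult \<kappa> (\<Prod>s\<in>S. [:s, -1:])"
      using insert.IH[of "- q'"] insert.prems(1) insert.hyps by auto
    then have "p = smult \<kappa> (\<Prod>s\<in>insert z S. [:s, -1:])"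
      unfolding q using insert.hyps by (simp only: mult_smult_right prod.insert[OF insert.hyps(1,2)])
    then show ?thesis ..
  qed (use q in auto)
qed

lemma poly_prod_node: "poly (\<Prod>s\<in>S. [:s, -1:]) u = node_prod S u"
  by (simp add: node_prod_def poly_prod)

lemma degree_prod_node:
  fixes S :: "real set"
  shows "degree (\<Prod>s\<in>S. [:s, -1:]) = card S"
  by (subst degree_prod_eq_sum_degree) auto

lemma poly_eq_value_plus_root:
  fixes q :: "real poly"
  obtains s where "q = [:poly q z:] + [:z, -1:] * s" "degree s \<le> degree q - 1"
proof -
  have "poly (q - [:poly q z:]) z = 0" by simp
  then obtain s' where s': "q - [:poly q z:] = [:- z, 1:] * s'"
    unfolding poly_eq_0_iff_dvd by auto
  have "degree s' \<le> degree q - 1"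
  proof (cases "s' = 0")
    case False
    then have "Suc (degree s') = degree (q - [:poly q z:])"
      unfolding s' by (subst degree_mult_eq) auto
    also have "\<dots> \<le> degree q" by (rule degree_diff_le) auto
    finally show ?thesis by simp
  qed simp
  moreover have "q = [:poly q z:] + [:z, -1:] * (- s')"
    using s' by (simp add: algebra_simps)
  ultimately show ?thesis using that[of "- s'"] by simp
qed

section \<open>Cauchy kernels of positive functionals\<close>

text \<open>Abstracts integration against a positive measure, so that the same lemmas serve \<mu>
  and \<nu>. The predicate \<open>small\<close> describes sets that cannot contain the support:
  finite sets if the support is infinite, sets with fewer than \<open>n\<close> points if it has at
  least \<open>n\<close>.\<close>

locale pos_functional =
  fixes L :: "(real \<Rightarrow> real) \<Rightarrow> real" and l r :: real and small :: "real set \<Rightarrow> bool"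
  assumes small_empty: "small {}"
    and L_add: "continuous_on {l..r} f \<Longrightarrow> continuous_on {l..r} g \<Longrightarrow>
      L (\<lambda>x. f x + g x) = L f + L g"
    and L_scale: "continuous_on {l..r} f \<Longrightarrow> L (\<lambda>x. c * f x) = c * L f"
    and L_cong: "(\<And>x. x \<in> {l..r} \<Longrightarrow> f x = g x) \<Longrightarrow> L f = L g"
    and L_pos: "continuous_on {l..r} f \<Longrightarrow> (\<And>x. x \<in> {l..r} \<Longrightarrow> 0 \<le> f x) \<Longrightarrow>
      small {x \<in> {l..r}. f x = 0} \<Longrightarrow> 0 < L f"
begin

lemma L_zero: "L (\<lambda>x. 0) = 0"
  using L_scale[of "\<lambda>_. 0" 0] by simp

lemma L_diff:
  assumes "continuous_on {l..r} f" "continuous_on {l..r} g"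
  shows "L (\<lambda>x. f x - g x) = L f - L g"
proof -
  have "L (\<lambda>x. f x + (-1) * g x) = L f + L (\<lambda>x. (-1) * g x)"
    using assms by (intro L_add continuous_intros)
  then show ?thesis using L_scale[OF assms(2), of "-1"] by simp
qed

lemma L_sum:
  assumes "finite I" "\<And>i. i \<in> I \<Longrightarrow> continuous_on {l..r} (f i)"
  shows "L (\<lambda>x. \<Sum>i\<in>I. f i x) = (\<Sum>i\<in>I. L (f i))"
  using assms
proof (induction I rule: finite_induct)
  case empty
  then show ?case by (simp add: L_zero)
next
  case (insert i I)
  have "continuous_on {l..r} (\<lambda>x. \<Sum>i\<in>I. f i x)"
    using insert.prems by (intro continuous_on_sum) auto
  then show ?case using insert by (simp add: L_add)
qed

text \<open>The pointwise inequality is strict, so the difference has no zeros and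
  \<open>small {}\<close> is enough for positivity.\<close>

lemma L_mono:
  assumes "continuous_on {l..r} f" "continuous_on {l..r} g" "\<And>x. x \<in> {l..r} \<Longrightarrow> f x < g x"
  shows "L f < L g"
proof -
  have "{x \<in> {l..r}. g x - f x = 0} = {}" using assms(3) by force
  then have small: "small {x \<in> {l..r}. g x - f x = 0}" using small_empty by (simp only:)
  have "continuous_on {l..r} (\<lambda>x. g x - f x)" using assms(1,2) by (intro continuous_intros)
  then have "0 < L (\<lambda>x. g x - f x)"
    using assms(3) small by (intro L_pos) (auto simp: less_imp_le)
  then show ?thesis using L_diff[OF assms(2,1)] by simp
qed

lemma L_abs_bound:
  assumes "continuous_on {l..r} f" "\<And>x. x \<in> {l..r} \<Longrightarrow> \<bar>f x\<bar> < C"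
  shows "\<bar>L f\<bar> \<le> L (\<lambda>_. C)"
proof -
  have "L f < L (\<lambda>_. C)" using assms by (intro L_mono continuous_intros) (auto simp: abs_less_iff)
  moreover have "L (\<lambda>x. (-1) * f x) < L (\<lambda>_. C)"
    using assms by (intro L_mono continuous_intros) (auto simp: abs_less_iff)
  ultimately show ?thesis using L_scale[OF assms(1), of "-1"] by simp
qed

end

locale cauchy_kernel = pos_functional Lam al be finite
  for Lam :: "(real \<Rightarrow> real) \<Rightarrow> real" and al be :: real
begin

definition k :: "real \<Rightarrow> real \<Rightarrow> real" where
  "k u v = Lam (\<lambda>w. 1 / ((u - w) * (v - w)))"

text \<open>Up to a factor depending only on \<open>u\<close>, this is the combination of Loewner
  kernels whose square the AAA weights minimise in the mean.\<close>

definition tr :: "real set \<Rightarrow> (real \<Rightarrow> real) \<Rightarrow> real \<Rightarrow> real" where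
  "tr V d u = (\<Sum>v\<in>V. d v * k u v)"

definition nodes :: "real set \<Rightarrow> bool" where
  "nodes V \<longleftrightarrow> finite V \<and> V \<subseteq> {be<..}"

lemma nodes_finite: "nodes V \<Longrightarrow> finite V"
  and nodes_gt: "nodes V \<Longrightarrow> v \<in> V \<Longrightarrow> be < v"
  by (auto simp: nodes_def)

lemma node_prod_pos: "nodes V \<Longrightarrow> w \<in> {al..be} \<Longrightarrow> 0 < node_prod V w"
  unfolding node_prod_def by (intro prod_pos) (auto simp: nodes_def)

lemma continuous_on_node_prod [continuous_intros]: "continuous_on A (node_prod V)"
  unfolding node_prod_def by (intro continuous_intros)

lemma cauchy_continuous: "be < u \<Longrightarrow> be < v \<Longrightarrow>
    continuous_on {al..be} (\<lambda>w. 1 / ((u - w) * (v - w)))"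
  by (intro continuous_intros) auto

lemma quotient_continuous:
  assumes "nodes X" "nodes V"
  shows "continuous_on {al..be} (\<lambda>w. poly p w / (node_prod X w * node_prod V w))"
proof -
  have "node_prod X w * node_prod V w \<noteq> 0" if "w \<in> {al..be}" for w
    using node_prod_pos[OF assms(1) that] node_prod_pos[OF assms(2) that] by simp
  then show ?thesis by (intro continuous_intros) auto
qed

lemma k_pos: "be < u \<Longrightarrow> be < v \<Longrightarrow> 0 < k u v"
  unfolding k_def
proof (rule L_pos[OF cauchy_continuous])
  assume uv: "be < u" "be < v"
  show "0 \<le> 1 / ((u - x) * (v - x))" if "x \<in> {al..be}" for x using that uv by auto
  have "{x \<in> {al..be}. 1 / ((u - x) * (v - x)) = 0} = {}" using uv by auto
  then show "finite {x \<in> {al..be}. 1 / ((u - x) * (v - x)) = 0}" by (metis finite.emptyI)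
qed

lemma k_bounded:
  assumes "be < m"
  obtains C where "\<And>u v. m \<le> u \<Longrightarrow> m \<le> v \<Longrightarrow> k u v \<le> C"
proof
  fix u v assume uv: "m \<le> u" "m \<le> v"
  show "k u v \<le> Lam (\<lambda>_. 1 / ((m - be) * (m - be)) + 1)"
    unfolding k_def
  proof (rule less_imp_le[OF L_mono])
    show "continuous_on {al..be} (\<lambda>w. 1 / ((u - w) * (v - w)))"
      using assms uv by (intro cauchy_continuous) auto
    fix w assume "w \<in> {al..be}"
    then have "1 / ((u - w) * (v - w)) \<le> 1 / ((m - be) * (m - be))"
      using assms uv by (intro divide_left_mono mult_mono mult_pos_pos) auto
    then show "1 / ((u - w) * (v - w)) < 1 / ((m - be) * (m - be)) + 1" by simp
  qed auto
qed

lemma k_continuous: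
  assumes "be < m" "be < v"
  shows "continuous_on {m..} (\<lambda>u. k u v)"
proof -
  \<comment> \<open>The added 1 makes the bound strict, as \<open>L_abs_bound\<close> demands. The
    functional at the constant \<open>c\<close> is then a Lipschitz constant for the kernel.\<close>
  define c where "c = 1 / ((m - be) * (m - be) * (v - be)) + 1"
  have "\<bar>k u v - k u' v\<bar> \<le> Lam (\<lambda>_. c) * \<bar>u - u'\<bar>" if u: "m \<le> u" "m \<le> u'" for u u'
  proof -
    let ?f = "\<lambda>w. 1 / ((u - w) * (u' - w) * (v - w))"
    have gt: "u - w > 0" "u' - w > 0" "v - w > 0" if "w \<in> {al..be}" for w
      using that u assms by auto
    have cont: "continuous_on {al..be} ?f"
      using gt by (intro continuous_intros) force
    have "\<bar>?f w\<bar> < c" if "w \<in> {al..be}" for w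
    proof -
      have "?f w \<le> 1 / ((m - be) * (m - be) * (v - be))"
        using gt[OF that] that u assms by (intro divide_left_mono mult_mono mult_pos_pos) auto
      then show ?thesis using gt[OF that] by (simp add: c_def)
    qed
    then have b: "\<bar>Lam ?f\<bar> \<le> Lam (\<lambda>_. c)" using cont by (intro L_abs_bound)
    have "k u v - k u' v = Lam (\<lambda>w. 1 / ((u - w) * (v - w)) - 1 / ((u' - w) * (v - w)))"
      unfolding k_def using u assms by (intro L_diff[symmetric] cauchy_continuous) auto
    also have "\<dots> = Lam (\<lambda>w. (u' - u) * ?f w)"
      by (rule L_cong) (use gt in \<open>fastforce simp: divide_simps\<close>)
    also have "\<dots> = (u' - u) * Lam ?f" by (rule L_scale[OF cont])
    finally have "\<bar>k u v - k u' v\<bar> = \<bar>Lam ?f\<bar> * \<bar>u - u'\<bar>"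
      by (simp add: abs_mult abs_minus_commute mult.commute)
    then show ?thesis using b by (simp add: mult_right_mono)
  qed
  moreover have "0 < c" using assms by (auto simp: c_def intro!: add_nonneg_pos)
  then have "0 \<le> Lam (\<lambda>_. c)"
    using L_abs_bound[of "\<lambda>_. 0" c] by (simp add: L_zero)
  ultimately have "(Lam (\<lambda>_. c))-lipschitz_on {m..} (\<lambda>u. k u v)"
    by (intro lipschitz_onI) (auto simp: dist_real_def)
  then show ?thesis by (rule lipschitz_on_continuous_on)
qed

lemma tr_continuous:
  assumes "be < m" "nodes V"
  shows "continuous_on {m..} (tr V d)"
  unfolding tr_def using assms nodes_gt by (intro continuous_intros k_continuous) auto

lemma tr_linear: "tr V (\<lambda>v. x * c v + y * d v) u = x * tr V c u + y * tr V d u"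
  unfolding tr_def sum_distrib_left sum.distrib[symmetric]
  by (rule sum.cong) (auto simp: algebra_simps)

lemma tr_zero: "(\<And>v. v \<in> V \<Longrightarrow> d v = 0) \<Longrightarrow> tr V d u = 0"
  unfolding tr_def by simp

lemma tr_eq:
  assumes "nodes V" "be < u"
  shows "tr V d u = Lam (\<lambda>w. poly (node_poly V d) w / ((u - w) * node_prod V w))"
proof -
  have "tr V d u = (\<Sum>v\<in>V. Lam (\<lambda>w. d v * (1 / ((u - w) * (v - w)))))"
    unfolding tr_def k_def
    by (rule sum.cong[OF refl]) (use assms nodes_gt in \<open>simp only: L_scale[OF cauchy_continuous]\<close>)
  also have "\<dots> = Lam (\<lambda>w. \<Sum>v\<in>V. d v * (1 / ((u - w) * (v - w))))"
    using assms nodes_gt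
    by (intro L_sum[symmetric] continuous_on_mult_left cauchy_continuous) (auto simp: nodes_def)
  also have "\<dots> = Lam (\<lambda>w. poly (node_poly V d) w / ((u - w) * node_prod V w))"
  proof (rule L_cong)
    fix w assume "w \<in> {al..be}"
    then have "w \<notin> V" using assms by (auto simp: nodes_def)
    have "(\<Sum>v\<in>V. d v * (1 / ((u - w) * (v - w)))) = (\<Sum>v\<in>V. d v / (v - w)) / (u - w)"
      unfolding sum_divide_distrib by (rule sum.cong) auto
    then show "(\<Sum>v\<in>V. d v * (1 / ((u - w) * (v - w))))
        = poly (node_poly V d) w / ((u - w) * node_prod V w)"
      using partial_fractions_node_poly[OF nodes_finite[OF assms(1)] \<open>w \<notin> V\<close>, of d] by simp
  qed
  finally show ?thesis .
qed

text \<open>With \<open>q\<close> expanded as \<open>node_poly X c\<close>, the left-hand side is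
  the combination of the values \<open>tr V d x\<close> with coefficients \<open>c x\<close>, and
  these values all vanish.\<close>

lemma tr_zeros_orthogonal:
  assumes "nodes X" "nodes V" "\<And>x. x \<in> X \<Longrightarrow> tr V d x = 0" "degree q < card X"
  shows "Lam (\<lambda>w. poly (q * node_poly V d) w / (node_prod X w * node_prod V w)) = 0"
proof -
  let ?p = "node_poly V d"
  obtain c where c: "q = node_poly X c"
    using node_poly_interpolation[OF nodes_finite[OF assms(1)] assms(4)] .
  have cont: "continuous_on {al..be} (\<lambda>w. poly ?p w / ((x - w) * node_prod V w))"
    if "x \<in> X" for x
  proof -
    have "nodes {x}" using that assms(1) by (auto simp: nodes_def)
    from quotient_continuous[OF this assms(2), of ?p] show ?thesis by (simp add: node_prod_def)
  qed
  have "0 = (\<Sum>x\<in>X. c x * tr V d x)" using assms(3) by simp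
  also have "\<dots> = (\<Sum>x\<in>X. Lam (\<lambda>w. c x * (poly ?p w / ((x - w) * node_prod V w))))"
    by (rule sum.cong[OF refl])
      (use assms nodes_gt in \<open>simp only: L_scale[OF cont] tr_eq\<close>)
  also have "\<dots> = Lam (\<lambda>w. \<Sum>x\<in>X. c x * (poly ?p w / ((x - w) * node_prod V w)))"
    using cont assms(1)
    by (intro L_sum[symmetric] continuous_on_mult_left) (auto simp: nodes_def)
  also have "\<dots> = Lam (\<lambda>w. poly (q * ?p) w / (node_prod X w * node_prod V w))"
  proof (rule L_cong)
    fix w assume "w \<in> {al..be}"
    then have "w \<notin> X" using assms by (auto simp: nodes_def)
    have "(\<Sum>x\<in>X. c x * (poly ?p w / ((x - w) * node_prod V w)))
        = (\<Sum>x\<in>X. c x / (x - w)) * (poly ?p w / node_prod V w)"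
      unfolding sum_distrib_right by (rule sum.cong) auto
    then show "(\<Sum>x\<in>X. c x * (poly ?p w / ((x - w) * node_prod V w)))
        = poly (q * ?p) w / (node_prod X w * node_prod V w)"
      using partial_fractions_node_poly[OF nodes_finite[OF assms(1)] \<open>w \<notin> X\<close>, of c]
      by (simp add: c)
  qed
  finally show ?thesis by simp
qed

lemma quotient_pos:
  assumes "nodes X" "nodes V" "p \<noteq> 0" "\<And>w. w \<in> {al..be} \<Longrightarrow> 0 \<le> poly p w"
  shows "0 < Lam (\<lambda>w. poly p w / (node_prod X w * node_prod V w))"
proof (rule L_pos[OF quotient_continuous[OF assms(1,2)]])
  fix w assume w: "w \<in> {al..be}"
  show "0 \<le> poly p w / (node_prod X w * node_prod V w)"
    using assms(4)[OF w] node_prod_pos[OF assms(1) w] node_prod_pos[OF assms(2) w] by simp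
next
  have "{w \<in> {al..be}. poly p w / (node_prod X w * node_prod V w) = 0} \<subseteq> {w. poly p w = 0}"
    using node_prod_pos[OF assms(1)] node_prod_pos[OF assms(2)] by force
  then show "finite {w \<in> {al..be}. poly p w / (node_prod X w * node_prod V w) = 0}"
    using poly_roots_finite[OF assms(3)] finite_subset by blast
qed

lemma node_poly_eq_0_imp:
  assumes "nodes V" "node_poly V d = 0" "v \<in> V"
  shows "d v = 0"
  using poly_node_poly_node[OF nodes_finite[OF assms(1)] assms(3), of d]
    node_prod_nonzero[of "V - {v}" v] assms by (simp add: nodes_def)

text \<open>Orthogonality is applied to the numerator itself, whose degree is below the number of
  zeros: the functional of its square vanishes, so strict positivity makes it 0. Thus the kernels
  form a Chebyshev system to the right of \<open>be\<close>.\<close>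

lemma tr_few_zeros:
  assumes "nodes X" "nodes V" "\<And>x. x \<in> X \<Longrightarrow> tr V d x = 0" "card V \<le> card X" "v \<in> V"
  shows "d v = 0"
proof -
  let ?p = "node_poly V d"
  have "V \<noteq> {}" using assms(5) by auto
  then have "degree ?p < card X"
    using degree_node_poly[OF nodes_finite[OF assms(2)], of d] assms(4) by linarith
  then have 0: "Lam (\<lambda>w. poly (?p * ?p) w / (node_prod X w * node_prod V w)) = 0"
    using tr_zeros_orthogonal assms(1-3) by blast
  have "?p = 0"
  proof (rule ccontr)
    assume "?p \<noteq> 0"
    then have "0 < Lam (\<lambda>w. poly (?p * ?p) w / (node_prod X w * node_prod V w))"
      by (intro quotient_pos assms) auto
    then show False using 0 by simp
  qed
  then show ?thesis using node_poly_eq_0_imp assms by blast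
qed

text \<open>The classical argument for zeros of orthogonal polynomials: with fewer than
  \<open>card X\<close> sign changes, the polynomial \<open>r\<close> having just these sign changes
  would be orthogonal to the numerator although their product is nonnegative. The degree leaves room
  for no further zeros.\<close>

lemma node_poly_factor:
  assumes "nodes X" "nodes V" "\<And>x. x \<in> X \<Longrightarrow> tr V d x = 0" "card V = Suc (card X)"
    "\<exists>v\<in>V. d v \<noteq> 0"
  obtains Z \<kappa> where "Z \<subseteq> {al..be}" "finite Z" "card Z = card X" "\<kappa> \<noteq> 0"
    "node_poly V d = smult \<kappa> (\<Prod>z\<in>Z. [:z, -1:])"
proof -
  let ?p = "node_poly V d"
  have p0: "?p \<noteq> 0" using node_poly_eq_0_imp[OF assms(2)] assms(5) by blast
  have "V \<noteq> {}" using assms(4) by auto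
  then have degp: "degree ?p \<le> card X"
    using degree_node_poly[OF nodes_finite[OF assms(2)], of d] assms(4) by linarith
  have fin: "finite {x \<in> {al..be}. poly ?p x = 0}"
    using poly_roots_finite[OF p0] by (rule finite_subset[rotated]) auto
  have cont: "continuous_on {al..be} (poly ?p)" by (intro continuous_intros)
  obtain S e where S: "S \<subseteq> {x \<in> {al..be}. poly ?p x = 0}"
      "e \<in> {-1,1::real}"
      "\<And>x. x \<in> {al..be} \<Longrightarrow> poly ?p x \<noteq> 0 \<Longrightarrow> e * poly ?p x * (\<Prod>s\<in>S. x - s) > 0"
    by (rule sign_changes[OF fin cont]) (rule that)
  have finS: "finite S" using fin S(1) finite_subset by auto
  define r where "r = smult e (\<Prod>s\<in>S. [:- s, 1:])"
  have "r \<noteq> 0" using S(2) finS by (auto simp: r_def)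
  have "\<not> card S < card X"
  proof
    assume "card S < card X"
    moreover have "degree r \<le> card S"
      unfolding r_def using degree_prod_eq_sum_degree[of S "\<lambda>s. [:- s, 1:]"] S(2) by auto
    ultimately have "Lam (\<lambda>w. poly (r * ?p) w / (node_prod X w * node_prod V w)) = 0"
      by (intro tr_zeros_orthogonal assms) auto
    moreover have "0 \<le> poly (r * ?p) w" if "w \<in> {al..be}" for w
      using S(3)[OF that] by (cases "poly ?p w = 0") (auto simp: r_def poly_prod algebra_simps)
    then have "0 < Lam (\<lambda>w. poly (r * ?p) w / (node_prod X w * node_prod V w))"
      using \<open>r \<noteq> 0\<close> p0 by (intro quotient_pos assms) auto
    ultimately show False by simp
  qed
  then obtain Z where Z: "Z \<subseteq> S" "card Z = card X" "finite Z"
    by (meson finS finite_subset not_less obtain_subset_with_card_n)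
  then obtain \<kappa> where k: "?p = smult \<kappa> (\<Prod>z\<in>Z. [:z, -1:])"
    using poly_factor_of_zeros[of Z ?p] degp S(1) by auto
  moreover have "\<kappa> \<noteq> 0" using k p0 by auto
  ultimately show ?thesis using that[of Z \<kappa>] Z S(1) by blast
qed

text \<open>At a node the numerator equals \<open>d v * node_prod (V - {v}) v\<close>, and to the
  right of \<open>be\<close> it has no zeros, hence a constant sign. Since
  \<open>node_prod (V - {v}) v\<close> alternates along the ordered nodes, so do the
  weights.\<close>

lemma weights_alternate:
  assumes "nodes X" "nodes V" "\<And>x. x \<in> X \<Longrightarrow> tr V d x = 0" "card V = Suc (card X)"
    "\<exists>v\<in>V. d v \<noteq> 0"
  obtains \<kappa> where "\<And>v. v \<in> V \<Longrightarrow> 0 < \<kappa> * (d v * node_prod (V - {v}) v)"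
proof -
  obtain Z \<kappa> where Z: "Z \<subseteq> {al..be}" "\<kappa> \<noteq> 0" "node_poly V d = smult \<kappa> (\<Prod>z\<in>Z. [:z, -1:])"
    using node_poly_factor[OF assms] by metis
  have "0 < \<kappa> * (-1) ^ card Z * (d v * node_prod (V - {v}) v)" if "v \<in> V" for v
  proof -
    have "d v * node_prod (V - {v}) v = \<kappa> * node_prod Z v"
      using poly_node_poly_node[OF nodes_finite[OF assms(2)] that, of d] Z(3)
      by (simp add: poly_prod_node)
    moreover have "node_prod Z v = (-1) ^ card Z * (\<Prod>z\<in>Z. v - z)"
      unfolding node_prod_def prod_constant[symmetric] prod.distrib[symmetric] by simp
    moreover have "(\<Prod>z\<in>Z. v - z) > 0"
      using Z(1) nodes_gt[OF assms(2) that] by (intro prod_pos) auto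
    ultimately have "\<kappa> * (-1) ^ card Z * (d v * node_prod (V - {v}) v)
        = \<kappa>\<^sup>2 * ((-1) ^ card Z)\<^sup>2 * (\<Prod>z\<in>Z. v - z)"
      by (simp add: power2_eq_square)
    then show ?thesis using Z(2) \<open>(\<Prod>z\<in>Z. v - z) > 0\<close> by simp
  qed
  then show ?thesis using that by blast
qed

end

section \<open>Traces orthogonal to an alternating vector\<close>

context cauchy_kernel
begin

text \<open>\<open>node_prod (V - {v}) v\<close> changes sign from each node to the next, so this
  describes a checkerboard cone without enumerating \<open>V\<close> in order. The inequalities are
  weak because the positive and negative parts of a vector, which may have zero entries, have to
  qualify.\<close>

definition alternating :: "real set \<Rightarrow> (real \<Rightarrow> real) \<Rightarrow> bool" where
  "alternating V q \<longleftrightarrow> (\<forall>v\<in>V. 0 \<le> q v * node_prod (V - {v}) v) \<and> (\<exists>v\<in>V. q v \<noteq> 0)"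

lemma nodes_subset: "nodes V \<Longrightarrow> W \<subseteq> V \<Longrightarrow> nodes W"
  unfolding nodes_def using finite_subset by blast

lemma nodes_insert: "nodes V \<Longrightarrow> be < x \<Longrightarrow> nodes (insert x V)"
  unfolding nodes_def by auto

lemma node_prod_self_nonzero: "nodes V \<Longrightarrow> node_prod (V - {v}) v \<noteq> 0"
  using node_prod_nonzero[of "V - {v}" v] by (simp add: nodes_def)

text \<open>A nonzero \<open>c\<close> would alternate strictly by \<open>weights_alternate\<close>,
  so all terms \<open>q v * c v\<close> would have the same weak sign and one of them would be
  nonzero. Orthogonality to \<open>q\<close> thus lowers by one the number of zeros that forces a
  trace to vanish.\<close>

lemma alternating_orthogonal_eq_0:
  assumes "nodes X" "nodes V" "\<And>x. x \<in> X \<Longrightarrow> tr V c x = 0" "card V = Suc (card X)"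
    "alternating V q" "(\<Sum>v\<in>V. q v * c v) = 0" "v \<in> V"
  shows "c v = 0"
proof (rule ccontr)
  assume "c v \<noteq> 0"
  then have "\<exists>v\<in>V. c v \<noteq> 0" using assms(7) by blast
  from weights_alternate[OF assms(1-4) this] obtain \<kappa>
    where \<kappa>: "\<And>v. v \<in> V \<Longrightarrow> 0 < \<kappa> * (c v * node_prod (V - {v}) v)" by blast
  let ?e = "\<lambda>v. node_prod (V - {v}) v"
  have e: "?e v \<noteq> 0" for v by (rule node_prod_self_nonzero[OF assms(2)])
  have eq: "\<kappa> * (q v * c v) = (q v * ?e v) * (\<kappa> * (c v * ?e v)) / (?e v)\<^sup>2" for v
    using e[of v] by (simp add: power2_eq_square)
  have nonneg: "0 \<le> \<kappa> * (q v * c v)" if "v \<in> V" for v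
    unfolding eq using assms(5) \<kappa>[OF that] that
    by (intro divide_nonneg_nonneg mult_nonneg_nonneg[of "q v * _"])
      (auto simp: alternating_def less_imp_le)
  obtain y where y: "y \<in> V" "q y \<noteq> 0" using assms(5) by (auto simp: alternating_def)
  then have "\<kappa> * (q y * c y) \<noteq> 0" using \<kappa>[OF y(1)] by auto
  then have "0 < \<kappa> * (q y * c y)" using nonneg[OF y(1)] by linarith
  then have "0 < (\<Sum>v\<in>V. \<kappa> * (q v * c v))"
    using sum_pos2[of V y "\<lambda>v. \<kappa> * (q v * c v)"] nonneg nodes_finite[OF assms(2)] y(1) by blast
  then show False using assms(6) by (simp add: sum_distrib_left[symmetric])
qed

text \<open>A dimension count. The equations are indexed by an option type: \<open>None\<close>
  stands for orthogonality to \<open>q\<close>, and \<open>Some s\<close> for a zero at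
  \<open>s\<close>.\<close>

lemma orthogonal_trace_exists:
  assumes "nodes S" "nodes V" "Suc (card S) < card V"
  obtains c where "\<exists>v\<in>V. c v \<noteq> 0" "(\<Sum>v\<in>V. q v * c v) = 0" "\<And>s. s \<in> S \<Longrightarrow> tr V c s = 0"
proof -
  define M where "M = (\<lambda>e v. case e of None \<Rightarrow> q v | Some s \<Rightarrow> k s v)"
  have "card (insert None (Some ` S)) = Suc (card S)"
    using nodes_finite[OF assms(1)] by (subst card_insert_disjoint) (auto simp: card_image)
  then obtain c where c: "\<exists>v\<in>V. c v \<noteq> 0"
      "\<forall>e\<in>insert None (Some ` S). (\<Sum>v\<in>V. c v * M e v) = 0"
    using homogeneous_system[of "insert None (Some ` S)" V M] assms nodes_finite by auto
  show ?thesis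
  proof (rule that[OF c(1)])
    show "(\<Sum>v\<in>V. q v * c v) = 0" using c(2) by (simp add: M_def mult.commute)
    show "tr V c s = 0" if "s \<in> S" for s using c(2) that by (simp add: M_def tr_def)
  qed
qed

text \<open>If the trace of \<open>c\<close> kept its sign at the zero \<open>z\<close>, a small perturbation inside the orthogonal
  complement of \<open>q\<close> would turn \<open>z\<close> into two zeros, one too many.\<close>

lemma sign_pattern_of_trace:
  assumes S: "nodes S" "S \<subseteq> {m<..<M}" and m: "be < m" and V: "nodes V" "card V = card S + 2"
    and q: "alternating V q"
    and c: "(\<Sum>v\<in>V. q v * c v) = 0" "\<And>s. s \<in> S \<Longrightarrow> tr V c s = 0" "\<exists>v\<in>V. c v \<noteq> 0"
  obtains e where "e \<in> {-1,1::real}"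
    "\<And>x. x \<in> {m..M} - S \<Longrightarrow> 0 < e * tr V c x * (\<Prod>s\<in>S. x - s)"
proof -
  let ?g = "tr V c"
  have finS: "finite S" using S(1) by (rule nodes_finite)
  have unique: "\<forall>v\<in>V. c' v = 0" if "(\<Sum>v\<in>V. q v * c' v) = 0" "nodes X" "card X = Suc (card S)"
    "\<And>s. s \<in> X \<Longrightarrow> tr V c' s = 0" for c' X
    using alternating_orthogonal_eq_0[of X V c' q] that V q by auto
  have zeros: "x \<in> S" if "be < x" "?g x = 0" for x
  proof (rule ccontr)
    assume "x \<notin> S"
    then have "\<forall>v\<in>V. c v = 0"
      using unique[OF c(1), of "insert x S"] nodes_insert[OF S(1) that(1)] finS c(2) that(2) by auto
    then show False using c(3) by auto
  qed
  have zeroset: "{x \<in> {m..M}. ?g x = 0} = S" using zeros m S(2) c(2) by fastforce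
  have gcont: "continuous_on {m..} (tr V d)" for d by (rule tr_continuous[OF m V(1)])
  have gcontA: "continuous_on A (tr V d)" if "A \<subseteq> {m..}" for d A
    by (rule continuous_on_subset[OF gcont that])
  obtain Sg e where Sg: "Sg \<subseteq> S" "e \<in> {-1,1::real}"
      "\<And>x. x \<in> {m..M} \<Longrightarrow> ?g x \<noteq> 0 \<Longrightarrow> e * ?g x * (\<Prod>s\<in>Sg. x - s) > 0"
    using sign_changes[of m M ?g] gcontA[of "{m..M}" c] finS unfolding zeroset by auto
  have finSg: "finite Sg" using Sg(1) finS finite_subset by auto
  have "Sg = S"
  proof (rule ccontr)
    assume "Sg \<noteq> S"
    then obtain z where z: "z \<in> S" "z \<notin> Sg" using Sg(1) by auto
    have zm: "m < z" "z < M" using S(2) z(1) by auto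
    \<comment> \<open>The perturbing trace \<open>c'\<close> vanishes at \<open>y\<close> in place
      of \<open>z\<close>. Without this extra zero it could be \<open>c\<close> itself; with it, a
      further zero at \<open>z\<close> would be one too many, whence \<open>hz\<close>.\<close>
    define y where "y = Max (insert be S) + 1"
    have ySless: "s < y" if "s \<in> S" for s
    proof -
      have "s \<le> Max (insert be S)" using that finS by (intro Max_ge) auto
      then show ?thesis by (simp add: y_def)
    qed
    then have y: "be < y" "y \<notin> S"
    proof -
      have "be \<le> Max (insert be S)" using finS by (intro Max_ge) auto
      then show "be < y" by (simp add: y_def)
      show "y \<notin> S" using ySless by blast
    qed
    have cardz: "card (insert y (S - {z})) = card S"
      using card_Suc_Diff1[OF finS z(1)] finS y(2) by simp
    have ny: "nodes (insert y (S - {z}))"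
      using nodes_insert[OF nodes_subset[OF S(1)] y(1)] by auto
    have "Suc (card (insert y (S - {z}))) < card V"
      unfolding cardz using V(2) by simp
    from orthogonal_trace_exists[OF ny V(1) this, of q] obtain c'
      where c': "\<exists>v\<in>V. c' v \<noteq> 0" "(\<Sum>v\<in>V. q v * c' v) = 0"
        "\<And>s. s \<in> insert y (S - {z}) \<Longrightarrow> tr V c' s = 0" by blast
    let ?h = "tr V c'"
    have hz: "?h z \<noteq> 0"
    proof
      assume "?h z = 0"
      then have "\<forall>v\<in>V. c' v = 0"
        using unique[OF c'(2), of "insert y S"] nodes_insert[OF S(1) y(1)] finS y(2) c'(3) by auto
      then show False using c'(1) by auto
    qed
    have "\<exists>\<delta>>0. \<forall>x\<in>S. x \<noteq> z \<longrightarrow> \<delta> \<le> dist z x" by (rule finite_set_avoid[OF finS])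
    then obtain \<delta>0 where \<delta>0: "\<delta>0 > 0" "\<And>x. x \<in> S \<Longrightarrow> x \<noteq> z \<Longrightarrow> \<delta>0 \<le> dist z x" by blast
    define \<delta> where "\<delta> = min (\<delta>0 / 2) (min (z - m) (M - z))"
    have \<delta>: "\<delta> > 0" "\<delta> < \<delta>0" "m \<le> z - \<delta>" "z + \<delta> \<le> M"
      using \<delta>0(1) zm by (auto simp: \<delta>_def min_def)
    let ?I = "{z - \<delta>..z + \<delta>}"
    have IS: "x = z" if "x \<in> ?I" "x \<in> S" for x
      using \<delta>0(2)[OF that(2)] that(1) \<delta>(2) by (cases "x = z") (auto simp: dist_real_def)
    \<comment> \<open>On \<open>?I\<close> there are no points of \<open>Sg\<close>, so
      \<open>p\<close> has constant sign and \<open>p z * ?g\<close> is positive on both sides of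
      \<open>z\<close>, where it touches 0.\<close>
    define p where "p = (\<lambda>x. e * (\<Prod>s\<in>Sg. x - s))"
    have pcont: "continuous_on ?I p" unfolding p_def by (intro continuous_intros)
    have pnz: "p x \<noteq> 0" if "x \<in> ?I" for x
    proof -
      have "x \<notin> Sg" using IS[OF that] z(2) Sg(1) by auto
      then have "(\<Prod>s\<in>Sg. x - s) \<noteq> 0" using finSg by auto
      then show ?thesis unfolding p_def using Sg(2) by auto
    qed
    have same: "0 < p x * p z" if "x \<in> ?I" for x
      by (rule continuous_nonzero_same_sign[OF pcont is_interval_cc pnz that]) (use \<delta>(1) in auto)
    have pg: "0 < p z * ?g x" if "x \<in> ?I" "x \<noteq> z" for x
    proof -
      have "x \<notin> S" using IS that by auto
      then have "?g x \<noteq> 0" using zeroset that(1) \<delta>(3,4) by auto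
      then have "0 < p x * ?g x" using Sg(3)[of x] that \<delta>(3,4) by (simp add: p_def mult_ac)
      then have "0 < (p x * ?g x) * (p x * p z)" using same[OF that(1)] by simp
      then have "0 < (p x)\<^sup>2 * (p z * ?g x)" by (simp add: power2_eq_square mult_ac)
      then show ?thesis by (simp add: zero_less_mult_iff)
    qed
    define x1 x2 where "x1 = z - \<delta>" and "x2 = z + \<delta>"
    have x12: "x1 \<in> ?I" "x2 \<in> ?I" "x1 < z" "z < x2" "m \<le> x1" using \<delta> by (auto simp: x1_def x2_def)
    \<comment> \<open>\<open>H\<close> exceeds the modulus of \<open>?h\<close> at both end points,
      so a coefficient \<eta> of modulus \<open>\<mu> / H\<close> leaves the perturbed trace
      positive there; the sign of \<eta> makes it negative at \<open>z\<close>.\<close>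
    define \<mu> H where "\<mu> = min (p z * ?g x1) (p z * ?g x2)" and "H = 1 + \<bar>?h x1\<bar> + \<bar>?h x2\<bar>"
    have "\<mu> > 0" unfolding \<mu>_def using pg[of x1] pg[of x2] x12 by simp
    have "H > 0" unfolding H_def by simp
    define \<eta> where "\<eta> = \<mu> / H * sgn (?h z)"
    have abs\<eta>: "\<bar>\<eta>\<bar> = \<mu> / H" using \<open>\<mu> > 0\<close> \<open>H > 0\<close> hz by (simp add: \<eta>_def abs_mult abs_sgn_eq)
    have small: "\<eta> * ?h x < \<mu>" if "x \<in> {x1, x2}" for x
    proof -
      have "\<eta> * ?h x \<le> \<bar>\<eta>\<bar> * \<bar>?h x\<bar>" by (simp add: abs_mult[symmetric])
      also have "\<dots> < \<bar>\<eta>\<bar> * H"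
        using that abs\<eta> \<open>\<mu> > 0\<close> \<open>H > 0\<close> by (intro mult_strict_left_mono) (auto simp: H_def)
      also have "\<dots> = \<mu>" using abs\<eta> \<open>H > 0\<close> by simp
      finally show ?thesis .
    qed
    define c2 where "c2 = (\<lambda>v. p z * c v + (- \<eta>) * c' v)"
    have f: "tr V c2 x = p z * ?g x + (- \<eta>) * ?h x" for x unfolding c2_def by (rule tr_linear)
    have f1: "0 < tr V c2 x1" "0 < tr V c2 x2"
      using small[of x1] small[of x2] by (auto simp: f \<mu>_def)
    have "0 < \<eta> * ?h z"
      using \<open>\<mu> > 0\<close> \<open>H > 0\<close> hz unfolding \<eta>_def
      by (cases "0 < ?h z") (auto simp: sgn_if intro!: divide_pos_pos mult_pos_neg divide_neg_pos)
    then have fz: "tr V c2 z < 0" using c(2)[OF z(1)] by (simp add: f)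
    obtain \<xi>1 where \<xi>1: "x1 \<le> \<xi>1" "\<xi>1 \<le> z" "tr V c2 \<xi>1 = 0"
      using IVT2'[of "tr V c2" z 0 x1] f1 fz x12 gcontA[of "{x1..z}" c2] by auto
    obtain \<xi>2 where \<xi>2: "z \<le> \<xi>2" "\<xi>2 \<le> x2" "tr V c2 \<xi>2 = 0"
      using IVT'[of "tr V c2" z 0 x2] f1 fz x12 gcontA[of "{z..x2}" c2] by auto
    have ne: "\<xi>1 \<noteq> z" "\<xi>2 \<noteq> z" using \<xi>1(3) \<xi>2(3) fz by auto
    have inI: "\<xi>1 \<in> ?I" "\<xi>2 \<in> ?I" using \<xi>1 \<xi>2 \<delta>(1) by (auto simp: x1_def x2_def)
    have nS: "\<xi>1 \<notin> S" "\<xi>2 \<notin> S" using IS inI ne by blast+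
    \<comment> \<open>Two zeros replace \<open>z\<close>, which gives \<open>card V - 1\<close> in
      all, the number that \<open>unique\<close> forbids.\<close>
    let ?X = "insert \<xi>1 (insert \<xi>2 (S - {z}))"
    have "\<xi>1 \<noteq> \<xi>2" using \<xi>1 \<xi>2 ne by auto
    then have cardX: "card ?X = Suc (card S)"
      using finS nS z(1) card_Suc_Diff1[OF finS z(1)] by simp
    have "nodes ?X"
      using nodes_subset[OF S(1), of "S - {z}"] inI \<delta>(3) m by (intro nodes_insert) auto
    moreover have "tr V c2 s = 0" if "s \<in> ?X" for s
      using that \<xi>1(3) \<xi>2(3) c(2) c'(3) by (auto simp: f)
    moreover have "(\<Sum>v\<in>V. q v * c2 v) = p z * (\<Sum>v\<in>V. q v * c v) + (- \<eta>) * (\<Sum>v\<in>V. q v * c' v)"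
      unfolding c2_def sum_distrib_left sum.distrib[symmetric]
      by (rule sum.cong) (auto simp: algebra_simps)
    ultimately have "\<forall>v\<in>V. c2 v = 0"
      using unique[of c2 ?X] cardX c(1) c'(2) by auto
    then show False using fz tr_zero[of V c2 z] by auto
  qed
  then show ?thesis using that[of e] Sg(2,3) zeroset by fastforce
qed

end

section \<open>Minimisers of a quadratic form on traces\<close>

text \<open>\<open>N\<close> stands for integration against \<nu> in the coordinate
  \<open>u\<close>; its interval lies to the right of the one on which \<open>Lam\<close>
  acts.\<close>

locale kernel_pair = cauchy_kernel Lam al be +
    N: pos_functional N a b "\<lambda>S. finite S \<and> card S < n"
  for Lam :: "(real \<Rightarrow> real) \<Rightarrow> real" and al be :: real
    and N :: "(real \<Rightarrow> real) \<Rightarrow> real" and a b :: real and n :: nat +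
  assumes be_less: "be < a"
begin

lemma trN_continuous: "nodes V \<Longrightarrow> continuous_on {a..b} (tr V d)"
  by (rule continuous_on_subset[OF tr_continuous[OF be_less]]) auto

lemma kN_continuous: "be < v \<Longrightarrow> continuous_on {a..b} (\<lambda>u. k u v)"
  by (rule continuous_on_subset[OF k_continuous[OF be_less]]) auto

text \<open>Entry \<open>v\<close> of the Gram matrix applied to \<open>y\<close>; the matrix
  entries are the values of \<open>N\<close> at products of two kernels.\<close>

definition gram :: "real set \<Rightarrow> (real \<Rightarrow> real) \<Rightarrow> real \<Rightarrow> real" where
  "gram V y v = N (\<lambda>u. tr V y u * k u v)"

lemma gram_sum:
  assumes "nodes V"
  shows "N (\<lambda>u. tr V y u * tr V c u) = (\<Sum>v\<in>V. c v * gram V y v)"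
proof -
  have cont: "continuous_on {a..b} (\<lambda>u. tr V y u * k u v)" if "v \<in> V" for v
    using assms that by (intro continuous_intros trN_continuous kN_continuous nodes_gt)
  have "N (\<lambda>u. tr V y u * tr V c u) = N (\<lambda>u. \<Sum>v\<in>V. c v * (tr V y u * k u v))"
    unfolding tr_def[of V c] sum_distrib_left by (simp add: mult_ac)
  also have "\<dots> = (\<Sum>v\<in>V. N (\<lambda>u. c v * (tr V y u * k u v)))"
    using cont nodes_finite[OF assms] by (intro N.L_sum continuous_on_mult_left) auto
  also have "\<dots> = (\<Sum>v\<in>V. c v * gram V y v)"
    unfolding gram_def by (rule sum.cong[OF refl]) (use cont in \<open>simp only: N.L_scale\<close>)
  finally show ?thesis .
qed

lemma gram_linear:
  assumes "nodes V" "v \<in> V"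
  shows "gram V (\<lambda>i. x * c i + y * d i) v = x * gram V c v + y * gram V d v"
proof -
  have cont: "continuous_on {a..b} (\<lambda>u. tr V d u * k u v)" for d
    using assms by (intro continuous_intros trN_continuous kN_continuous nodes_gt)
  have "gram V (\<lambda>i. x * c i + y * d i) v
      = N (\<lambda>u. x * (tr V c u * k u v) + y * (tr V d u * k u v))"
    unfolding gram_def tr_linear by (simp add: algebra_simps)
  also have "\<dots> = N (\<lambda>u. x * (tr V c u * k u v)) + N (\<lambda>u. y * (tr V d u * k u v))"
    using cont by (intro N.L_add continuous_on_mult_left)
  also have "\<dots> = x * gram V c v + y * gram V d v"
    unfolding gram_def using cont by (simp only: N.L_scale)
  finally show ?thesis .
qed

lemma trace_zero_set:
  assumes "nodes V" "\<exists>v\<in>V. d v \<noteq> 0"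
  shows "finite {x \<in> {a..b}. tr V d x = 0}" "card {x \<in> {a..b}. tr V d x = 0} < card V"
proof -
  let ?Z = "{x \<in> {a..b}. tr V d x = 0}"
  have no: False if "X \<subseteq> ?Z" "finite X" "card X = card V" for X
  proof -
    have "nodes X" using that be_less by (auto simp: nodes_def)
    then have "\<forall>v\<in>V. d v = 0" using tr_few_zeros[of X V d] that assms(1) by auto
    then show False using assms(2) by auto
  qed
  show fin: "finite ?Z" using no infinite_arbitrarily_large[of ?Z "card V"] by blast
  show "card ?Z < card V"
  proof (rule ccontr)
    assume "\<not> card ?Z < card V"
    then obtain X where "X \<subseteq> ?Z" "card X = card V" "finite X"
      using obtain_subset_with_card_n[of "card V" ?Z] by auto
    then show False using no by blast
  qed
qed

text \<open>The Chebyshev property leaves a nonzero trace fewer than \<open>n\<close> zeros, which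
  is exactly what the strict positivity of \<open>N\<close> tolerates.\<close>

lemma gram_pos:
  assumes "nodes V" "card V = n" "\<exists>v\<in>V. d v \<noteq> 0"
  shows "0 < (\<Sum>v\<in>V. d v * gram V d v)"
proof -
  have "0 < N (\<lambda>u. tr V d u * tr V d u)"
  proof (rule N.L_pos)
    show "continuous_on {a..b} (\<lambda>u. tr V d u * tr V d u)"
      by (intro continuous_intros trN_continuous assms(1))
    show "finite {x \<in> {a..b}. tr V d x * tr V d x = 0} \<and>
        card {x \<in> {a..b}. tr V d x * tr V d x = 0} < n"
      using trace_zero_set[OF assms(1,3)] assms(2) by simp
  qed auto
  then show ?thesis using gram_sum[OF assms(1)] by simp
qed

text \<open>With fewer than \<open>card V - 1\<close> zeros, the sign changes of the trace of
  \<open>y\<close> on \<open>{a..b}\<close> could be copied by a trace orthogonal to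
  \<open>q\<close>. Then \<open>N\<close> of the product of both traces would be nonzero, while
  \<open>gram_sum\<close> identifies it with the scalar product of \<open>q\<close> and
  \<open>c\<close>, which is 0.\<close>

lemma alternating_trace_zeros:
  assumes "nodes V" "card V = n" "alternating V q" "\<And>v. v \<in> V \<Longrightarrow> gram V y v = q v"
  obtains X where "X \<subseteq> {a..b}" "finite X" "card V = Suc (card X)" "\<And>x. x \<in> X \<Longrightarrow> tr V y x = 0"
proof -
  let ?f = "tr V y"
  let ?Z = "{x \<in> {a..b}. ?f x = 0}"
  have ynz: "\<exists>v\<in>V. y v \<noteq> 0"
  proof (rule ccontr)
    assume "\<not> ?thesis"
    then have "?f u = 0" for u by (intro tr_zero) auto
    then have "gram V y v = 0" for v unfolding gram_def by (simp add: N.L_zero)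
    then show False using assms(3,4) by (auto simp: alternating_def)
  qed
  note Z = trace_zero_set[OF assms(1) ynz]
  have fcont: "continuous_on {a..b} ?f" by (rule trN_continuous[OF assms(1)])
  have "card V = Suc (card ?Z)"
  proof (rule ccontr)
    assume "card V \<noteq> Suc (card ?Z)"
    then have less: "Suc (card ?Z) < card V" using Z(2) by simp
    obtain Sf ef where Sf: "Sf \<subseteq> ?Z" "ef \<in> {-1,1::real}"
        "\<And>x. x \<in> {a..b} \<Longrightarrow> ?f x \<noteq> 0 \<Longrightarrow> ef * ?f x * (\<Prod>s\<in>Sf. x - s) > 0"
      by (rule sign_changes[OF Z(1) fcont]) (rule that)
    have finSf: "finite Sf" using Sf(1) Z(1) finite_subset by auto
    have cardSf: "card Sf \<le> card ?Z" by (rule card_mono[OF Z(1) Sf(1)])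
    \<comment> \<open>\<open>sign_pattern_of_trace\<close> wants exactly \<open>card V - 2\<close>
      zeros, so the sign changes of \<open>?f\<close> are padded by points \<open>E\<close> to the
      right of \<open>{a..b}\<close>, whose factors have constant sign on that interval.\<close>
    let ?B = "max a b"
    obtain E where E: "finite E" "card E = card V - 2 - card Sf" "E \<subseteq> {?B + 1<..<?B + 2}"
      using infinite_arbitrarily_large[of "{?B + 1<..<?B + 2}" "card V - 2 - card Sf"] by auto
    define S where "S = Sf \<union> E"
    have disj: "Sf \<inter> E = {}" using Sf(1) E(3) by fastforce
    have cardS: "card V = card S + 2"
      unfolding S_def card_Un_disjoint[OF finSf E(1) disj] E(2) using cardSf less by linarith
    define m where "m = (be + a) / 2"
    have m: "be < m" "m < a" using be_less by (auto simp: m_def)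
    have Ssub: "S \<subseteq> {m<..<?B + 3}" using Sf(1) E(3) m by (fastforce simp: S_def)
    have nS: "nodes S" using Ssub m finSf E(1) by (auto simp: nodes_def S_def)
    obtain c where c: "\<exists>v\<in>V. c v \<noteq> 0" "(\<Sum>v\<in>V. q v * c v) = 0"
        "\<And>s. s \<in> S \<Longrightarrow> tr V c s = 0"
      using orthogonal_trace_exists[OF nS assms(1), of q] cardS by auto
    obtain eg where eg: "eg \<in> {-1,1::real}"
        "\<And>x. x \<in> {m..?B + 3} - S \<Longrightarrow> 0 < eg * tr V c x * (\<Prod>s\<in>S. x - s)"
      using sign_pattern_of_trace[OF nS Ssub m(1) assms(1) cardS assms(3) c(2,3,1)] by metis
    \<comment> \<open>The product of three signs: of \<open>?f\<close>, of the trace of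
      \<open>c\<close>, and of the padding factors.\<close>
    define \<kappa> where "\<kappa> = ef * eg * (-1) ^ card E"
    have pos: "0 < \<kappa> * (?f x * tr V c x)" if x: "x \<in> {a..b}" "?f x \<noteq> 0" for x
    proof -
      have "x \<notin> S" using x Sf(1) E(3) by (fastforce simp: S_def)
      then have g: "0 < eg * tr V c x * ((\<Prod>s\<in>Sf. x - s) * (\<Prod>s\<in>E. x - s))"
        using eg(2)[of x] x m unfolding S_def prod.union_disjoint[OF finSf E(1) disj] by auto
      have E': "(\<Prod>s\<in>E. x - s) = (-1) ^ card E * (\<Prod>s\<in>E. s - x)"
        unfolding prod_constant[symmetric] prod.distrib[symmetric] by simp
      have E0: "0 < (\<Prod>s\<in>E. s - x)" using x(1) E(3) by (intro prod_pos) fastforce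
      have f: "0 < ef * ?f x * (\<Prod>s\<in>Sf. x - s)" using Sf(3) x by auto
      have "0 < (ef * ?f x * (\<Prod>s\<in>Sf. x - s)) * (eg * tr V c x * ((\<Prod>s\<in>Sf. x - s) * (\<Prod>s\<in>E. x - s)))"
        by (rule mult_pos_pos[OF f g])
      also have "\<dots> = \<kappa> * (?f x * tr V c x) * ((\<Prod>s\<in>Sf. x - s)\<^sup>2 * (\<Prod>s\<in>E. s - x))"
        unfolding E' \<kappa>_def by (simp add: power2_eq_square mult_ac)
      finally show ?thesis using E0 by (auto simp: zero_less_mult_iff mult_less_0_iff)
    qed
    have cont: "continuous_on {a..b} (\<lambda>x. ?f x * tr V c x)"
      by (intro continuous_intros trN_continuous assms(1))
    have "0 < N (\<lambda>x. \<kappa> * (?f x * tr V c x))"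
    proof (rule N.L_pos)
      show "continuous_on {a..b} (\<lambda>x. \<kappa> * (?f x * tr V c x))"
        by (intro continuous_on_mult_left cont)
      show "0 \<le> \<kappa> * (?f x * tr V c x)" if "x \<in> {a..b}" for x
        using pos[OF that] by (cases "?f x = 0") auto
      have "{x \<in> {a..b}. \<kappa> * (?f x * tr V c x) = 0} \<subseteq> ?Z" using pos by force
      then show "finite {x \<in> {a..b}. \<kappa> * (?f x * tr V c x) = 0} \<and>
          card {x \<in> {a..b}. \<kappa> * (?f x * tr V c x) = 0} < n"
        using Z assms(2) by (meson card_mono finite_subset le_less_trans)
    qed
    also have "N (\<lambda>x. \<kappa> * (?f x * tr V c x)) = \<kappa> * N (\<lambda>x. ?f x * tr V c x)"
      by (rule N.L_scale[OF cont])
    also have "N (\<lambda>x. ?f x * tr V c x) = (\<Sum>v\<in>V. q v * c v)"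
      unfolding gram_sum[OF assms(1)] by (rule sum.cong) (auto simp: assms(4))
    finally show False using c(2) by simp
  qed
  then show ?thesis using Z(1) by (intro that[of ?Z]) blast+
qed

end

text \<open>A nonnegative parabola through the origin has slope 0 there. The step chosen in the
  proof is small enough for the linear term to outweigh the quadratic one.\<close>

lemma linear_coeff_zero_of_nonneg:
  fixes x y :: real
  assumes "\<And>e. 0 \<le> 2 * e * x + e\<^sup>2 * y"
  shows "x = 0"
proof (rule ccontr)
  assume "x \<noteq> 0"
  define e where "e = - x / (1 + \<bar>y\<bar>)"
  have "e\<^sup>2 * y \<le> e\<^sup>2 * (1 + \<bar>y\<bar>)" by (intro mult_left_mono) auto
  also have "\<dots> = - e * x" by (simp add: e_def power2_eq_square)
  finally have "0 \<le> e * x" using assms[of e] by linarith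
  moreover have "e * x < 0"
    using \<open>x \<noteq> 0\<close> by (simp add: e_def divide_less_0_iff power2_eq_square[symmetric] add_pos_nonneg)
  ultimately show False by simp
qed

section \<open>The inverse Gram matrix and the minimal eigenvector\<close>

context kernel_pair
begin

text \<open>One more unknown, multiplying \<open>- q\<close>, makes the system homogeneous with
  \<open>n + 1\<close> unknowns and \<open>n\<close> equations. In a nontrivial solution it cannot
  vanish, since \<open>gram_pos\<close> makes the Gram matrix injective.\<close>

lemma gram_surj:
  assumes "nodes V" "card V = n"
  obtains y where "\<And>v. v \<in> V \<Longrightarrow> gram V y v = q v"
proof -
  define M where "M = (\<lambda>e i. case i of None \<Rightarrow> - q e | Some v \<Rightarrow> N (\<lambda>u. k u v * k u e))"
  let ?I = "insert None (Some ` V)"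
  have finV: "finite V" by (rule nodes_finite[OF assms(1)])
  have "card ?I = Suc (card V)"
    using finV by (subst card_insert_disjoint) (auto simp: card_image)
  then obtain c where c: "\<exists>i\<in>?I. c i \<noteq> 0" "\<forall>e\<in>V. (\<Sum>i\<in>?I. c i * M e i) = 0"
    using homogeneous_system[of V ?I M] finV by auto
  define y where "y = (\<lambda>v. c (Some v))"
  have gram_eq: "gram V y e = (\<Sum>v\<in>V. y v * N (\<lambda>u. k u v * k u e))" if "e \<in> V" for e
  proof -
    have cont: "continuous_on {a..b} (\<lambda>u. k u v * k u e)" if "v \<in> V" for v
      using assms(1) that \<open>e \<in> V\<close> by (intro continuous_intros kN_continuous nodes_gt)
    have "gram V y e = N (\<lambda>u. \<Sum>v\<in>V. y v * (k u v * k u e))"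
      unfolding gram_def tr_def sum_distrib_right by (simp add: mult_ac)
    also have "\<dots> = (\<Sum>v\<in>V. N (\<lambda>u. y v * (k u v * k u e)))"
      using cont finV by (intro N.L_sum continuous_on_mult_left) auto
    also have "\<dots> = (\<Sum>v\<in>V. y v * N (\<lambda>u. k u v * k u e))"
      by (rule sum.cong[OF refl]) (use cont in \<open>simp only: N.L_scale\<close>)
    finally show ?thesis .
  qed
  have eq: "gram V y e = c None * q e" if "e \<in> V" for e
  proof -
    have "0 = (\<Sum>i\<in>?I. c i * M e i)" using c(2) that by simp
    also have "\<dots> = c None * M e None + (\<Sum>i\<in>Some ` V. c i * M e i)"
      using finV by (subst sum.insert) auto
    also have "(\<Sum>i\<in>Some ` V. c i * M e i) = gram V y e"
      unfolding gram_eq[OF that] by (subst sum.reindex) (auto simp: M_def y_def)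
    finally show ?thesis by (simp add: M_def)
  qed
  have "c None \<noteq> 0"
  proof
    assume 0: "c None = 0"
    then have "\<exists>v\<in>V. y v \<noteq> 0" using c(1) by (auto simp: y_def)
    from gram_pos[OF assms this] show False using eq 0 by simp
  qed
  then have "gram V (\<lambda>v. (1 / c None) * y v + 0 * y v) v = q v" if "v \<in> V" for v
    using gram_linear[OF assms(1) that, of "1 / c None" y 0 y] eq[OF that] by simp
  then show ?thesis using that by blast
qed

lemma gram_sym:
  assumes "nodes V"
  shows "(\<Sum>v\<in>V. c v * gram V y v) = (\<Sum>v\<in>V. y v * gram V c v)"
  unfolding gram_sum[OF assms, symmetric] by (simp add: mult.commute)

text \<open>The zeros from \<open>alternating_trace_zeros\<close> make the weights alternate
  strictly up to a common sign. That sign is the right one because the scalar product of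
  \<open>y\<close> and \<open>q\<close> is positive, so both agree in sign at some node.\<close>

lemma gram_inverse_alternates:
  assumes "nodes V" "card V = n" "alternating V q" "\<And>v. v \<in> V \<Longrightarrow> gram V y v = q v" "v \<in> V"
  shows "0 < y v * node_prod (V - {v}) v"
proof -
  let ?e = "\<lambda>v. node_prod (V - {v}) v"
  obtain X where X: "X \<subseteq> {a..b}" "finite X" "card V = Suc (card X)" "\<And>x. x \<in> X \<Longrightarrow> tr V y x = 0"
    using alternating_trace_zeros[OF assms(1-4)] by metis
  have "nodes X" using X(1,2) be_less by (auto simp: nodes_def)
  have "\<exists>v\<in>V. y v \<noteq> 0"
  proof (rule ccontr)
    assume "\<not> ?thesis"
    then have "gram V y v = 0" for v unfolding gram_def by (simp add: tr_zero N.L_zero)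
    then show False using assms(3,4) by (auto simp: alternating_def)
  qed
  then obtain \<kappa> where \<kappa>: "\<And>v. v \<in> V \<Longrightarrow> 0 < \<kappa> * (y v * ?e v)"
    using weights_alternate[OF \<open>nodes X\<close> assms(1) X(4) X(3)] by blast
  have "0 < (\<Sum>v\<in>V. y v * gram V y v)" by (rule gram_pos) (fact assms(1,2) \<open>\<exists>v\<in>V. y v \<noteq> 0\<close>)+
  also have "\<dots> = (\<Sum>v\<in>V. y v * q v)" by (rule sum.cong) (auto simp: assms(4))
  finally have "\<not> (\<forall>v\<in>V. y v * q v \<le> 0)"
    using sum_nonpos[of V "\<lambda>v. y v * q v"] by force
  then obtain i where i: "i \<in> V" "0 < y i * q i" by force
  have "0 \<le> q i * ?e i" using assms(3) i(1) by (auto simp: alternating_def)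
  moreover have "?e i \<noteq> 0" by (rule node_prod_self_nonzero[OF assms(1)])
  ultimately have "0 < y i * ?e i"
    using i(2) by (auto simp: zero_less_mult_iff zero_le_mult_iff)
  then have "0 < \<kappa>" using \<kappa>[OF i(1)] zero_less_mult_pos2 by blast
  then show ?thesis using \<kappa>[OF assms(5)] by (simp add: zero_less_mult_iff)
qed

text \<open>Lagrange multipliers on the sphere of a weighted norm: rescaling extends minimality to
  every \<open>c\<close>, and then the first variation vanishes in every direction. The multiplier
  \<rho> is the minimum itself, the smallest generalised eigenvalue.\<close>

lemma minimiser_eigenvector:
  assumes V: "nodes V" "card V = n" and W: "\<And>v. v \<in> V \<Longrightarrow> 0 < W v"
    and d: "(\<Sum>v\<in>V. W v * (d v)\<^sup>2) = 1"
    and min: "\<And>c. (\<Sum>v\<in>V. W v * (c v)\<^sup>2) = 1 \<Longrightarrow>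
      N (\<lambda>u. (tr V d u)\<^sup>2) \<le> N (\<lambda>u. (tr V c u)\<^sup>2)"
  obtains \<rho> where "0 < \<rho>" "\<And>v. v \<in> V \<Longrightarrow> gram V d v = \<rho> * (W v * d v)"
    "\<And>c. \<rho> * (\<Sum>v\<in>V. W v * (c v)\<^sup>2) \<le> (\<Sum>v\<in>V. c v * gram V c v)"
proof -
  have finV: "finite V" by (rule nodes_finite[OF V(1)])
  let ?B = "\<lambda>c d. \<Sum>v\<in>V. c v * gram V d v"
  let ?W = "\<lambda>c d. \<Sum>v\<in>V. W v * (c v * d v)"
  have N: "N (\<lambda>u. (tr V c u)\<^sup>2) = ?B c c" for c
    using gram_sum[OF V(1), of c c] by (simp add: power2_eq_square)
  define \<rho> where "\<rho> = ?B d d"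
  have dn: "\<exists>v\<in>V. d v \<noteq> 0" using d by (rule contrapos_pp) auto
  have "0 < \<rho>" unfolding \<rho>_def by (rule gram_pos[OF V dn])
  have Bexp: "?B (\<lambda>v. x * c v + y * f v) (\<lambda>v. x * c v + y * f v)
      = x\<^sup>2 * ?B c c + 2 * x * y * ?B f c + y\<^sup>2 * ?B f f" for x y c f
  proof -
    have "?B (\<lambda>v. x * c v + y * f v) (\<lambda>v. x * c v + y * f v)
       = (\<Sum>v\<in>V. (x * c v + y * f v) * (x * gram V c v + y * gram V f v))"
      by (rule sum.cong[OF refl]) (simp add: gram_linear[OF V(1)])
    also have "\<dots> = x\<^sup>2 * ?B c c + x * y * ?B f c + x * y * ?B c f + y\<^sup>2 * ?B f f"
      unfolding sum_distrib_left sum.distrib[symmetric]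
      by (rule sum.cong) (auto simp: algebra_simps power2_eq_square)
    finally show ?thesis using gram_sym[OF V(1), of c f] by simp
  qed
  have Wexp: "?W (\<lambda>v. x * c v + y * f v) (\<lambda>v. x * c v + y * f v)
      = x\<^sup>2 * ?W c c + 2 * x * y * ?W f c + y\<^sup>2 * ?W f f" for x y c f
    unfolding sum_distrib_left sum.distrib[symmetric]
    by (rule sum.cong) (auto simp: algebra_simps power2_eq_square)
  have low: "\<rho> * ?W c c \<le> ?B c c" for c
  proof (cases "\<exists>v\<in>V. c v \<noteq> 0")
    case True
    then obtain i where i: "i \<in> V" "c i \<noteq> 0" by auto
    have pos: "0 < ?W c c"
      using W i finV by (intro sum_pos2[of V i]) (auto simp: zero_less_mult_iff less_imp_le)
    define s where "s = 1 / sqrt (?W c c)"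
    have s2: "s\<^sup>2 * ?W c c = 1" using pos by (simp add: s_def power_divide)
    have "(\<Sum>v\<in>V. W v * (s * c v + 0 * c v)\<^sup>2) = s\<^sup>2 * ?W c c"
      using Wexp[of s c 0 c] by (simp add: power2_eq_square)
    then have "\<rho> \<le> ?B (\<lambda>v. s * c v + 0 * c v) (\<lambda>v. s * c v + 0 * c v)"
      unfolding \<rho>_def N[symmetric] using s2 by (intro min) simp
    also have "\<dots> = s\<^sup>2 * ?B c c" using Bexp[of s c 0 c] by simp
    finally have "\<rho> * ?W c c \<le> s\<^sup>2 * ?B c c * ?W c c" using pos by (intro mult_right_mono) auto
    also have "\<dots> = (s\<^sup>2 * ?W c c) * ?B c c" by (simp add: mult_ac)
    finally show ?thesis unfolding s2 by simp
  next
    case False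
    then have "?W c c = 0" "?B c c = 0" by simp_all
    then show ?thesis by simp
  qed
  have stat: "?B c d = \<rho> * ?W c d" for c
  proof -
    have "?B c d - \<rho> * ?W c d = 0"
    proof (rule linear_coeff_zero_of_nonneg)
      fix e
      have "0 \<le> ?B (\<lambda>v. 1 * d v + e * c v) (\<lambda>v. 1 * d v + e * c v)
          - \<rho> * ?W (\<lambda>v. 1 * d v + e * c v) (\<lambda>v. 1 * d v + e * c v)"
        using low by simp
      also have "\<dots> = (?B d d - \<rho> * ?W d d) + 2 * e * (?B c d - \<rho> * ?W c d)
          + e\<^sup>2 * (?B c c - \<rho> * ?W c c)"
        unfolding Bexp Wexp by (simp add: algebra_simps)
      also have "?B d d - \<rho> * ?W d d = 0" using d by (simp add: \<rho>_def power2_eq_square)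
      finally show "0 \<le> 2 * e * (?B c d - \<rho> * ?W c d) + e\<^sup>2 * (?B c c - \<rho> * ?W c c)" by simp
    qed
    then show ?thesis by simp
  qed
  show ?thesis
  proof (rule that[OF \<open>0 < \<rho>\<close>])
    fix v assume v: "v \<in> V"
    have "?B (\<lambda>i. if i = v then 1 else 0) d = (\<Sum>i\<in>V. if i = v then gram V d i else 0)"
      "?W (\<lambda>i. if i = v then 1 else 0) d = (\<Sum>i\<in>V. if i = v then W i * d i else 0)"
      by (rule sum.cong; auto)+
    then show "gram V d v = \<rho> * (W v * d v)"
      using stat[of "\<lambda>i. if i = v then 1 else 0"] v finV by simp
  next
    show "\<rho> * (\<Sum>v\<in>V. W v * (c v)\<^sup>2) \<le> ?B c c" for c
      using low[of c] by (simp add: power2_eq_square)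
  qed
qed

text \<open>A Perron--Frobenius argument: by \<open>gram_inverse_alternates\<close> the inverse Gram matrix is
  strictly positive after conjugation with the sign pattern of \<open>node_prod (V - {v}) v\<close>, so
  that an eigenvector for its largest eigenvalue cannot mix both sign patterns.\<close>

theorem minimiser_trace_zeros:
  assumes V: "nodes V" "card V = n" and W: "\<And>v. v \<in> V \<Longrightarrow> 0 < W v"
    and d: "(\<Sum>v\<in>V. W v * (d v)\<^sup>2) = 1"
    and min: "\<And>c. (\<Sum>v\<in>V. W v * (c v)\<^sup>2) = 1 \<Longrightarrow>
      N (\<lambda>u. (tr V d u)\<^sup>2) \<le> N (\<lambda>u. (tr V c u)\<^sup>2)"
  obtains X where "X \<subseteq> {a..b}" "finite X" "card V = Suc (card X)" "\<And>x. x \<in> X \<Longrightarrow> tr V d x = 0"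
proof -
  obtain \<rho> where \<rho>: "0 < \<rho>" "\<And>v. v \<in> V \<Longrightarrow> gram V d v = \<rho> * (W v * d v)"
      "\<And>c. \<rho> * (\<Sum>v\<in>V. W v * (c v)\<^sup>2) \<le> (\<Sum>v\<in>V. c v * gram V c v)"
    using minimiser_eigenvector[OF assms] by blast
  have finV: "finite V" by (rule nodes_finite[OF V(1)])
  let ?e = "\<lambda>v. node_prod (V - {v}) v"
  \<comment> \<open>\<open>d = p - m\<close> splits \<open>d\<close> by the two opposite sign
    patterns; both \<open>p\<close> and \<open>m\<close> satisfy the weak inequalities of
    \<open>alternating\<close>.\<close>
  define p where "p = (\<lambda>v. if 0 \<le> d v * ?e v then d v else 0)"
  define m where "m = (\<lambda>v. p v - d v)"
  have pe: "0 \<le> p v * ?e v" and me: "0 \<le> m v * ?e v" for v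
    by (auto simp: p_def m_def)
  have dpm: "d v = p v - m v" for v by (simp add: m_def)
  have alt: "alternating V (\<lambda>v. W v * f v)" if "\<And>v. 0 \<le> f v * ?e v" "\<exists>v\<in>V. f v \<noteq> 0" for f
    unfolding alternating_def
  proof (intro conjI ballI)
    fix v assume "v \<in> V"
    then show "0 \<le> W v * f v * ?e v" using W[of v] that(1)[of v] by (simp add: mult.assoc)
  next
    show "\<exists>v\<in>V. W v * f v \<noteq> 0" using that(2) W by force
  qed
  have dn: "\<exists>v\<in>V. d v \<noteq> 0" using d by (rule contrapos_pp) auto
  \<comment> \<open>In the first two cases \<open>d\<close> or its negative is alternating, so
    \<open>alternating_trace_zeros\<close> applies directly. The mixed case is refuted.\<close>
  consider "\<forall>v\<in>V. m v = 0" | "\<forall>v\<in>V. p v = 0" | "\<exists>v\<in>V. p v \<noteq> 0" "\<exists>v\<in>V. m v \<noteq> 0" by blast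
  then show ?thesis
  proof cases
    case 1
    have g: "gram V d v = W v * (\<rho> * p v)" if "v \<in> V" for v
      using \<rho>(2)[OF that] 1 that dpm[of v] by simp
    have "alternating V (\<lambda>v. W v * (\<rho> * p v))"
      using pe \<rho>(1) dn 1 dpm by (intro alt) (auto simp: mult.assoc)
    then show ?thesis by (rule alternating_trace_zeros[OF V _ g]) (assumption, rule that)
  next
    case 2
    have dm: "(0::real) * d v + (-1) * d v = - d v" for v by simp
    have g: "gram V (\<lambda>v. 0 * d v + (-1) * d v) v = W v * (\<rho> * m v)" if "v \<in> V" for v
      unfolding gram_linear[OF V(1) that] using \<rho>(2)[OF that] 2 that dpm[of v] by simp
    have "alternating V (\<lambda>v. W v * (\<rho> * m v))"
      using me \<rho>(1) dn 2 dpm by (intro alt) (auto simp: mult.assoc)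
    then obtain X where X: "X \<subseteq> {a..b}" "finite X" "card V = Suc (card X)"
        "\<And>x. x \<in> X \<Longrightarrow> tr V (\<lambda>v. 0 * d v + (-1) * d v) x = 0"
      by (rule alternating_trace_zeros[OF V _ g]) (assumption, rule that)
    have "tr V d x = 0" if "x \<in> X" for x using X(4)[OF that] unfolding tr_linear by simp
    then show ?thesis by (rule that[OF X(1-3)])
  next
    case 3
    obtain yp where yp: "\<And>v. v \<in> V \<Longrightarrow> gram V yp v = W v * p v"
      by (rule gram_surj[OF V, of "\<lambda>v. W v * p v"]) (rule that)
    obtain ym where ym: "\<And>v. v \<in> V \<Longrightarrow> gram V ym v = W v * m v"
      by (rule gram_surj[OF V, of "\<lambda>v. W v * m v"]) (rule that)
    have ype: "0 < yp v * ?e v" if "v \<in> V" for v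
      by (rule gram_inverse_alternates[OF V alt yp that]) (use pe 3 in auto)
    have yme: "0 < ym v * ?e v" if "v \<in> V" for v
      by (rule gram_inverse_alternates[OF V alt ym that]) (use me 3 in auto)
    have d_eq: "d v = \<rho> * (yp v - ym v)" if "v \<in> V" for v
    proof (rule ccontr)
      define f where "f = (\<lambda>v. 1 * d v + (- \<rho>) * (1 * yp v + (-1) * ym v))"
      assume "d v \<noteq> \<rho> * (yp v - ym v)"
      then have "\<exists>v\<in>V. f v \<noteq> 0" using that by (auto simp: f_def)
      moreover have "gram V f v = 0" if "v \<in> V" for v
        unfolding f_def gram_linear[OF V(1) that] \<rho>(2)[OF that] yp[OF that] ym[OF that]
        by (simp add: m_def algebra_simps)
      ultimately show False using gram_pos[OF V, of f] by simp
    qed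
    \<comment> \<open>\<open>x\<close> plays the role of the absolute value of \<open>d\<close>, and
      \<open>y\<close> is the preimage of \<open>W v * x v\<close> under the Gram matrix. As
      \<open>yp\<close> and \<open>ym\<close> have the same strict signs, their sum exceeds their
      difference in modulus, so \<rho> times \<open>y\<close> strictly exceeds \<open>d\<close> in
      modulus at every node.\<close>
    define y where "y = (\<lambda>v. 1 * yp v + 1 * ym v)"
    define x where "x = (\<lambda>v. p v + m v)"
    have gy: "gram V y v = W v * x v" if "v \<in> V" for v
      unfolding y_def gram_linear[OF V(1) that] yp[OF that] ym[OF that]
      by (simp add: x_def algebra_simps)
    have x2: "(x v)\<^sup>2 = (d v)\<^sup>2" for v by (auto simp: x_def m_def p_def)
    have less: "(d v)\<^sup>2 < \<rho>\<^sup>2 * (y v)\<^sup>2" if "v \<in> V" for v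
    proof -
      have "0 < (yp v * ym v) * (?e v)\<^sup>2"
        using mult_pos_pos[OF ype yme, OF that that] by (simp add: power2_eq_square mult_ac)
      then have "0 < yp v * ym v" by (simp add: zero_less_mult_iff)
      then have "(yp v - ym v)\<^sup>2 < (y v)\<^sup>2" by (simp add: y_def power2_eq_square algebra_simps)
      then show ?thesis using d_eq[OF that] \<rho>(1) by (simp add: power_mult_distrib)
    qed
    define Y where "Y = (\<Sum>v\<in>V. W v * (y v)\<^sup>2)"
    have "V \<noteq> {}" using dn by auto
    have "1 < (\<Sum>v\<in>V. W v * (\<rho>\<^sup>2 * (y v)\<^sup>2))"
      unfolding d[symmetric] using less W by (intro sum_strict_mono finV \<open>V \<noteq> {}\<close>) auto
    also have "\<dots> = \<rho>\<^sup>2 * Y" unfolding Y_def sum_distrib_left by (simp add: mult_ac)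
    finally have Y: "1 < \<rho>\<^sup>2 * Y" .
    \<comment> \<open>Minimality of \<rho> bounds the weighted norm of \<open>y\<close> by its
      scalar product with \<open>x\<close>; the nonnegative square of \<open>x - \<rho> * y\<close>
      then yields \<open>\<rho>\<^sup>2 * Y\<close> \<le> 1, against the strict inequality
      above.\<close>
    have "\<rho> * Y \<le> (\<Sum>v\<in>V. y v * gram V y v)" unfolding Y_def by (rule \<rho>(3))
    also have "\<dots> = (\<Sum>v\<in>V. W v * (x v * y v))" by (rule sum.cong) (auto simp: gy)
    finally have "2 * \<rho> * (\<rho> * Y) \<le> 2 * \<rho> * (\<Sum>v\<in>V. W v * (x v * y v))"
      using \<rho>(1) by (intro mult_left_mono) auto
    moreover have "0 \<le> (\<Sum>v\<in>V. W v * (x v - \<rho> * y v)\<^sup>2)"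
      using W by (intro sum_nonneg) (auto simp: less_imp_le)
    moreover have "(\<Sum>v\<in>V. W v * (x v - \<rho> * y v)\<^sup>2)
        = (\<Sum>v\<in>V. W v * (x v)\<^sup>2) - 2 * \<rho> * (\<Sum>v\<in>V. W v * (x v * y v)) + \<rho>\<^sup>2 * Y"
      unfolding Y_def sum_distrib_left sum_subtractf[symmetric] sum.distrib[symmetric]
      by (rule sum.cong) (auto simp: power2_eq_square algebra_simps)
    moreover have "(\<Sum>v\<in>V. W v * (x v)\<^sup>2) = 1" using d by (simp add: x2)
    moreover have "2 * \<rho> * (\<rho> * Y) = 2 * (\<rho>\<^sup>2 * Y)" by (simp add: power2_eq_square)
    ultimately have "\<rho>\<^sup>2 * Y \<le> 1" by linarith
    then show ?thesis using Y by simp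
  qed
qed

end

section \<open>The interpolant\<close>

context cauchy_kernel
begin

text \<open>At a zero \<open>\<zeta>\<close> of the denominator, the numerator is (up to positive factors) the value of the
  functional at the square of the cofactor \<open>r\<close>, divided by \<open>r(\<zeta>)\<close>: the orthogonality relations
  allow one to replace factors of the integrand by their values at \<open>\<zeta>\<close>.\<close>

lemma numerator_at_zero:
  assumes X: "nodes X" and V: "nodes V" "card V = Suc (card X)"
    and tr0: "\<And>x. x \<in> X \<Longrightarrow> tr V d x = 0"
    and Z: "Z \<subseteq> {al..be}" "finite Z" "card Z = card X" "\<kappa> \<noteq> 0"
    and p: "node_poly V d = smult \<kappa> (\<Prod>z\<in>Z. [:z, -1:])"
    and \<Phi>: "\<And>u v. u \<in> V \<Longrightarrow> v \<in> V \<Longrightarrow> \<Phi> u - \<Phi> v = (u - v) * k u v"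
    and \<zeta>: "\<zeta> \<in> Z"
  shows "0 < poly (node_poly V (\<lambda>v. d v * \<Phi> v)) \<zeta> * (\<kappa> * node_prod (Z - {\<zeta>}) \<zeta>)"
proof -
  have finV: "finite V" by (rule nodes_finite[OF V(1)])
  let ?r = "\<Prod>z\<in>Z - {\<zeta>}. [:z, -1:]" and ?p = "node_poly V d"
  let ?nX = "\<Prod>x\<in>X. [:x, -1:]" and ?nV = "node_prod V"
  have p': "?p = smult \<kappa> ([:\<zeta>, -1:] * ?r)"
    unfolding p by (subst prod.remove[OF Z(2) \<zeta>]) simp
  have \<zeta>I: "\<zeta> \<in> {al..be}" using Z(1) \<zeta> by auto
  have \<zeta>V: "\<zeta> \<notin> V" "v - \<zeta> \<noteq> 0" if "v \<in> V" for v
    using \<zeta>I nodes_gt[OF V(1)] that by force+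
  have nV: "0 < ?nV w" "0 < node_prod X w" if "w \<in> {al..be}" for w
    using node_prod_pos[OF V(1) that] node_prod_pos[OF X that] by auto
  have rz: "poly ?r \<zeta> \<noteq> 0" unfolding poly_prod_node using Z(2) by (intro node_prod_nonzero) auto
  have r0: "?r \<noteq> 0" using rz by auto
  have Vne: "V \<noteq> {}" using V(2) by auto
  then obtain y where y: "y \<in> V" by auto
  have sum0: "(\<Sum>v\<in>V. d v / (v - \<zeta>)) = 0"
    using partial_fractions_node_poly[of V \<zeta> d] finV \<zeta>V y p' by auto
  \<comment> \<open>Dividing \<open>?p\<close> by its factor at \<zeta> amounts, up to sign, to
    dividing each weight by \<open>v - \<zeta>\<close>. This gives partial fractions for the
    cofactor \<open>?r\<close>.\<close>
  define S where "S = node_poly V (\<lambda>v. d v / (v - \<zeta>))"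
  have S: "S = smult (- \<kappa>) ?r"
  proof -
    have "poly ([:\<zeta>, -1:] * S) w = poly ([:\<zeta>, -1:] * smult (- \<kappa>) ?r) w" for w
    proof -
      have "poly ([:\<zeta>, -1:] * S) w = (\<zeta> - w) * poly S w" by (simp add: algebra_simps)
      also have "\<dots> = (\<Sum>v\<in>V. (\<zeta> - w) * (d v / (v - \<zeta>) * node_prod (V - {v}) w))"
        unfolding S_def poly_node_poly sum_distrib_left ..
      also have "\<dots> = (\<Sum>v\<in>V. d v / (v - \<zeta>) * ?nV w - d v * node_prod (V - {v}) w)"
      proof (rule sum.cong[OF refl])
        fix v assume v: "v \<in> V"
        show "(\<zeta> - w) * (d v / (v - \<zeta>) * node_prod (V - {v}) w)
            = d v / (v - \<zeta>) * ?nV w - d v * node_prod (V - {v}) w"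
          unfolding node_prod_remove[OF finV v, of w]
          using \<zeta>V(2)[OF v] by (simp add: field_simps)
      qed
      also have "\<dots> = (\<Sum>v\<in>V. d v / (v - \<zeta>)) * ?nV w - poly ?p w"
        unfolding sum_subtractf sum_distrib_right poly_node_poly ..
      finally show ?thesis unfolding sum0 p' by simp
    qed
    then have "[:\<zeta>, -1:] * S = [:\<zeta>, -1:] * smult (- \<kappa>) ?r" 
      unfolding poly_eq_poly_eq_iff[symmetric] by (rule ext)
    then show ?thesis by (subst (asm) mult_left_cancel) auto
  qed
  have nodes_y: "nodes {y}" using V(1) y by (auto simp: nodes_def)
  have e: "nodes {}" by (simp add: nodes_def)
  \<comment> \<open>The numbers \<open>d v / (v - \<zeta>)\<close> have sum 0, so \<Phi> may be
    replaced by its difference from the value at a fixed node \<open>y\<close>, and this difference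
    is given by the kernel.\<close>
  have "poly (node_poly V (\<lambda>v. d v * \<Phi> v)) \<zeta> / ?nV \<zeta> = (\<Sum>v\<in>V. d v * \<Phi> v / (v - \<zeta>))"
    by (rule partial_fractions_node_poly[symmetric]) (use finV \<zeta>V y in auto)
  also have "\<dots> = (\<Sum>v\<in>V. d v * (v - y) / (v - \<zeta>) * k v y) + \<Phi> y * (\<Sum>v\<in>V. d v / (v - \<zeta>))"
    unfolding sum_distrib_left sum.distrib[symmetric]
  proof (rule sum.cong[OF refl])
    fix v assume v: "v \<in> V"
    have \<Phi>v: "\<Phi> v = \<Phi> y + (v - y) * k v y" using \<Phi>[OF v y] by simp
    show "d v * \<Phi> v / (v - \<zeta>) = d v * (v - y) / (v - \<zeta>) * k v y + \<Phi> y * (d v / (v - \<zeta>))"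
      unfolding \<Phi>v distrib_left add_divide_distrib by (simp add: mult_ac)
  qed
  also have "\<dots> = (\<Sum>v\<in>V. Lam (\<lambda>w. d v * (v - y) / (v - \<zeta>) * (1 / ((v - w) * (y - w)))))"
    unfolding sum0 k_def using nodes_gt[OF V(1)] y
    by (simp add: L_scale[OF cauchy_continuous] del: times_divide_eq_left times_divide_eq_right
        cong: sum.cong)
  also have "\<dots> = Lam (\<lambda>w. \<Sum>v\<in>V. d v * (v - y) / (v - \<zeta>) * (1 / ((v - w) * (y - w))))"
    using nodes_gt[OF V(1)] y finV
    by (intro L_sum[symmetric] continuous_on_mult_left cauchy_continuous) auto
  also have "\<dots> = Lam (\<lambda>w. \<kappa> * (poly ?r w / (node_prod {} w * ?nV w)))"
  proof (rule L_cong)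
    fix w assume w: "w \<in> {al..be}"
    have wV: "w \<notin> V" "v - w \<noteq> 0" if "v \<in> V" for v using w nodes_gt[OF V(1)] that by force+
    have yw: "y - w \<noteq> 0" using wV y by auto
    have "(\<Sum>v\<in>V. d v * (v - y) / (v - \<zeta>) * (1 / ((v - w) * (y - w))))
        = (\<Sum>v\<in>V. (1 / (y - w)) * (d v / (v - \<zeta>)) - (d v / (v - \<zeta>)) / (v - w))"
    proof (rule sum.cong[OF refl])
      fix v assume v: "v \<in> V"
      show "d v * (v - y) / (v - \<zeta>) * (1 / ((v - w) * (y - w)))
          = (1 / (y - w)) * (d v / (v - \<zeta>)) - (d v / (v - \<zeta>)) / (v - w)"
        using \<zeta>V(2)[OF v] wV(2)[OF v] yw by (simp add: divide_simps) (simp add: algebra_simps)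
    qed
    also have "\<dots> = - (\<Sum>v\<in>V. (d v / (v - \<zeta>)) / (v - w))"
      unfolding sum_subtractf sum_distrib_left[symmetric] sum0 by simp
    also have "\<dots> = - (poly S w / ?nV w)"
      unfolding S_def by (subst partial_fractions_node_poly) (use finV wV y in auto)
    finally show "(\<Sum>v\<in>V. d v * (v - y) / (v - \<zeta>) * (1 / ((v - w) * (y - w))))
        = \<kappa> * (poly ?r w / (node_prod {} w * ?nV w))"
      unfolding S by (simp add: node_prod_def)
  qed
  also have "\<dots> = \<kappa> * Lam (\<lambda>w. poly ?r w / (node_prod {} w * ?nV w))"
    by (rule L_scale[OF quotient_continuous[OF e V(1)]])
  \<comment> \<open>Expanding the fraction by \<open>node_prod X\<close> produces the weight of the
    orthogonality relations.\<close>
  also have "Lam (\<lambda>w. poly ?r w / (node_prod {} w * ?nV w))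
      = Lam (\<lambda>w. poly (?nX * ?r) w / (node_prod X w * ?nV w))"
  proof (rule L_cong)
    fix w assume "w \<in> {al..be}"
    then show "poly ?r w / (node_prod {} w * ?nV w) = poly (?nX * ?r) w / (node_prod X w * ?nV w)"
      using nV(2)[of w] by (simp add: poly_prod_node) (simp add: node_prod_def)
  qed
  finally have Q: "poly (node_poly V (\<lambda>v. d v * \<Phi> v)) \<zeta> / ?nV \<zeta>
      = \<kappa> * Lam (\<lambda>w. poly (?nX * ?r) w / (node_prod X w * ?nV w))" .
  have cardX: "0 < card X" using Z(2,3) \<zeta> by (metis card_gt_0_iff empty_iff)
  \<comment> \<open>Subtracting from \<open>q\<close> its value at \<zeta> leaves a multiple of the
    linear factor at \<zeta>. Times \<open>?r\<close> this is a multiple of \<open>?p\<close> by a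
    polynomial of degree below \<open>card X\<close>, so the functional does not see it.\<close>
  have reduce: "Lam (\<lambda>w. poly (q * ?r) w / (node_prod X w * ?nV w))
      = poly q \<zeta> * Lam (\<lambda>w. poly ?r w / (node_prod X w * ?nV w))" if q: "degree q \<le> card X" for q
  proof -
    obtain s where s: "q = [:poly q \<zeta>:] + [:\<zeta>, -1:] * s" "degree s \<le> degree q - 1"
      by (rule poly_eq_value_plus_root)
    have "degree s < card X" using s(2) q cardX by linarith
    then have 0: "Lam (\<lambda>w. poly (s * ?p) w / (node_prod X w * ?nV w)) = 0"
      by (intro tr_zeros_orthogonal X V(1) tr0)
    have "Lam (\<lambda>w. poly (q * ?r) w / (node_prod X w * ?nV w))
        = Lam (\<lambda>w. poly q \<zeta> * (poly ?r w / (node_prod X w * ?nV w))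
            + (1 / \<kappa>) * (poly (s * ?p) w / (node_prod X w * ?nV w)))"
    proof (rule L_cong)
      fix w assume "w \<in> {al..be}"
      have qw: "poly q w = poly q \<zeta> + (\<zeta> - w) * poly s w"
        by (subst s(1)) (simp add: algebra_simps)
      have "poly (q * ?r) w = poly q \<zeta> * poly ?r w + (1 / \<kappa>) * poly (s * ?p) w"
        unfolding p' poly_mult qw using Z(4) by (simp add: algebra_simps)
      then show "poly (q * ?r) w / (node_prod X w * ?nV w)
          = poly q \<zeta> * (poly ?r w / (node_prod X w * ?nV w))
            + (1 / \<kappa>) * (poly (s * ?p) w / (node_prod X w * ?nV w))"
        by (simp add: add_divide_distrib)
    qed
    also have "\<dots> = poly q \<zeta> * Lam (\<lambda>w. poly ?r w / (node_prod X w * ?nV w))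
        + (1 / \<kappa>) * Lam (\<lambda>w. poly (s * ?p) w / (node_prod X w * ?nV w))"
      by (simp only: L_add[OF continuous_on_mult_left[OF quotient_continuous[OF X V(1)]]
            continuous_on_mult_left[OF quotient_continuous[OF X V(1)]]]
          L_scale[OF quotient_continuous[OF X V(1)]])
    finally show ?thesis unfolding 0 by simp
  qed
  define \<Lambda> where "\<Lambda> = Lam (\<lambda>w. poly ?r w / (node_prod X w * ?nV w))"
  have degr: "degree ?r \<le> card X"
    unfolding degree_prod_node using Z(2,3) card_mono[of Z "Z - {\<zeta>}"] by auto
  \<comment> \<open>\<open>reduce\<close> serves twice: for \<open>?r\<close> it gives \<Lambda> the
    sign of \<open>poly ?r \<zeta>\<close>, and for \<open>?nX\<close> it evaluates the
    numerator.\<close>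
  have "0 < Lam (\<lambda>w. poly (?r * ?r) w / (node_prod X w * ?nV w))"
    using r0 by (intro quotient_pos X V(1)) auto
  then have r\<Lambda>: "0 < poly ?r \<zeta> * \<Lambda>" unfolding reduce[OF degr] \<Lambda>_def .
  have "poly (node_poly V (\<lambda>v. d v * \<Phi> v)) \<zeta> = ?nV \<zeta> * (\<kappa> * (node_prod X \<zeta> * \<Lambda>))"
    using Q nV[OF \<zeta>I] reduce[of ?nX] unfolding degree_prod_node \<Lambda>_def
    by (simp add: poly_prod_node field_simps)
  then have "poly (node_poly V (\<lambda>v. d v * \<Phi> v)) \<zeta> * (\<kappa> * poly ?r \<zeta>)
      = \<kappa>\<^sup>2 * (?nV \<zeta> * node_prod X \<zeta>) * (poly ?r \<zeta> * \<Lambda>)"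
    by (simp add: power2_eq_square mult_ac)
  also have "\<dots> > 0" using nV[OF \<zeta>I] Z(4) by (intro mult_pos_pos[OF _ r\<Lambda>]) simp
  finally show ?thesis unfolding poly_prod_node .
qed

text \<open>The quotient of the two polynomials at \<open>u\<close> is \<Phi> y plus
  \<open>u - y\<close> times the sum of \<open>mu z / (u - z)\<close>, a discrete counterpart of the
  formula for \<Phi>. The masses are positive by \<open>numerator_at_zero\<close>. At a second node
  \<open>t\<close> the quotient interpolates, so the sum of \<open>mu z / (t - z)\<close> is
  \<open>k t y\<close>; and \<open>t - z\<close> \<le> \<open>t - al\<close> bounds the total
  mass.\<close>

lemma interpolant_structure:
  assumes X: "nodes X" and V: "nodes V" "card V = Suc (card X)"
    and tr0: "\<And>x. x \<in> X \<Longrightarrow> tr V d x = 0"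
    and d: "\<exists>v\<in>V. d v \<noteq> 0"
    and \<Phi>: "\<And>u v. u \<in> V \<Longrightarrow> v \<in> V \<Longrightarrow> \<Phi> u - \<Phi> v = (u - v) * k u v"
    and bound: "\<And>u v. u \<in> V \<Longrightarrow> v \<in> V \<Longrightarrow> (u - al) * k u v \<le> C" "0 \<le> C"
  obtains Z \<kappa> where "Z \<subseteq> {al..be}" "finite Z" "card Z = card X" "\<kappa> \<noteq> 0"
    "node_poly V d = smult \<kappa> (\<Prod>z\<in>Z. [:z, -1:])"
    "\<And>z. z \<in> Z \<Longrightarrow> poly (node_poly V (\<lambda>v. d v * \<Phi> v)) z \<noteq> 0"
    "\<And>y. y \<in> V \<Longrightarrow> \<exists>mu. (\<forall>z\<in>Z. 0 \<le> mu z) \<and> (\<Sum>z\<in>Z. mu z) \<le> C \<and>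
      node_poly V (\<lambda>v. d v * \<Phi> v)
        = smult \<kappa> (smult (\<Phi> y) (\<Prod>z\<in>Z. [:z, -1:]) - [:- y, 1:] * node_poly Z mu)"
proof -
  have finV: "finite V" by (rule nodes_finite[OF V(1)])
  obtain Z \<kappa> where Z: "Z \<subseteq> {al..be}" "finite Z" "card Z = card X" "\<kappa> \<noteq> 0"
      and p: "node_poly V d = smult \<kappa> (\<Prod>z\<in>Z. [:z, -1:])"
    by (rule node_poly_factor[OF X V(1) tr0 V(2) d]) (assumption, rule that)
  let ?Q = "node_poly V (\<lambda>v. d v * \<Phi> v)" and ?p = "node_poly V d"
  note num = numerator_at_zero[OF X V tr0 Z p \<Phi>]
  have Vz: "z < v" "z \<notin> V" if "z \<in> Z" "v \<in> V" for z v
    using Z(1) that nodes_gt[OF V(1)] by force+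
  have pnz: "node_prod Z v \<noteq> 0" if "v \<in> V" for v
    using Vz that Z(2) by (intro node_prod_nonzero) auto
  have Qv: "poly ?Q v = \<Phi> v * poly ?p v" if "v \<in> V" for v
    using that finV by (simp add: poly_node_poly_node)
  have Vne: "V \<noteq> {}" using V(2) by auto
  show ?thesis
  proof (rule that[OF Z p])
    show "poly ?Q z \<noteq> 0" if "z \<in> Z" for z using num[OF _ _ _ that] by auto
  next
    fix y assume y: "y \<in> V"
    let ?D = "?Q - smult (\<Phi> y) ?p"
    have "poly ?D y = 0" using Qv[OF y] by simp
    then obtain T where T: "?D = [:- y, 1:] * T" unfolding poly_eq_0_iff_dvd by auto
    have degD: "degree ?D < card V"
      using degree_node_poly[OF finV Vne] degree_smult_le[of "\<Phi> y" ?p]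
      by (intro degree_diff_less) (auto intro: le_less_trans)
    have "\<exists>c. T = node_poly Z c"
    proof (cases "T = 0")
      case True
      then show ?thesis by (intro exI[of _ "\<lambda>_. 0"]) (simp add: node_poly_def)
    next
      case False
      then have "degree ?D = Suc (degree T)" unfolding T by (subst degree_mult_eq) auto
      then have "degree T < card Z" using degD V(2) Z(3) by linarith
      then show ?thesis using node_poly_interpolation[OF Z(2)] by metis
    qed
    then obtain c where c: "T = node_poly Z c" by blast
    define mu where "mu = (\<lambda>z. - c z / \<kappa>)"
    have mu: "0 < mu z" if z: "z \<in> Z" for z
    proof -
      let ?r = "node_prod (Z - {z}) z"
      have r: "?r \<noteq> 0" using Z(2) by (intro node_prod_nonzero) auto
      have "poly ?p z = 0" unfolding p using z Z(2) by (simp add: poly_prod_node node_prod_remove)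
      then have "poly ?Q z = poly ?D z" by simp
      also have "\<dots> = (z - y) * (c z * ?r)" unfolding T c using poly_node_poly_node[OF Z(2) z, of c] by (simp add: algebra_simps)
      also have "\<dots> = (y - z) * (mu z * (\<kappa> * ?r))" using Z(4) by (simp add: mu_def algebra_simps)
      finally have "poly ?Q z * (\<kappa> * ?r) = mu z * ((y - z) * (\<kappa> * ?r)\<^sup>2)"
        by (simp add: power2_eq_square)
      moreover have "0 < poly ?Q z * (\<kappa> * ?r)" using num[OF _ _ _ z] by blast
      moreover have "0 < (y - z) * (\<kappa> * ?r)\<^sup>2" using Vz(1)[OF z y] r Z(4) by (intro mult_pos_pos) auto
      ultimately show ?thesis using zero_less_mult_pos2[of "mu z"] by (simp only:)
    qed
    have nmu: "node_poly Z c = smult \<kappa> (- node_poly Z mu)"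
    proof -
      have "c z = - (\<kappa> * mu z)" for z using Z(4) by (simp add: mu_def)
      then have "poly (node_poly Z c) = poly (smult \<kappa> (- node_poly Z mu))"
        by (intro ext) (simp add: poly_node_poly sum_distrib_left sum_negf mult.assoc)
      then show ?thesis by (simp only: poly_eq_poly_eq_iff)
    qed
    have eq: "?Q = smult \<kappa> (smult (\<Phi> y) (\<Prod>z\<in>Z. [:z, -1:]) - [:- y, 1:] * node_poly Z mu)"
    proof -
      have "?Q = smult (\<Phi> y) ?p + [:- y, 1:] * T" using T by (simp add: algebra_simps)
      then show ?thesis unfolding c nmu p
        by (simp only: smult_diff_right mult_smult_right smult_smult mult_minus_right
            smult_minus_right mult.commute[of "\<Phi> y"] diff_conv_add_uminus smult_add_right)
    qed
    \<comment> \<open>If \<open>Z\<close> is empty the sum is 0; otherwise there are at least two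
      nodes, and one different from \<open>y\<close> supplies the interpolation condition.\<close>
    have "(\<Sum>z\<in>Z. mu z) \<le> C"
    proof (cases "Z = {}")
      case False
      then have "card V \<noteq> 1" using Z(2,3) V(2) by auto
      then have "V \<noteq> {y}" by auto
      then obtain t where t: "t \<in> V" "t \<noteq> y" using y by blast
      have tz: "0 < t - z" if "z \<in> Z" for z using Vz(1)[OF that t(1)] by simp
      have "\<kappa> * (\<Phi> t * node_prod Z t)
          = \<kappa> * (\<Phi> y * node_prod Z t - (t - y) * poly (node_poly Z mu) t)"
        using Qv[OF t(1)] unfolding p poly_smult poly_prod_node
        unfolding eq by (auto simp add: poly_prod_node left_diff_distrib)
      then have "(t - y) * poly (node_poly Z mu) t = - (\<Phi> t - \<Phi> y) * node_prod Z t"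
        using Z(4) unfolding mult_cancel_left by (auto simp: algebra_simps)
      then have "(t - y) * poly (node_poly Z mu) t = (t - y) * (- k t y * node_prod Z t)"
        unfolding \<Phi>[OF t(1) y] by simp
      then have "poly (node_poly Z mu) t = - k t y * node_prod Z t"
        using t(2) by (subst (asm) mult_left_cancel) auto
      then have "(\<Sum>z\<in>Z. mu z / (z - t)) = - k t y"
        using partial_fractions_node_poly[OF Z(2), of t mu] pnz[OF t(1)] Vz(2) t(1) by auto
      moreover have "(\<Sum>z\<in>Z. mu z / (t - z)) = (\<Sum>z\<in>Z. - (mu z / (z - t)))"
        by (rule sum.cong[OF refl]) (metis minus_diff_eq minus_divide_right)
      ultimately have kt: "(\<Sum>z\<in>Z. mu z / (t - z)) = k t y"
        unfolding sum_negf by simp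
      have "(\<Sum>z\<in>Z. mu z) \<le> (\<Sum>z\<in>Z. (t - al) * (mu z / (t - z)))"
      proof (rule sum_mono)
        fix z assume z: "z \<in> Z"
        then have "mu z * (t - z) \<le> mu z * (t - al)"
          using mu[OF z] Z(1) by (intro mult_left_mono) auto
        then show "mu z \<le> (t - al) * (mu z / (t - z))"
          using tz[OF z] by (simp add: field_simps)
      qed
      also have "\<dots> = (t - al) * k t y" unfolding sum_distrib_left[symmetric] kt ..
      also have "\<dots> \<le> C" by (rule bound(1)[OF t(1) y])
      finally show ?thesis .
    qed (use bound(2) in simp)
    then show "\<exists>mu. (\<forall>z\<in>Z. 0 \<le> mu z) \<and> (\<Sum>z\<in>Z. mu z) \<le> C \<and>
        ?Q = smult \<kappa> (smult (\<Phi> y) (\<Prod>z\<in>Z. [:z, -1:]) - [:- y, 1:] * node_poly Z mu)"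
      using mu eq by (intro exI[of _ mu]) (auto simp: less_imp_le)
  qed
qed

end

section \<open>Bounded functions with many zeros\<close>

text \<open>The identity behind Blaschke factors: modulus 1 on the unit circle, and a quantitative
  gap inside.\<close>

lemma cmod_blaschke_diff:
  "(cmod (1 - cnj w * z))\<^sup>2 - (cmod (z - w))\<^sup>2 = (1 - (cmod w)\<^sup>2) * (1 - (cmod z)\<^sup>2)"
  unfolding cmod_power2 by (simp add: power2_eq_square algebra_simps)

text \<open>\<open>h\<close> is \<open>f\<close> divided by the Blaschke factor of \<open>w\<close>.
  This factor has modulus nearly 1 on circles of radius close to 1, so the maximum principle on such
  circles, followed by the limit of the radii, preserves the bound \<open>M\<close> without any
  boundary values of \<open>f\<close>.\<close>

lemma divide_blaschke_factor:
  assumes f: "f holomorphic_on ball 0 1" and bound: "\<And>z. cmod z < 1 \<Longrightarrow> cmod (f z) \<le> M"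
    and w: "cmod w < 1" "f w = 0"
  obtains h where "h holomorphic_on ball 0 1" "\<And>z. cmod z < 1 \<Longrightarrow> cmod (h z) \<le> M"
    "\<And>z. f z * (1 - cnj w * z) = (z - w) * h z"
proof -
  define g where "g = (\<lambda>z. if z = w then deriv f w else (f z - f w) / (z - w))"
  have g: "g holomorphic_on ball 0 1"
    unfolding g_def by (rule pole_lemma_open[OF f open_ball])
  have fg: "f z = (z - w) * g z" for z using w(2) by (auto simp: g_def)
  define h where "h = (\<lambda>z. g z * (1 - cnj w * z))"
  have h: "h holomorphic_on ball 0 1" unfolding h_def by (intro holomorphic_intros g)
  have eq: "f z * (1 - cnj w * z) = (z - w) * h z" for z by (simp add: fg h_def)
  have M0: "0 \<le> M" using bound[of 0] norm_ge_zero[of "f 0"] by (simp del: norm_ge_zero)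
  have "cmod (h z) \<le> M" if z: "cmod z < 1" for z
  proof -
    \<comment> \<open>By \<open>cmod_blaschke_diff\<close>, the squared modulus of the reciprocal
      factor exceeds 1 on the circle of radius \<open>r\<close> by at most
      \<open>1 - r\<^sup>2\<close> over the squared distance to \<open>w\<close>, and this distance
      is at least \<open>r - cmod w\<close>.\<close>
    define B where "B = (\<lambda>r. M * sqrt (1 + (1 - r\<^sup>2) / (r - cmod w)\<^sup>2))"
    have circle: "cmod (h z) \<le> B r" if r: "cmod z < r" "cmod w < r" "r < 1" for r
    proof (rule maximum_modulus_frontier[of h "cball 0 r"])
      have sub: "cball (0::complex) r \<subseteq> ball 0 1" using r by auto
      show "h holomorphic_on interior (cball 0 r)"
        by (rule holomorphic_on_subset[OF h]) (use sub interior_subset in blast)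
      show "continuous_on (closure (cball 0 r)) h"
        using continuous_on_subset[OF holomorphic_on_imp_continuous_on[OF h] sub] by simp
      show "bounded (cball (0::complex) r)" by simp
      show "z \<in> cball 0 r" using r by simp
      fix x :: complex assume "x \<in> frontier (cball 0 r)"
      then have x: "cmod x = r" using r norm_ge_zero[of z] by (auto simp: sphere_def)
      have low: "r - cmod w \<le> cmod (x - w)" using norm_triangle_ineq2[of x w] x by simp
      have pos: "0 < r - cmod w" using r by simp
      have "(cmod w)\<^sup>2 \<le> 1" "r\<^sup>2 \<le> 1"
        using w r order_le_less_trans[OF norm_ge_zero r(1)] by (auto intro!: power_le_one)
      then have "(1 - (cmod w)\<^sup>2) * (1 - r\<^sup>2) \<le> 1 * (1 - r\<^sup>2)" by (intro mult_right_mono) auto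
      then have "(cmod (1 - cnj w * x))\<^sup>2 \<le> (cmod (x - w))\<^sup>2 + (1 - r\<^sup>2)"
        using cmod_blaschke_diff[of w x] x by simp
      also have "\<dots> \<le> (cmod (x - w))\<^sup>2 * (1 + (1 - r\<^sup>2) / (r - cmod w)\<^sup>2)"
      proof -
        have "(r - cmod w)\<^sup>2 \<le> (cmod (x - w))\<^sup>2" using low pos by (intro power_mono) auto
        then have "(1 - r\<^sup>2) * ((r - cmod w)\<^sup>2 / (r - cmod w)\<^sup>2)
            \<le> (1 - r\<^sup>2) * ((cmod (x - w))\<^sup>2 / (r - cmod w)\<^sup>2)"
          using \<open>r\<^sup>2 \<le> 1\<close> by (intro mult_left_mono divide_right_mono) auto
        then show ?thesis using pos by (simp add: algebra_simps)
      qed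
      finally have "cmod (1 - cnj w * x) \<le> sqrt ((cmod (x - w))\<^sup>2 * (1 + (1 - r\<^sup>2) / (r - cmod w)\<^sup>2))"
        by (rule real_le_rsqrt)
      then have le: "cmod (1 - cnj w * x) \<le> cmod (x - w) * sqrt (1 + (1 - r\<^sup>2) / (r - cmod w)\<^sup>2)"
        by (simp add: real_sqrt_mult)
      have "cmod (x - w) * cmod (h x) = cmod (f x) * cmod (1 - cnj w * x)"
        using eq[of x] by (metis norm_mult)
      also have "\<dots> \<le> M * (cmod (x - w) * sqrt (1 + (1 - r\<^sup>2) / (r - cmod w)\<^sup>2))"
        using bound[of x] x r(3) by (intro mult_mono le M0) auto
      also have "\<dots> = cmod (x - w) * B r" by (simp add: B_def)
      finally have "cmod (x - w) * cmod (h x) \<le> cmod (x - w) * B r" .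
      then show "cmod (h x) \<le> B r" by (rule mult_left_le_imp_le) (use low pos in linarith)
    qed
    have "(B \<longlongrightarrow> M * sqrt (1 + (1 - 1\<^sup>2) / (1 - cmod w)\<^sup>2)) (at_left 1)"
      unfolding B_def using w by (intro tendsto_intros) auto
    then have lim: "(B \<longlongrightarrow> M) (at_left 1)" by simp
    have "eventually (\<lambda>r. r \<in> {max (cmod z) (cmod w)<..<1}) (at_left 1)"
      using z w by (intro eventually_at_leftI[of "max (cmod z) (cmod w)"]) auto
    then have "eventually (\<lambda>r. cmod (h z) \<le> B r) (at_left 1)"
      by eventually_elim (use circle in auto)
    then show ?thesis by (intro tendsto_lowerbound[OF lim]) auto
  qed
  then show ?thesis using that[OF h] eq by blast
qed

text \<open>Each zero splits off one Blaschke factor. The base of the power bounds its modulus on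
  the disc of radius \<open>r\<close>: the gap in \<open>cmod_blaschke_diff\<close> is at least
  \<open>(1 - r\<^sup>2)\<^sup>2\<close>, and the denominator has modulus at most 2, whence the
  4.\<close>

lemma blaschke_bound:
  assumes "finite W" "f holomorphic_on ball 0 1" "\<And>z. cmod z < 1 \<Longrightarrow> cmod (f z) \<le> M"
    "\<And>w. w \<in> W \<Longrightarrow> cmod w \<le> r \<and> f w = 0" "0 \<le> r" "r < 1" "cmod z \<le> r"
  shows "cmod (f z) \<le> M * sqrt (1 - (1 - r\<^sup>2)\<^sup>2 / 4) ^ card W"
  using assms(1-4)
proof (induction W arbitrary: f rule: finite_induct)
  case empty
  then show ?case using assms(6,7) by simp
next
  case (insert w W)
  let ?q = "sqrt (1 - (1 - r\<^sup>2)\<^sup>2 / 4)"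
  have w: "cmod w \<le> r" "cmod w < 1" "f w = 0" using insert.prems(3)[of w] assms(6) by auto
  obtain h where h: "h holomorphic_on ball 0 1" "\<And>z. cmod z < 1 \<Longrightarrow> cmod (h z) \<le> M"
      "\<And>z. f z * (1 - cnj w * z) = (z - w) * h z"
    using divide_blaschke_factor[OF insert.prems(1,2) w(2,3)] by blast
  have "h x = 0" if "x \<in> W" for x
  proof -
    have "f x = 0" "x \<noteq> w" using insert.prems(3)[of x] insert.hyps that by auto
    then show ?thesis using h(3)[of x] by simp
  qed
  then have IH: "cmod (h z) \<le> M * ?q ^ card W"
    using insert.IH[OF h(1,2)] insert.prems(3) by auto
  have r2: "r\<^sup>2 < 1" using assms(5,6) by (simp add: abs_square_less_1)
  let ?D = "cmod (1 - cnj w * z)"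
  have wz: "cmod (cnj w * z) \<le> r\<^sup>2"
    unfolding norm_mult power2_eq_square using w(1) assms(5,7) by (auto intro: mult_mono)
  have D: "0 < ?D" "?D \<le> 2"
    using norm_triangle_ineq2[of 1 "cnj w * z"] norm_triangle_ineq4[of 1 "cnj w * z"] wz r2 by auto
  have "(cmod w)\<^sup>2 \<le> r\<^sup>2" "(cmod z)\<^sup>2 \<le> r\<^sup>2" using w(1) assms(7) by (auto intro: power_mono)
  then have "(1 - r\<^sup>2) * (1 - r\<^sup>2) \<le> (1 - (cmod w)\<^sup>2) * (1 - (cmod z)\<^sup>2)"
    using r2 by (intro mult_mono) auto
  then have "(cmod (z - w))\<^sup>2 \<le> ?D\<^sup>2 - (1 - r\<^sup>2)\<^sup>2"
    using cmod_blaschke_diff[of w z] by (simp add: power2_eq_square)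
  also have "\<dots> \<le> ?D\<^sup>2 - ?D\<^sup>2 * ((1 - r\<^sup>2)\<^sup>2 / 4)"
  proof -
    have "?D\<^sup>2 \<le> 2\<^sup>2" using D by (intro power_mono) auto
    then have "?D\<^sup>2 * (1 - r\<^sup>2)\<^sup>2 \<le> 2\<^sup>2 * (1 - r\<^sup>2)\<^sup>2" by (intro mult_right_mono) auto
    then show ?thesis by simp
  qed
  finally have "cmod (z - w) \<le> sqrt (?D\<^sup>2 * (1 - (1 - r\<^sup>2)\<^sup>2 / 4))"
    by (intro real_le_rsqrt) (simp add: algebra_simps)
  then have zw: "cmod (z - w) \<le> ?D * ?q" using D by (simp add: real_sqrt_mult)
  have "?D * cmod (f z) = cmod (z - w) * cmod (h z)"
    using h(3)[of z] by (metis norm_mult mult.commute)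
  also have "\<dots> \<le> (?D * ?q) * (M * ?q ^ card W)"
    using D zw order_trans[OF norm_ge_zero zw] by (intro mult_mono IH zw) auto
  also have "\<dots> = ?D * (M * ?q ^ card (insert w W))" using insert.hyps by simp
  finally show ?case using D(1) by simp
qed

lemma compact_in_ball:
  fixes K :: "complex set"
  assumes "compact K" "K \<subseteq> ball 0 1"
  obtains r where "0 \<le> r" "r < 1" "K \<subseteq> cball 0 r"
proof (cases "K = {}")
  case False
  have "continuous_on K cmod" by (intro continuous_intros)
  then obtain x where "x \<in> K" "\<And>y. y \<in> K \<Longrightarrow> cmod y \<le> cmod x"
    using continuous_attains_sup[OF assms(1) False] by blast
  then show ?thesis using assms(2) by (intro that[of "cmod x"]) auto
qed (rule that[of 0]; simp)

text \<open>The functions are uniformly bounded only on compact sets, so after the Riemann map the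
  Blaschke estimate is used on a disc of radius \<open>s\<close> < 1 that still contains the images
  of \<open>K\<close> and \<open>J\<close>. Rescaling it to the unit disc turns the radius
  \<open>r\<close> into \<open>t = r / s\<close>.\<close>

lemma geometric_convergence:
  assumes G: "open G" "simply_connected G" "G \<noteq> UNIV"
    and f: "\<And>n. 1 \<le> n \<Longrightarrow> f n holomorphic_on G"
    and bounded: "\<And>K. compact K \<Longrightarrow> K \<subseteq> G \<Longrightarrow> \<exists>M. \<forall>n\<ge>1. \<forall>z\<in>K. cmod (f n z) \<le> M"
    and J: "compact J" "J \<subseteq> G"
    and W: "\<And>n::nat. 1 \<le> n \<Longrightarrow> W n \<subseteq> J \<and> finite (W n) \<and> card (W n) = n \<and> (\<forall>w\<in>W n. f n w = 0)"
    and K: "compact K" "K \<subseteq> G"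
  obtains q where "0 < q" "q < 1" "\<forall>\<^sub>F n in sequentially. \<forall>z\<in>K. cmod (f n z) \<le> q ^ n"
proof (cases "K = {}")
  case True
  then show ?thesis by (intro that[of "1/2"]) auto
next
  case False
  then have "G \<noteq> {}" using K by auto
  then obtain \<phi> \<psi> where \<phi>: "\<phi> holomorphic_on G" "\<And>z. z \<in> G \<Longrightarrow> \<phi> z \<in> ball 0 1 \<and> \<psi> (\<phi> z) = z"
    and \<psi>: "\<psi> holomorphic_on ball 0 1" "\<And>z. z \<in> ball 0 1 \<Longrightarrow> \<psi> z \<in> G \<and> \<phi> (\<psi> z) = z"
    using Riemann_mapping_theorem[of G] G by blast
  have "compact (\<phi> ` (K \<union> J))"
    using K J \<phi>(1) by (intro compact_continuous_image continuous_on_subset[OF holomorphic_on_imp_continuous_on[OF \<phi>(1)]]) auto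
  then obtain r where r: "0 \<le> r" "r < 1" "\<phi> ` (K \<union> J) \<subseteq> cball 0 r"
    by (rule compact_in_ball) (use \<phi>(2) K J in \<open>blast, blast\<close>)
  define s where "s = (1 + r) / 2"
  have s: "0 < s" "s < 1" "r < s" using r by (auto simp: s_def)
  have scale: "complex_of_real s * z \<in> ball 0 1" if "cmod z < 1" for z
  proof -
    have "s * cmod z \<le> 1 * cmod z" using s by (intro mult_right_mono) auto
    then show ?thesis using that s by (simp add: norm_mult)
  qed
  have "compact (\<psi> ` cball 0 s)"
    using s by (intro compact_continuous_image continuous_on_subset[OF holomorphic_on_imp_continuous_on[OF \<psi>(1)]]) auto
  moreover have "\<psi> ` cball 0 s \<subseteq> G" using \<psi>(2) s by auto
  ultimately have "\<exists>M. \<forall>n\<ge>1. \<forall>z\<in>\<psi> ` cball 0 s. cmod (f n z) \<le> M" by (rule bounded)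
  then obtain M where M: "\<forall>n\<ge>1. \<forall>z\<in>\<psi> ` cball 0 s. cmod (f n z) \<le> M" ..
  define t where "t = r / s"
  have t: "0 \<le> t" "t < 1" using r s by (auto simp: t_def)
  define q where "q = sqrt (1 - (1 - t\<^sup>2)\<^sup>2 / 4)"
  have t2: "0 \<le> t\<^sup>2" "t\<^sup>2 < 1" using t by (auto simp: abs_square_less_1)
  then have "0 < (1 - t\<^sup>2)\<^sup>2" "(1 - t\<^sup>2)\<^sup>2 \<le> 1" by (auto intro: power_le_one)
  then have q: "0 < q" "q < 1" by (auto simp: q_def)
  have main: "cmod (f n z) \<le> M * q ^ n" if n: "1 \<le> n" and z: "z \<in> K" for n z
  proof -
    let ?g = "\<lambda>z. f n (\<psi> (of_real s * z))"
    let ?W = "(\<lambda>w. \<phi> w / of_real s) ` W n"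
    have Wn: "W n \<subseteq> J" "finite (W n)" "card (W n) = n" "\<And>w. w \<in> W n \<Longrightarrow> f n w = 0"
      using W[OF n] by auto
    have small: "cmod (\<phi> w / of_real s) \<le> t" if "w \<in> K \<union> J" for w
      using r(3) that s(1) by (auto simp: norm_divide t_def divide_right_mono)
    have unscale: "\<psi> (of_real s * (\<phi> w / of_real s)) = w" if "w \<in> K \<union> J" for w
      using \<phi>(2)[of w] that K J s(1) by auto
    have "inj_on (\<lambda>w. \<phi> w / of_real s) (W n)"
      by (rule inj_on_inverseI[of _ "\<lambda>w. \<psi> (of_real s * w)"]) (use unscale Wn(1) in blast)
    then have "card ?W = n" using Wn(3) by (simp add: card_image)
    moreover have "cmod (?g (\<phi> z / of_real s)) \<le> M * sqrt (1 - (1 - t\<^sup>2)\<^sup>2 / 4) ^ card ?W"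
    proof (rule blaschke_bound[where f = ?g, OF _ _ _ _ t])
      have "(\<lambda>z. \<psi> (of_real s * z)) holomorphic_on ball 0 1"
        by (rule holomorphic_on_compose_gen[OF _ \<psi>(1), unfolded o_def])
          (use scale in \<open>auto intro!: holomorphic_intros\<close>)
      then show "?g holomorphic_on ball 0 1"
        by (rule holomorphic_on_compose_gen[OF _ f[OF n], unfolded o_def]) (use scale \<psi>(2) in auto)
      show "cmod (?g z) \<le> M" if "cmod z < 1" for z
      proof -
        have "of_real s * z \<in> cball 0 s" using that s by (simp add: norm_mult)
        then show ?thesis using M n by blast
      qed
    qed (use Wn small unscale z in auto)
    ultimately show ?thesis using unscale[of z] z by (simp add: q_def)
  qed
  \<comment> \<open>A base strictly between \<open>q\<close> and 1 absorbs the constant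
    \<open>M\<close> for large \<open>n\<close>.\<close>
  define p where "p = (q + 1) / 2"
  have p: "0 < p" "p < 1" "q < p" using q by (auto simp: p_def)
  have "(\<lambda>n. M * (q / p) ^ n) \<longlonglongrightarrow> M * 0"
    using p q by (intro tendsto_mult LIMSEQ_power_zero) auto
  then have "\<forall>\<^sub>F n in sequentially. M * (q / p) ^ n < 1" by (intro order_tendstoD) auto
  then have "\<forall>\<^sub>F n in sequentially. \<forall>z\<in>K. cmod (f n z) \<le> p ^ n"
    using eventually_ge_at_top[of 1]
  proof eventually_elim
    case (elim n)
    then have "M * q ^ n \<le> p ^ n" using p(1) by (simp add: power_divide field_simps)
    then show ?case using main[OF elim(2)] by force
  qed
  then show ?thesis by (rule that[OF p(1,2)])
qed

section \<open>Functionals defined by measures\<close>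

lemma finite_borel_measureD:
  assumes "finite_borel_measure M"
  shows "finite_measure M" "sets M = sets borel" "space M = UNIV"
proof -
  interpret finite_borel_measure M by fact
  show "finite_measure M" "sets M = sets borel" "space M = UNIV"
    using M_is_borel sets_eq_imp_space_eq[OF M_is_borel] by (auto intro: finite_measure_axioms)
qed

lemma msupp_complement:
  "- msupp M = \<Union>{U. open U \<and> emeasure M U = 0}"
  by (auto simp: msupp_def)

lemma closed_msupp: "closed (msupp M)"
  unfolding closed_def msupp_complement by auto

text \<open>The complement is a union of open null sets, and countably many of them suffice by the
  Lindelof property.\<close>

lemma emeasure_complement_msupp:
  assumes "finite_borel_measure M"
  shows "emeasure M (- msupp M) = 0"
proof -
  note M = finite_borel_measureD[OF assms]
  let ?F = "{U. open U \<and> emeasure M U = 0}"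
  obtain G where G: "G \<subseteq> ?F" "countable G" "\<Union>G = \<Union>?F"
    by (rule Lindelof[of ?F]) auto
  have "(\<Union>U\<in>G. U) \<in> null_sets M"
  proof (rule null_sets_UN'[OF G(2)])
    fix U assume "U \<in> G"
    then have "open U" "emeasure M U = 0" using G(1) by auto
    then show "U \<in> null_sets M" by (intro null_setsI) (simp_all add: M(2))
  qed
  then show ?thesis unfolding msupp_complement G(3)[symmetric] by (simp add: null_setsD1)
qed

lemma AE_msupp:
  assumes "finite_borel_measure M"
  shows "AE x in M. x \<in> msupp M"
proof (rule AE_I')
  note M = finite_borel_measureD[OF assms]
  show "- msupp M \<in> null_sets M"
    using emeasure_complement_msupp[OF assms] closed_msupp[of M] M by (intro null_setsI) auto
qed auto

lemma integrable_bounded_on_msupp: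
  fixes f :: "real \<Rightarrow> 'b::{banach, second_countable_topology}"
  assumes "finite_borel_measure M" "f \<in> borel_measurable borel" "\<And>x. x \<in> msupp M \<Longrightarrow> norm (f x) \<le> C"
  shows "integrable M f" "norm (LINT x|M. f x) \<le> C * measure M UNIV"
proof -
  note M = finite_borel_measureD[OF assms(1)]
  interpret finite_measure M by (rule M(1))
  have AE: "AE x in M. norm (f x) \<le> C" using AE_msupp[OF assms(1)] by eventually_elim (rule assms(3))
  have meas: "f \<in> borel_measurable M" using assms(2) M(2) measurable_cong_sets by blast
  show int: "integrable M f" by (rule integrable_const_bound[OF AE meas])
  have "norm (LINT x|M. f x) \<le> (LINT x|M. norm (f x))" by (rule integral_norm_bound)
  also have "\<dots> \<le> (LINT x|M. C)" by (rule integral_mono_AE) (use int AE in simp_all)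
  also have "\<dots> = C * measure M UNIV" using M(3) by simp
  finally show "norm (LINT x|M. f x) \<le> C * measure M UNIV" .
qed

lemma bounded_set_integrable:
  fixes g :: "real \<Rightarrow> real"
  assumes "finite_borel_measure M" "closed S" "continuous_on S g" "\<And>x. x \<in> S \<Longrightarrow> \<bar>g x\<bar> \<le> C"
  shows "set_integrable M S g"
  unfolding set_integrable_def
proof (rule integrable_bounded_on_msupp[OF assms(1)])
  show "(\<lambda>x. indicator S x *\<^sub>R g x) \<in> borel_measurable borel"
    using assms(2,3) by (intro borel_measurable_continuous_on_indicator) auto
  show "norm (indicator S x *\<^sub>R g x) \<le> max C 0" for x
    using assms(4)[of x] by (auto simp: indicator_def)
qed

lemma set_integral_pos_of_msupp:
  fixes g :: "real \<Rightarrow> real"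
  assumes M: "finite_borel_measure M" and S: "closed S" "msupp M \<subseteq> S"
    and g: "continuous_on S g" "\<And>x. x \<in> S \<Longrightarrow> 0 \<le> g x" "set_integrable M S g"
    and y: "y \<in> msupp M" "0 < g y"
  shows "0 < (LINT x:S|M. g x)"
proof -
  note M' = finite_borel_measureD[OF M]
  let ?g = "\<lambda>x. indicator S x * g x"
  have nonneg: "0 \<le> ?g x" for x using g(2)[of x] by (auto simp: indicator_def)
  have int: "integrable M ?g" using g(3) by (simp add: set_integrable_def)
  have "y \<in> S" using y S by auto
  obtain U where U: "open U" "U \<inter> S = g -` {0<..} \<inter> S"
    using g(1) unfolding continuous_on_open_invariant by (metis open_greaterThan)
  have "y \<in> U" using U(2) y(2) \<open>y \<in> S\<close> by blast
  have "(LINT x|M. ?g x) \<noteq> 0"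
  proof
    assume "(LINT x|M. ?g x) = 0"
    then have "AE x in M. ?g x = 0"
      using integral_nonneg_eq_0_iff_AE[OF int] nonneg by simp
    then have "AE x in M. x \<notin> U"
      using AE_msupp[OF M]
    proof eventually_elim
      case (elim x)
      then have "x \<in> S" "g x = 0" using S(2) by (auto simp: indicator_def)
      moreover have "x \<in> g -` {0<..}" if "x \<in> U" using U(2) that \<open>x \<in> S\<close> by blast
      ultimately show ?case by auto
    qed
    then have "emeasure M U = 0" using AE_iff_measurable[of U M "\<lambda>x. x \<notin> U"] U(1) M' by auto
    then show False using y(1) U(1) \<open>y \<in> U\<close> by (auto simp: msupp_def)
  qed
  moreover have "0 \<le> (LINT x|M. ?g x)" using nonneg by (intro Bochner_Integration.integral_nonneg) auto
  ultimately show ?thesis by (simp add: set_lebesgue_integral_def)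
qed

text \<open>The image under \<open>w\<close> of the measure with density \<omega>, plus a mass
  \<open>c\<close> at 0. The mass is meant for the image of infinity, which carries the linear term
  of \<open>F\<close>; with \<open>c = 0\<close> the lemma serves \<nu>. The second condition on
  \<open>small\<close> yields a support point at which the integrand is positive.\<close>

lemma pushforward_pos_functional:
  fixes w \<omega> :: "real \<Rightarrow> real"
  assumes M: "finite_borel_measure M" and S: "closed S" "msupp M \<subseteq> S"
    and w: "continuous_on S w" "w ` S \<subseteq> {l..r}"
    and \<omega>: "continuous_on S \<omega>" "\<And>x. x \<in> S \<Longrightarrow> 0 < \<omega> x \<and> \<omega> x \<le> C"
    and c: "0 \<le> c" "c = 0 \<or> 0 \<in> {l..r}"
    and small: "small {}" "\<And>Z. small Z \<Longrightarrow> \<exists>y\<in>msupp M. w y \<notin> Z"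
  shows "pos_functional (\<lambda>h. c * h 0 + (LINT x:S|M. h (w x) * \<omega> x)) l r small"
proof -
  have cont: "continuous_on S (\<lambda>x. h (w x) * \<omega> x)" if "continuous_on {l..r} h" for h
    using that w \<omega>(1) by (intro continuous_intros continuous_on_compose2[OF that]) auto
  have int: "set_integrable M S (\<lambda>x. h (w x) * \<omega> x)" if h: "continuous_on {l..r} h" for h
  proof -
    have "bounded (h ` {l..r})" using h by (intro compact_imp_bounded compact_continuous_image) auto
    then obtain D where "\<forall>y\<in>h ` {l..r}. norm y \<le> D" unfolding bounded_iff by blast
    then have D: "\<bar>h u\<bar> \<le> D" if "u \<in> {l..r}" for u using that by auto
    show ?thesis
    proof (rule bounded_set_integrable[OF M S(1) cont[OF h]])
      fix x assume x: "x \<in> S"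
      then have "\<bar>h (w x)\<bar> \<le> D" using D[of "w x"] w(2) by auto
      then show "\<bar>h (w x) * \<omega> x\<bar> \<le> D * C"
        unfolding abs_mult using \<omega>(2)[OF x] by (intro mult_mono) auto
    qed
  qed
  show ?thesis
  proof
    show "small {}" by (rule small)
  next
    fix f g :: "real \<Rightarrow> real" assume f: "continuous_on {l..r} f" and g: "continuous_on {l..r} g"
    show "c * (f 0 + g 0) + (LINT x:S|M. (f (w x) + g (w x)) * \<omega> x)
        = c * f 0 + (LINT x:S|M. f (w x) * \<omega> x) + (c * g 0 + (LINT x:S|M. g (w x) * \<omega> x))"
      using set_integral_add(2)[OF int[OF f] int[OF g]] by (simp add: algebra_simps)
  next
    fix f :: "real \<Rightarrow> real" and d assume f: "continuous_on {l..r} f"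
    show "c * (d * f 0) + (LINT x:S|M. d * f (w x) * \<omega> x) = d * (c * f 0 + (LINT x:S|M. f (w x) * \<omega> x))"
      using set_integral_mult_right[where a = d] by (simp add: algebra_simps)
  next
    fix f g :: "real \<Rightarrow> real" assume fg: "\<And>x. x \<in> {l..r} \<Longrightarrow> f x = g x"
    have "(LINT x:S|M. f (w x) * \<omega> x) = (LINT x:S|M. g (w x) * \<omega> x)"
      unfolding set_lebesgue_integral_def
      using fg w(2) by (intro Bochner_Integration.integral_cong) (auto simp: indicator_def)
    moreover have "c * f 0 = c * g 0" using c(2) fg[of 0] by auto
    ultimately show "c * f 0 + (LINT x:S|M. f (w x) * \<omega> x) = c * g 0 + (LINT x:S|M. g (w x) * \<omega> x)"
      by simp
  next
    fix f :: "real \<Rightarrow> real" assume f: "continuous_on {l..r} f" "\<And>x. x \<in> {l..r} \<Longrightarrow> 0 \<le> f x"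
      "small {x \<in> {l..r}. f x = 0}"
    obtain y where y: "y \<in> msupp M" "w y \<notin> {x \<in> {l..r}. f x = 0}" using small(2)[OF f(3)] by auto
    have yS: "y \<in> S" using y(1) S(2) by blast
    have wy: "w y \<in> {l..r}" using w(2) yS by blast
    have "0 < (LINT x:S|M. f (w x) * \<omega> x)"
    proof (rule set_integral_pos_of_msupp[OF M S cont[OF f(1)] _ int[OF f(1)] y(1)])
      show "0 \<le> f (w x) * \<omega> x" if "x \<in> S" for x
        using f(2)[of "w x"] \<omega>(2)[OF that] w(2) that by (intro mult_nonneg_nonneg) auto
      have "f (w y) \<noteq> 0" "0 \<le> f (w y)" using y(2) wy f(2) by auto
      then show "0 < f (w y) * \<omega> y" using \<omega>(2)[OF yS] by (intro mult_pos_pos) auto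
    qed
    moreover have "0 \<le> c * f 0" using c f(2)[of 0] by auto
    ultimately show "0 < c * f 0 + (LINT x:S|M. f (w x) * \<omega> x)" by simp
  qed
qed

section \<open>Functions with a Nevanlinna--Pick representation\<close>

locale np_function =
  fixes F :: "complex \<Rightarrow> complex" and A B :: real and \<mu> :: "real measure"
  assumes np: "np_representation F A B \<mu>"
begin

lemma B_nonneg: "0 \<le> B" and \<mu>_finite: "finite_borel_measure \<mu>"
  and F_eq: "z \<notin> complex_of_real ` msupp \<mu> \<Longrightarrow>
    F z = of_real A + of_real B * z + (LINT s|\<mu>. (1 + z * of_real s) / (of_real s - z))"
  using np by (auto simp: np_representation_def)

lemma measurable_\<mu>: "f \<in> borel_measurable borel \<Longrightarrow> f \<in> borel_measurable \<mu>"
  using measurable_cong_sets[OF finite_borel_measureD(2)[OF \<mu>_finite] refl] by blast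

lemma closed_image_msupp: "closed (complex_of_real ` msupp \<mu>)"
  by (intro closed_injective_linear_image closed_msupp linear_of_real) (auto simp: inj_on_def)

lemma distance_to_msupp:
  assumes "z \<notin> complex_of_real ` msupp \<mu>"
  obtains e where "0 < e" "\<And>s. s \<in> msupp \<mu> \<Longrightarrow> e \<le> cmod (of_real s - z)"
proof -
  have "open (- complex_of_real ` msupp \<mu>)" using closed_image_msupp by (rule open_Compl)
  moreover have "z \<in> - complex_of_real ` msupp \<mu>" using assms by simp
  ultimately obtain e where "0 < e" "ball z e \<subseteq> - complex_of_real ` msupp \<mu>"
    unfolding open_contains_ball by blast
  then show ?thesis
    by (intro that[of e]) (auto simp: subset_iff dist_norm norm_minus_commute not_less)
qed

text \<open>The support keeps a positive distance from \<open>z\<close>, and for large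
  \<open>s\<close> both moduli grow alike. This makes integrands with numerator
  \<open>1 + s\<^sup>2\<close> bounded on a possibly unbounded support.\<close>

lemma poisson_factor_bounded:
  assumes "z \<notin> complex_of_real ` msupp \<mu>"
  obtains C where "0 < C" "\<And>s. s \<in> msupp \<mu> \<Longrightarrow> cmod (of_real s - \<i>) \<le> C * cmod (of_real s - z)"
    "\<And>s. s \<in> msupp \<mu> \<Longrightarrow> 1 \<le> C * cmod (of_real s - z)"
proof -
  obtain e where e: "0 < e" "\<And>s. s \<in> msupp \<mu> \<Longrightarrow> e \<le> cmod (of_real s - z)"
    using distance_to_msupp[OF assms] by blast
  have pos: "0 < 1 + (1 + cmod (z - \<i>)) / e" using e(1) by (intro add_pos_nonneg) auto
  show ?thesis
  proof (rule that[OF pos])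
    fix s assume s: "s \<in> msupp \<mu>"
    let ?d = "cmod (of_real s - z)"
    have d: "1 \<le> ?d / e" using e(1) e(2)[OF s] by simp
    have "cmod (of_real s - \<i>) \<le> ?d + cmod (z - \<i>)"
      using norm_triangle_ineq[of "of_real s - z" "z - \<i>"] by simp
    also have "\<dots> \<le> ?d + (1 + cmod (z - \<i>)) * (?d / e)"
      using mult_mono[OF _ d, of "cmod (z - \<i>)" "1 + cmod (z - \<i>)"] by simp
    also have "\<dots> = (1 + (1 + cmod (z - \<i>)) / e) * ?d" by (simp add: distrib_right)
    finally show "cmod (of_real s - \<i>) \<le> (1 + (1 + cmod (z - \<i>)) / e) * ?d" .
    have "1 \<le> 1 * (?d / e)" using d by simp
    also have "\<dots> \<le> (1 + cmod (z - \<i>)) * (?d / e)"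
      using d by (intro mult_right_mono) auto
    also have "\<dots> \<le> (1 + (1 + cmod (z - \<i>)) / e) * ?d" by (simp add: distrib_right)
    finally show "1 \<le> (1 + (1 + cmod (z - \<i>)) / e) * ?d" .
  qed
qed

lemma one_plus_square: "complex_of_real (1 + s\<^sup>2) = (of_real s - \<i>) * (of_real s + \<i>)"
  by (simp add: algebra_simps power2_eq_square)

lemma cmod_plus_i: "cmod (of_real s + \<i>) = cmod (of_real s - \<i>)"
  by (simp add: cmod_def)

text \<open>The divided difference of \<open>F\<close> without its linear term: the integral part of
  the Loewner kernel, at complex arguments.\<close>

definition G :: "complex \<Rightarrow> complex \<Rightarrow> complex" where
  "G z x = (LINT s|\<mu>. of_real (1 + s\<^sup>2) / ((of_real s - z) * (of_real s - x)))"

lemma G_integrand_bounded: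
  assumes "z \<notin> complex_of_real ` msupp \<mu>" "x \<notin> complex_of_real ` msupp \<mu>"
  obtains C where "\<And>s. s \<in> msupp \<mu> \<Longrightarrow>
    cmod (of_real (1 + s\<^sup>2) / ((of_real s - z) * (of_real s - x))) \<le> C"
proof -
  obtain C D where C: "0 < C" "\<And>s. s \<in> msupp \<mu> \<Longrightarrow> cmod (of_real s - \<i>) \<le> C * cmod (of_real s - z)"
    and D: "0 < D" "\<And>s. s \<in> msupp \<mu> \<Longrightarrow> cmod (of_real s - \<i>) \<le> D * cmod (of_real s - x)"
    using poisson_factor_bounded[OF assms(1)] poisson_factor_bounded[OF assms(2)] by metis
  show ?thesis
  proof (rule that[of "C * D"])
    fix s assume s: "s \<in> msupp \<mu>"
    then have nz: "of_real s - z \<noteq> 0" "of_real s - x \<noteq> 0" using assms by auto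
    have "cmod (of_real (1 + s\<^sup>2)) = cmod (of_real s - \<i>) * cmod (of_real s - \<i>)"
      unfolding one_plus_square norm_mult cmod_plus_i ..
    also have "\<dots> \<le> (C * cmod (of_real s - z)) * (D * cmod (of_real s - x))"
      using C D s by (intro mult_mono) auto
    finally show "cmod (of_real (1 + s\<^sup>2) / ((of_real s - z) * (of_real s - x))) \<le> C * D"
      using nz by (simp add: norm_divide norm_mult divide_le_eq mult_ac del: of_real_add of_real_power)
  qed
qed

lemma G_integrable:
  assumes "z \<notin> complex_of_real ` msupp \<mu>" "x \<notin> complex_of_real ` msupp \<mu>"
  shows "integrable \<mu> (\<lambda>s. of_real (1 + s\<^sup>2) / ((of_real s - z) * (of_real s - x)))"
proof -
  obtain C where "\<And>s. s \<in> msupp \<mu> \<Longrightarrow>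
      cmod (of_real (1 + s\<^sup>2) / ((of_real s - z) * (of_real s - x))) \<le> C"
    using G_integrand_bounded[OF assms] by blast
  then show ?thesis by (intro integrable_bounded_on_msupp(1)[OF \<mu>_finite]) auto
qed

lemma F_integrable:
  assumes "z \<notin> complex_of_real ` msupp \<mu>"
  shows "integrable \<mu> (\<lambda>s. (1 + z * of_real s) / (of_real s - z))"
proof -
  obtain C where C: "0 < C" "\<And>s. s \<in> msupp \<mu> \<Longrightarrow> 1 \<le> C * cmod (of_real s - z)"
    using poisson_factor_bounded[OF assms] by metis
  show ?thesis
  proof (rule integrable_bounded_on_msupp(1)[OF \<mu>_finite])
    fix s assume s: "s \<in> msupp \<mu>"
    then have nz: "of_real s - z \<noteq> 0" using assms by auto
    then have "(1 + z * of_real s) / (of_real s - z) = z + (1 + z\<^sup>2) / (of_real s - z)"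
      by (simp add: field_simps power2_eq_square)
    also have "cmod \<dots> \<le> cmod z + cmod (1 + z\<^sup>2) * (1 / cmod (of_real s - z))"
      using norm_triangle_ineq[of z "(1 + z\<^sup>2) / (of_real s - z)"] by (simp add: norm_divide)
    also have "\<dots> \<le> cmod z + cmod (1 + z\<^sup>2) * C"
      using C(2)[OF s] nz by (intro add_left_mono mult_left_mono) (auto simp: divide_le_eq)
    finally show "cmod ((1 + z * of_real s) / (of_real s - z)) \<le> cmod z + cmod (1 + z\<^sup>2) * C" .
  qed measurable
qed

lemma F_diff:
  assumes z: "z \<notin> complex_of_real ` msupp \<mu>" and x: "x \<notin> complex_of_real ` msupp \<mu>"
  shows "F z - F x = (z - x) * (of_real B + G z x)"
proof -
  have "F z - F x = of_real B * (z - x) + ((LINT s|\<mu>. (1 + z * of_real s) / (of_real s - z))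
      - (LINT s|\<mu>. (1 + x * of_real s) / (of_real s - x)))"
    unfolding F_eq[OF z] F_eq[OF x] by (simp add: algebra_simps)
  also have "(LINT s|\<mu>. (1 + z * of_real s) / (of_real s - z))
      - (LINT s|\<mu>. (1 + x * of_real s) / (of_real s - x))
      = (LINT s|\<mu>. (1 + z * of_real s) / (of_real s - z) - (1 + x * of_real s) / (of_real s - x))"
    by (rule Bochner_Integration.integral_diff[symmetric]; rule F_integrable) fact+
  also have "\<dots> = (LINT s|\<mu>. (z - x) * (of_real (1 + s\<^sup>2) / ((of_real s - z) * (of_real s - x))))"
  proof (rule integral_cong_AE)
    show "AE s in \<mu>. (1 + z * of_real s) / (of_real s - z) - (1 + x * of_real s) / (of_real s - x)
        = (z - x) * (of_real (1 + s\<^sup>2) / ((of_real s - z) * (of_real s - x)))"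
      using AE_msupp[OF \<mu>_finite]
    proof eventually_elim
      case (elim s)
      then have nz: "of_real s - z \<noteq> 0" "of_real s - x \<noteq> 0" using z x by auto
      then show ?case by (simp add: divide_simps) (simp add: algebra_simps power2_eq_square)
    qed
  qed (rule measurable_\<mu>, measurable)+
  also have "\<dots> = (z - x) * G z x"
    unfolding G_def by (rule integral_mult_right_zero)
  finally show ?thesis by (simp add: algebra_simps)
qed

text \<open>By \<open>F_diff\<close> the difference quotient is \<open>B + G z x\<close>, so
  continuity of \<open>G\<close> in its first argument suffices. The increment of \<open>G\<close>
  is \<open>z - x\<close> times an integral that stays bounded while \<open>z\<close> is within half
  the distance \<open>e\<close> of \<open>x\<close>.\<close>

lemma F_has_derivative:
  assumes x: "x \<notin> complex_of_real ` msupp \<mu>"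
  shows "(F has_field_derivative (of_real B + G x x)) (at x)"
proof -
  obtain e where e: "0 < e" "\<And>s. s \<in> msupp \<mu> \<Longrightarrow> e \<le> cmod (of_real s - x)"
    using distance_to_msupp[OF x] by blast
  obtain C where C: "\<And>s. s \<in> msupp \<mu> \<Longrightarrow>
      cmod (of_real (1 + s\<^sup>2) / ((of_real s - x) * (of_real s - x))) \<le> C"
    using G_integrand_bounded[OF x x] by blast
  define K where "K = \<bar>C\<bar> * (2 / e) * measure \<mu> UNIV"
  have far: "e / 2 \<le> cmod (of_real s - z)" if "s \<in> msupp \<mu>" "dist z x < e / 2" for s z
    using e(2)[OF that(1)] that(2) norm_triangle_ineq[of "of_real s - z" "z - x"]
    by (simp add: dist_norm)
  have bound: "cmod (G z x - G x x) \<le> K * cmod (z - x)" if z: "dist z x < e / 2" for z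
  proof -
    have zs: "z \<notin> complex_of_real ` msupp \<mu>" using far[OF _ z] e(1) by force
    let ?h = "\<lambda>s. of_real (1 + s\<^sup>2) / ((of_real s - x) * (of_real s - x)) * (1 / (of_real s - z))"
    have "cmod (?h s) \<le> \<bar>C\<bar> * (2 / e)" if s: "s \<in> msupp \<mu>" for s
    proof -
      have "cmod (1 / (of_real s - z)) \<le> 1 / (e / 2)"
        unfolding norm_divide norm_one using far[OF s z] e(1)
        by (intro divide_left_mono mult_pos_pos order_less_le_trans[OF _ far[OF s z]]) auto
      moreover have "cmod (of_real (1 + s\<^sup>2) / ((of_real s - x) * (of_real s - x))) \<le> \<bar>C\<bar>"
        using C[OF s] by linarith
      ultimately show ?thesis unfolding norm_mult[of "_ / _" "1 / _"]
        by (intro mult_mono) auto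
    qed
    moreover have "?h \<in> borel_measurable borel" by measurable
    ultimately have h: "cmod (LINT s|\<mu>. ?h s) \<le> K"
      unfolding K_def by (intro integrable_bounded_on_msupp(2)[OF \<mu>_finite])
    have "G z x - G x x = (LINT s|\<mu>. of_real (1 + s\<^sup>2) / ((of_real s - z) * (of_real s - x))
        - of_real (1 + s\<^sup>2) / ((of_real s - x) * (of_real s - x)))"
      unfolding G_def by (rule Bochner_Integration.integral_diff[symmetric]; rule G_integrable) fact+
    also have "\<dots> = (LINT s|\<mu>. (z - x) * ?h s)"
    proof (rule integral_cong_AE)
      show "AE s in \<mu>. of_real (1 + s\<^sup>2) / ((of_real s - z) * (of_real s - x))
          - of_real (1 + s\<^sup>2) / ((of_real s - x) * (of_real s - x)) = (z - x) * ?h s"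
        using AE_msupp[OF \<mu>_finite]
      proof eventually_elim
        case (elim s)
        then have nz: "of_real s - z \<noteq> 0" "of_real s - x \<noteq> 0" using zs x by auto
        then show ?case by (simp add: divide_simps) (simp add: algebra_simps)
      qed
    qed (rule measurable_\<mu>, measurable)+
    also have "\<dots> = (z - x) * (LINT s|\<mu>. ?h s)"
      by (rule integral_mult_right_zero)
    finally have "cmod (G z x - G x x) = cmod (z - x) * cmod (LINT s|\<mu>. ?h s)" by (simp add: norm_mult)
    also have "\<dots> \<le> cmod (z - x) * K"
      by (rule mult_left_mono[OF h]) simp
    finally show ?thesis by (simp add: mult.commute)
  qed
  have near: "eventually (\<lambda>z. dist z x < e / 2 \<and> z \<noteq> x) (at x)"
    unfolding eventually_at using e(1) by (intro exI[of _ "e / 2"]) auto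
  have "((\<lambda>z. G z x - G x x) \<longlongrightarrow> 0) (at x)"
  proof (rule Lim_null_comparison)
    show "\<forall>\<^sub>F z in at x. cmod (G z x - G x x) \<le> K * cmod (z - x)"
      using near by eventually_elim (use bound in auto)
    have "((\<lambda>z. K * cmod (z - x)) \<longlongrightarrow> K * cmod (x - x)) (at x)" by (intro tendsto_intros)
    then show "((\<lambda>z. K * cmod (z - x)) \<longlongrightarrow> 0) (at x)" by simp
  qed
  then have "((\<lambda>z. of_real B + (G z x - G x x) + G x x) \<longlongrightarrow> of_real B + 0 + G x x) (at x)"
    by (intro tendsto_intros)
  then have lim: "((\<lambda>z. of_real B + G z x) \<longlongrightarrow> of_real B + G x x) (at x)" by simp
  have "((\<lambda>z. (F z - F x) / (z - x)) \<longlongrightarrow> of_real B + G x x) (at x)"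
  proof (rule Lim_transform_eventually[OF lim])
    show "\<forall>\<^sub>F z in at x. of_real B + G z x = (F z - F x) / (z - x)"
      using near
    proof eventually_elim
      case (elim z)
      then have "z \<notin> complex_of_real ` msupp \<mu>" using far[of _ z] e(1) by force
      then show ?case using F_diff[OF _ x, of z] elim by simp
    qed
  qed
  then show ?thesis by (simp add: has_field_derivative_iff)
qed

lemma F_holomorphic: "F holomorphic_on - (complex_of_real ` msupp \<mu>)"
  unfolding holomorphic_on_def field_differentiable_def
  using F_has_derivative has_field_derivative_at_within by blast

lemma F_real:
  assumes "x \<notin> msupp \<mu>"
  shows "F (of_real x) = of_real (Re (F (of_real x)))"
proof -
  have "of_real x \<notin> complex_of_real ` msupp \<mu>" using assms by auto
  from F_eq[OF this] have "F (of_real x) = of_real A + of_real B * of_real x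
      + (LINT s|\<mu>. complex_of_real ((1 + x * s) / (s - x)))" by simp
  also have "\<dots> = of_real (A + B * x + (LINT s|\<mu>. (1 + x * s) / (s - x)))"
    by (simp only: integral_complex_of_real of_real_add of_real_mult)
  finally show ?thesis by (metis Re_complex_of_real)
qed

lemma loewner_kernel_eq:
  assumes x: "x \<notin> msupp \<mu>" and y: "y \<notin> msupp \<mu>"
  shows "loewner_kernel F x y = B + (LINT s:msupp \<mu>|\<mu>. (1 + s\<^sup>2) / ((s - x) * (s - y)))"
proof -
  have x': "of_real x \<notin> complex_of_real ` msupp \<mu>" and y': "of_real y \<notin> complex_of_real ` msupp \<mu>"
    using x y by auto
  let ?I = "LINT s|\<mu>. (1 + s\<^sup>2) / ((s - x) * (s - y))"
  have "G (of_real x) (of_real y) = (LINT s|\<mu>. complex_of_real ((1 + s\<^sup>2) / ((s - x) * (s - y))))"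
    unfolding G_def by simp
  then have G: "G (of_real x) (of_real y) = of_real ?I" by (simp only: integral_complex_of_real)
  have "loewner_kernel F x y = B + ?I"
  proof (cases "x = y")
    case True
    have "deriv F (of_real x) = of_real B + G (of_real x) (of_real x)"
      by (rule DERIV_imp_deriv[OF F_has_derivative[OF x']])
    then show ?thesis using G True by (simp add: loewner_kernel_def)
  next
    case False
    have "F (of_real x) - F (of_real y) = of_real ((x - y) * (B + ?I))"
      using F_diff[OF x' y'] G by simp
    then have "Re (F (of_real x)) - Re (F (of_real y)) = (x - y) * (B + ?I)"
      by (metis Re_complex_of_real minus_complex.simps(1))
    then show ?thesis using False by (simp add: loewner_kernel_def)
  qed
  also have "?I = (LINT s:msupp \<mu>|\<mu>. (1 + s\<^sup>2) / ((s - x) * (s - y)))"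
    unfolding set_lebesgue_integral_def
  proof (rule integral_cong_AE)
    show "(\<lambda>s. (1 + s\<^sup>2) / ((s - x) * (s - y))) \<in> borel_measurable \<mu>"
      "(\<lambda>s. indicator (msupp \<mu>) s *\<^sub>R ((1 + s\<^sup>2) / ((s - x) * (s - y)))) \<in> borel_measurable \<mu>"
      using closed_msupp[of \<mu>] finite_borel_measureD(2)[OF \<mu>_finite]
      by (simp_all add: measurable_cong_sets[OF _ refl, of \<mu> borel])
    show "AE s in \<mu>. (1 + s\<^sup>2) / ((s - x) * (s - y))
        = indicator (msupp \<mu>) s *\<^sub>R ((1 + s\<^sup>2) / ((s - x) * (s - y)))"
      using AE_msupp[OF \<mu>_finite] by eventually_elim simp
  qed
  finally show ?thesis .
qed

text \<open>Used in contrapositive form to obtain an infinite support. For a finite support the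
  measure is a sum of point masses, and the integral a finite sum of rational functions.\<close>

lemma finite_msupp_imp_rational:
  assumes fin: "finite (msupp \<mu>)"
  shows "rational_on F (- (complex_of_real ` msupp \<mu>))"
proof -
  let ?M = "msupp \<mu>"
  interpret finite_measure \<mu> by (rule finite_borel_measureD(1)[OF \<mu>_finite])
  have sets: "sets \<mu> = sets borel" by (rule finite_borel_measureD(2)[OF \<mu>_finite])
  define m where "m = (\<lambda>s. complex_of_real (measure \<mu> {s}))"
  define q where "q = (\<Prod>s\<in>?M. [:complex_of_real s, -1:])"
  define p where "p = q * [:of_real A, of_real B:]
    + (\<Sum>s\<in>?M. smult (m s) ([:1, of_real s:] * (\<Prod>t\<in>?M - {s}. [:complex_of_real t, -1:])))"
  have "q \<noteq> 0" unfolding q_def using fin by auto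
  moreover have "F z = poly p z / poly q z" if z: "z \<in> - complex_of_real ` ?M" for z
  proof -
    have nz: "of_real s - z \<noteq> 0" if "s \<in> ?M" for s using z that by auto
    have qz: "poly q z \<noteq> 0" unfolding q_def poly_prod using nz fin by auto
    let ?f = "\<lambda>s. (1 + z * of_real s) / (of_real s - z)"
    have "(LINT s|\<mu>. ?f s) = (LINT s|\<mu>. (\<Sum>t\<in>?M. indicator {t} s *\<^sub>R ?f t))"
    proof (rule integral_cong_AE)
      show "?f \<in> borel_measurable \<mu>" using F_integrable z by (intro borel_measurable_integrable) auto
      show "(\<lambda>s. \<Sum>t\<in>?M. indicator {t} s *\<^sub>R ?f t) \<in> borel_measurable \<mu>"
        using sets by (intro borel_measurable_sum borel_measurable_scaleR) auto
      show "AE s in \<mu>. ?f s = (\<Sum>t\<in>?M. indicator {t} s *\<^sub>R ?f t)"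
        using AE_msupp[OF \<mu>_finite]
      proof eventually_elim
        case (elim s)
        have "(\<Sum>t\<in>?M. indicator {t} s *\<^sub>R ?f t) = (\<Sum>t\<in>?M. if t = s then ?f t else 0)"
          by (rule sum.cong) (auto simp: indicator_def)
        then show ?case using elim fin by simp
      qed
    qed
    also have "\<dots> = (\<Sum>t\<in>?M. (LINT s|\<mu>. indicator {t} s *\<^sub>R ?f t))"
      using sets by (intro Bochner_Integration.integral_sum integrable_scaleR_left integrable_real_indicator)
        (auto simp: less_top[symmetric])
    also have "\<dots> = (\<Sum>t\<in>?M. m t * ?f t)"
    proof (rule sum.cong[OF refl])
      fix t
      have "integrable \<mu> (indicator {t} :: real \<Rightarrow> real)"
        using sets by (intro integrable_real_indicator) (auto simp: less_top[symmetric])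
      then have "(LINT s|\<mu>. indicator {t} s *\<^sub>R ?f t) = (LINT s|\<mu>. indicator {t} s) *\<^sub>R ?f t"
        by (intro integral_scaleR_left) auto
      then show "(LINT s|\<mu>. indicator {t} s *\<^sub>R ?f t) = m t * ?f t"
        using sets by (simp add: m_def scaleR_conv_of_real sets_eq_imp_space_eq[OF sets])
    qed
    finally have F: "F z = of_real A + of_real B * z + (\<Sum>t\<in>?M. m t * ?f t)"
      using F_eq z by simp
    have "poly q z * (\<Sum>t\<in>?M. m t * ?f t)
        = (\<Sum>s\<in>?M. m s * ((1 + z * of_real s) * (\<Prod>t\<in>?M - {s}. of_real t - z)))"
      unfolding sum_distrib_left
    proof (rule sum.cong[OF refl])
      fix s assume s: "s \<in> ?M"
      have "poly q z = (of_real s - z) * (\<Prod>t\<in>?M - {s}. of_real t - z)"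
        unfolding q_def poly_prod by (subst prod.remove[OF fin s]) simp
      then show "poly q z * (m s * ?f s) = m s * ((1 + z * of_real s) * (\<Prod>t\<in>?M - {s}. of_real t - z))"
        using nz[OF s] by simp
    qed
    then have "poly p z = poly q z * F z"
      unfolding F p_def by (simp add: poly_sum poly_prod algebra_simps)
    then show ?thesis using qz by simp
  qed
  ultimately show ?thesis unfolding rational_on_def by blast
qed

end

section \<open>The coordinate change and the kernel in the new coordinate\<close>

locale np_gap = np_function +
  fixes a b :: real and a\<^sub>m b\<^sub>m :: ereal and \<theta> :: real
  assumes infinite_msupp: "infinite (msupp \<mu>)"
    and a_less_b: "a < b"
    and gap: "{a..b} \<subseteq> einterval a\<^sub>m b\<^sub>m" "einterval a\<^sub>m b\<^sub>m \<inter> msupp \<mu> = {}"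
    and \<theta>: "b < \<theta>" "ereal \<theta> < b\<^sub>m"
begin

definition w :: "real \<Rightarrow> real" where "w x = 1 / (\<theta> - x)"

text \<open>The image under \<open>w\<close> of the right end of the gap, with 0 for infinity. The
  closed complement of the gap runs from \<open>b\<^sub>m\<close> through infinity to
  \<open>a\<^sub>m\<close>, so its image starts at the nonpositive \<open>al\<close> and ends at the
  nonnegative \<open>be\<close>.\<close>

definition al :: real where "al = (if b\<^sub>m = \<infinity> then 0 else 1 / (\<theta> - real_of_ereal b\<^sub>m))"

definition be :: real where "be = (if a\<^sub>m = - \<infinity> then 0 else 1 / (\<theta> - real_of_ereal a\<^sub>m))"

lemma a\<^sub>m_less: "a\<^sub>m < ereal a"
proof -
  have "a \<in> einterval a\<^sub>m b\<^sub>m" using gap(1) a_less_b by auto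
  then show ?thesis by (simp add: einterval_def)
qed

lemma msupp_cases:
  assumes "s \<in> msupp \<mu>"
  shows "ereal s \<le> a\<^sub>m \<or> b\<^sub>m \<le> ereal s"
proof -
  have "s \<notin> einterval a\<^sub>m b\<^sub>m" using gap(2) assms by blast
  then show ?thesis by (auto simp: einterval_def not_less)
qed

lemma al_cases:
  obtains "b\<^sub>m = \<infinity>" "al = 0" | r where "b\<^sub>m = ereal r" "\<theta> < r" "al = 1 / (\<theta> - r)"
proof (cases b\<^sub>m)
  case (real r)
  have "\<theta> < r" using \<theta>(2) real by simp
  moreover have "al = 1 / (\<theta> - r)" unfolding al_def by (simp add: real)
  ultimately show ?thesis by (rule that(2)[OF real])
next
  case PInf
  then show ?thesis by (rule that(1)) (unfold al_def, simp add: PInf)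
next
  case MInf
  then show ?thesis using \<theta>(2) by simp
qed

lemma be_cases:
  obtains "a\<^sub>m = - \<infinity>" "be = 0" | r where "a\<^sub>m = ereal r" "r < a" "be = 1 / (\<theta> - r)"
proof (cases a\<^sub>m)
  case (real r)
  have "r < a" using a\<^sub>m_less real by simp
  moreover have "be = 1 / (\<theta> - r)" unfolding be_def by (simp add: real)
  ultimately show ?thesis by (rule that(2)[OF real])
next
  case PInf
  then show ?thesis using a\<^sub>m_less by simp
next
  case MInf
  then have "a\<^sub>m = - \<infinity>" by simp
  then show ?thesis by (rule that(1)) (unfold be_def, simp add: \<open>a\<^sub>m = - \<infinity>\<close>)
qed

lemma al_be_0: "al \<le> 0" "0 \<le> be"
proof -
  show "al \<le> 0" by (cases rule: al_cases) auto
  show "0 \<le> be" using a_less_b \<theta>(1) by (cases rule: be_cases) auto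
qed

lemma be_less: "be < w a"
proof (cases rule: be_cases)
  case 1
  then show ?thesis using a_less_b \<theta>(1) by (simp add: w_def)
next
  case (2 r)
  then show ?thesis using a_less_b \<theta>(1) by (simp add: w_def frac_less2)
qed

lemma w_msupp:
  assumes "s \<in> msupp \<mu>"
  shows "w s \<in> {al..be}" "s \<noteq> \<theta>"
proof -
  have "w s \<in> {al..be} \<and> s \<noteq> \<theta>"
  proof (cases "ereal s \<le> a\<^sub>m")
    case True
    then show ?thesis
      using al_be_0 a_less_b \<theta>(1)
      by (cases rule: be_cases) (auto simp: w_def frac_le intro: order_trans[of al 0])
  next
    case False
    then have "b\<^sub>m \<le> ereal s" using msupp_cases[OF assms] by simp
    then show ?thesis
    proof (cases rule: al_cases)
      case (2 r)
      then have "1 / (s - \<theta>) \<le> 1 / (r - \<theta>)" "0 < s - \<theta>" using \<open>b\<^sub>m \<le> ereal s\<close> by (auto intro: frac_le)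
      moreover have "w s = - (1 / (s - \<theta>))" "al = - (1 / (r - \<theta>))"
        unfolding w_def 2(3) minus_divide_right by simp_all
      ultimately show ?thesis using al_be_0(2)
        by (auto intro: order_trans[of _ 0])
    qed simp
  qed
  then show "w s \<in> {al..be}" "s \<noteq> \<theta>" by auto
qed

lemma ray_of_coordinate:
  assumes "\<zeta> \<in> {al..be}" "\<zeta> \<noteq> 0"
  shows "of_real (\<theta> - 1 / \<zeta>) \<in> rays a\<^sub>m b\<^sub>m"
proof -
  have "ereal (\<theta> - 1 / \<zeta>) \<le> a\<^sub>m \<or> b\<^sub>m \<le> ereal (\<theta> - 1 / \<zeta>)"
  proof (cases "\<zeta> > 0")
    case True
    show ?thesis
    proof (cases rule: be_cases)
      case (2 r)
      have "\<theta> - r > 0" using 2 a_less_b \<theta>(1) by simp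
      then have "\<theta> - r \<le> 1 / \<zeta>" using assms(1) True 2(3) by (simp add: field_simps)
      then show ?thesis using 2(1) by simp
    qed (use True assms(1) in auto)
  next
    case False
    then have neg: "\<zeta> < 0" using assms(2) by simp
    show ?thesis
    proof (cases rule: al_cases)
      case (2 r)
      have "1 / (\<theta> - r) \<le> \<zeta>" using assms(1) 2(3) by simp
      then have "1 / \<zeta> \<le> \<theta> - r" using neg 2(2) by (simp add: field_simps)
      then show ?thesis using 2(1) by simp
    qed (use neg assms(1) in auto)
  qed
  then show ?thesis unfolding rays_def by blast
qed

text \<open>The polynomial of degree at most 1 that vanishes at the point with coordinate \<zeta>.
  For \<zeta> = 0 this point is infinity and the polynomial is the constant 1, so zeros at infinity
  fit into the same products.\<close>

definition lin :: "real \<Rightarrow> complex \<Rightarrow> complex" where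
  "lin \<zeta> z = 1 - of_real \<zeta> * (of_real \<theta> - z)"

lemma lin_eq_0:
  assumes "lin \<zeta> z = 0"
  shows "\<zeta> \<noteq> 0" "z = of_real (\<theta> - 1 / \<zeta>)"
proof -
  show nz: "\<zeta> \<noteq> 0" using assms by (auto simp: lin_def)
  have "of_real \<zeta> * (of_real \<theta> - z) = (1 :: complex)" using assms by (simp add: lin_def)
  then have "of_real \<theta> - z = 1 / of_real \<zeta>" using nz by (simp add: field_simps)
  then show "z = of_real (\<theta> - 1 / \<zeta>)" by (simp add: algebra_simps)
qed

lemma lin_nonzero:
  assumes "\<zeta> \<in> {al..be}" "z \<notin> rays a\<^sub>m b\<^sub>m"
  shows "lin \<zeta> z \<noteq> 0"
proof
  assume "lin \<zeta> z = 0"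
  note 0 = lin_eq_0[OF this]
  show False using ray_of_coordinate[OF assms(1) 0(1)] assms(2) unfolding 0(2) by blast
qed

text \<open>The value at 0 is the contribution of infinity. The factor \<open>(w s)\<^sup>2\<close>
  arises from \<open>w x - w s = (x - s) * w x * w s\<close>, used for both factors in the
  denominator of the Loewner integrand.\<close>

definition Lam :: "(real \<Rightarrow> real) \<Rightarrow> real" where
  "Lam h = B * h 0 + (LINT s:msupp \<mu>|\<mu>. h (w s) * ((1 + s\<^sup>2) * (w s)\<^sup>2))"

lemma \<theta>_msupp: "\<theta> \<notin> msupp \<mu>"
  using w_msupp(2) by blast

lemma w_inj: "x \<noteq> \<theta> \<Longrightarrow> y \<noteq> \<theta> \<Longrightarrow> w x = w y \<Longrightarrow> x = y"
  by (simp add: w_def)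

lemma w_continuous: "\<theta> \<notin> S \<Longrightarrow> continuous_on S w"
  unfolding w_def by (intro continuous_intros) auto

sublocale cauchy_kernel Lam al be
proof -
  have "pos_functional Lam al be finite"
    unfolding Lam_def
  proof -
    have "of_real \<theta> \<notin> complex_of_real ` msupp \<mu>" using \<theta>_msupp by auto
    then obtain C where C: "0 < C" "\<And>s. s \<in> msupp \<mu> \<Longrightarrow>
        cmod (of_real s - \<i>) \<le> C * cmod (of_real s - of_real \<theta>)"
      by (rule poisson_factor_bounded) (rule that)
    show "pos_functional (\<lambda>h. B * h 0 + (LINT s:msupp \<mu>|\<mu>. h (w s) * ((1 + s\<^sup>2) * (w s)\<^sup>2))) al be finite"
    proof (rule pushforward_pos_functional[OF \<mu>_finite closed_msupp order_refl])
      show "continuous_on (msupp \<mu>) w" by (rule w_continuous[OF \<theta>_msupp])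
      then show "continuous_on (msupp \<mu>) (\<lambda>s. (1 + s\<^sup>2) * (w s)\<^sup>2)" by (intro continuous_intros)
      show "w ` msupp \<mu> \<subseteq> {al..be}" using w_msupp(1) by blast
      show "0 \<le> B" by (rule B_nonneg)
      show "B = 0 \<or> 0 \<in> {al..be}" using al_be_0 by simp
      fix s assume s: "s \<in> msupp \<mu>"
      have ne: "s \<noteq> \<theta>" by (rule w_msupp(2)[OF s])
      \<comment> \<open>Boundedness of the density is the square of the estimate
        \<open>poisson_factor_bounded\<close> at \<theta>.\<close>
      have "(cmod (of_real s - \<i>))\<^sup>2 \<le> (C * cmod (of_real s - of_real \<theta>))\<^sup>2"
        using C(2)[OF s] by (intro power_mono) auto
      moreover have "(cmod (of_real s - \<i>))\<^sup>2 = 1 + s\<^sup>2" by (simp add: cmod_power2)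
      moreover have "cmod (of_real s - of_real \<theta>) = \<bar>s - \<theta>\<bar>"
        unfolding of_real_diff[symmetric] by (rule norm_of_real)
      moreover have "(C * \<bar>s - \<theta>\<bar>)\<^sup>2 = C\<^sup>2 * (\<theta> - s)\<^sup>2"
        by (simp add: power_mult_distrib power2_commute[of s])
      ultimately have "1 + s\<^sup>2 \<le> C\<^sup>2 * (\<theta> - s)\<^sup>2" by (simp only:)
      then have "(1 + s\<^sup>2) * (w s)\<^sup>2 \<le> C\<^sup>2" using ne by (simp add: w_def power_divide divide_le_eq)
      moreover have "0 < 1 + s\<^sup>2" by (intro add_pos_nonneg) auto
      then have "0 < (1 + s\<^sup>2) * (w s)\<^sup>2" using ne by (simp add: w_def)
      ultimately show "0 < (1 + s\<^sup>2) * (w s)\<^sup>2 \<and> (1 + s\<^sup>2) * (w s)\<^sup>2 \<le> C\<^sup>2" by simp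
    next
      fix Z :: "real set" assume "finite Z"
      have "inj_on w (msupp \<mu>)" using w_inj w_msupp(2) by (intro inj_onI) blast
      then have "infinite (w ` msupp \<mu>)" using infinite_msupp finite_imageD by blast
      then show "\<exists>y\<in>msupp \<mu>. w y \<notin> Z"
        using finite_subset[OF image_subsetI[of "msupp \<mu>" w Z] \<open>finite Z\<close>] by auto
    qed simp
  qed
  then show "cauchy_kernel Lam al be" by (simp add: cauchy_kernel_def)
qed

lemma interval_msupp: "x \<in> {a..b} \<Longrightarrow> x \<notin> msupp \<mu>"
  using gap by blast

lemma w_interval:
  assumes "x \<in> {a..b}"
  shows "x \<noteq> \<theta>" "w a \<le> w x" "w x \<le> w b" "0 < w x" "be < w x"
proof -
  show "x \<noteq> \<theta>" "w a \<le> w x" "w x \<le> w b" "0 < w x"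
    using assms \<theta>(1) by (auto simp: w_def frac_le)
  then show "be < w x" using be_less by simp
qed

lemma w_diff: "x \<noteq> \<theta> \<Longrightarrow> y \<noteq> \<theta> \<Longrightarrow> w x - w y = (x - y) * w x * w y"
  by (simp add: w_def field_simps)

lemma loewner_kernel_k:
  assumes x: "x \<in> {a..b}" and y: "y \<in> {a..b}"
  shows "loewner_kernel F x y = w x * w y * k (w x) (w y)"
proof -
  have pos: "0 < w x" "0 < w y" using w_interval x y by auto
  have "w x * w y * k (w x) (w y) = B + w x * w y *
      (LINT s:msupp \<mu>|\<mu>. 1 / ((w x - w s) * (w y - w s)) * ((1 + s\<^sup>2) * (w s)\<^sup>2))"
    using pos by (simp add: k_def Lam_def distrib_left)
  also have "w x * w y *
      (LINT s:msupp \<mu>|\<mu>. 1 / ((w x - w s) * (w y - w s)) * ((1 + s\<^sup>2) * (w s)\<^sup>2))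
    = (LINT s:msupp \<mu>|\<mu>. (w x * w y) * (1 / ((w x - w s) * (w y - w s)) * ((1 + s\<^sup>2) * (w s)\<^sup>2)))"
    by (rule set_integral_mult_right[symmetric])
  also have "\<dots> = (LINT s:msupp \<mu>|\<mu>. (1 + s\<^sup>2) / ((s - x) * (s - y)))"
    unfolding set_lebesgue_integral_def
  proof (rule Bochner_Integration.integral_cong[OF refl])
    fix s
    have "(w x * w y) * (1 / ((w x - w s) * (w y - w s)) * ((1 + s\<^sup>2) * (w s)\<^sup>2))
        = (1 + s\<^sup>2) / ((s - x) * (s - y))" if s: "s \<in> msupp \<mu>"
    proof -
      have ne: "s \<noteq> x" "s \<noteq> y" using interval_msupp x y s by auto
      have ws: "w s \<noteq> 0" using w_msupp(2)[OF s] by (simp add: w_def)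
      have "w x - w s = (x - s) * w x * w s" "w y - w s = (y - s) * w y * w s"
        using w_diff w_interval(1) x y w_msupp(2)[OF s] by auto
      then have eq: "(w x * w y) * (1 / ((w x - w s) * (w y - w s)) * ((1 + s\<^sup>2) * (w s)\<^sup>2))
          = (w x * w y) * (1 / (((x - s) * w x * w s) * ((y - s) * w y * w s)) * ((1 + s\<^sup>2) * (w s)\<^sup>2))"
        by (simp only:)
      also have "\<dots> = (1 + s\<^sup>2) / ((x - s) * (y - s))"
        using pos ws ne by (simp add: power2_eq_square)
      also have "(x - s) * (y - s) = (s - x) * (s - y)" by (simp add: algebra_simps)
      finally show ?thesis .
    qed
    then show "indicator (msupp \<mu>) s *\<^sub>R
        ((w x * w y) * (1 / ((w x - w s) * (w y - w s)) * ((1 + s\<^sup>2) * (w s)\<^sup>2)))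
      = indicator (msupp \<mu>) s *\<^sub>R ((1 + s\<^sup>2) / ((s - x) * (s - y)))"
      by (auto simp: indicator_def)
  qed
  finally show ?thesis using loewner_kernel_eq x y interval_msupp by simp
qed

definition \<Phi> :: "real \<Rightarrow> real" where "\<Phi> u = Re (F (of_real (\<theta> - 1 / u)))"

lemma \<Phi>_w: "x \<noteq> \<theta> \<Longrightarrow> \<Phi> (w x) = Re (F (of_real x))"
  by (simp add: \<Phi>_def w_def)

lemma \<Phi>_diff:
  assumes x: "x \<in> {a..b}" and y: "y \<in> {a..b}"
  shows "\<Phi> (w x) - \<Phi> (w y) = (w x - w y) * k (w x) (w y)"
proof -
  have "\<Phi> (w x) - \<Phi> (w y) = (x - y) * loewner_kernel F x y"
    using \<Phi>_w w_interval(1)[OF x] w_interval(1)[OF y] by (simp add: loewner_kernel_def)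
  also have "\<dots> = (w x - w y) * k (w x) (w y)"
    using w_diff w_interval(1)[OF x] w_interval(1)[OF y] loewner_kernel_k[OF x y] by simp
  finally show ?thesis .
qed

end

section \<open>AAA approximants\<close>

text \<open>Polynomial identities are checked through the coordinate \<open>w\<close>, which is real
  and singular at \<theta>; the remaining real points still determine a polynomial.\<close>

lemma complex_poly_eqI_reals:
  fixes p q :: "complex poly"
  assumes "\<And>x. x \<noteq> \<theta> \<Longrightarrow> poly p (of_real x) = poly q (of_real x)"
  shows "p = q"
proof (rule ccontr)
  assume "p \<noteq> q"
  then have "finite {z. poly (p - q) z = 0}" by (intro poly_roots_finite) simp
  moreover have "complex_of_real ` (- {\<theta>}) \<subseteq> {z. poly (p - q) z = 0}" using assms by auto
  ultimately have "finite (complex_of_real ` (- {\<theta>}))" by (rule finite_subset[rotated])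
  then have "finite (- {\<theta>})" by (rule finite_imageD) (auto simp: inj_on_def)
  then have "finite (UNIV :: real set)" by (metis Compl_partition finite.emptyI finite.insertI finite_Un)
  then show False using infinite_UNIV_char_0 by blast
qed

context np_gap
begin

lemma w_cancel: "x \<noteq> \<theta> \<Longrightarrow> (x - \<theta>) * w x = - 1"
  by (simp add: w_def divide_eq_eq)

lemma diff_eq_w:
  assumes "x \<noteq> \<theta>" "y \<noteq> \<theta>"
  shows "x - y = (x - \<theta>) * (w y - w x) / w y"
proof -
  have "(x - \<theta>) * (w y - w x) = ((x - \<theta>) * w x) * (y - x) * w y"
    unfolding w_diff[OF assms(2,1)] by (simp add: mult_ac)
  then have "(x - \<theta>) * (w y - w x) = (x - y) * w y"
    unfolding w_cancel[OF assms(1)] by simp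
  moreover have "w y \<noteq> 0" using assms(2) by (simp add: w_def)
  ultimately show ?thesis by simp
qed

lemma lin_real:
  assumes "x \<noteq> \<theta>"
  shows "lin \<zeta> (of_real x) = of_real ((x - \<theta>) * (\<zeta> - w x))"
proof -
  have "(x - \<theta>) * (\<zeta> - w x) = 1 - \<zeta> * (\<theta> - x)"
    using w_cancel[OF assms] by (simp add: algebra_simps)
  then show ?thesis by (simp add: lin_def)
qed

text \<open>\<open>(w x)\<^sup>2\<close> is the square of the factor \<open>w x\<close> shared by
  all the kernels \<open>loewner_kernel F x (t k)\<close>.\<close>

definition N :: "real measure \<Rightarrow> (real \<Rightarrow> real) \<Rightarrow> real" where
  "N \<nu> h = (LINT x:{a..b}|\<nu>. h (w x) * (w x)\<^sup>2)"

lemma kernel_pair_N: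
  assumes \<nu>: "finite_borel_measure \<nu>" "msupp \<nu> \<subseteq> {a..b}"
    and n: "1 \<le> n" "infinite (msupp \<nu>) \<or> n \<le> card (msupp \<nu>)"
  shows "kernel_pair Lam al be (N \<nu>) (w a) (w b) n"
proof -
  have \<theta>S: "\<theta> \<notin> {a..b}" using w_interval(1) by blast
  have "pos_functional (\<lambda>h. 0 * h 0 + (LINT x:{a..b}|\<nu>. h (w x) * (w x)\<^sup>2)) (w a) (w b)
      (\<lambda>S. finite S \<and> card S < n)"
  proof (rule pushforward_pos_functional[OF \<nu>(1) _ \<nu>(2)])
    show "continuous_on {a..b} w" by (rule w_continuous[OF \<theta>S])
    then show "continuous_on {a..b} (\<lambda>x. (w x)\<^sup>2)" by (intro continuous_intros)
    show "w ` {a..b} \<subseteq> {w a..w b}" using w_interval(2,3) by auto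
    show "0 < (w x)\<^sup>2 \<and> (w x)\<^sup>2 \<le> (w b)\<^sup>2" if "x \<in> {a..b}" for x
      using w_interval(3,4)[OF that] by (auto intro: power_mono)
    show "finite {} \<and> card {} < n" using n(1) by simp
    fix Z :: "real set" assume Z: "finite Z \<and> card Z < n"
    show "\<exists>y\<in>msupp \<nu>. w y \<notin> Z"
    proof (rule ccontr)
      assume "\<not> ?thesis"
      then have sub: "w ` msupp \<nu> \<subseteq> Z" by auto
      have inj: "inj_on w (msupp \<nu>)"
      proof (rule inj_onI)
        fix x y assume "x \<in> msupp \<nu>" "y \<in> msupp \<nu>" "w x = w y"
        then show "x = y" using w_inj[of x y] w_interval(1) \<nu>(2) by blast
      qed
      have "finite (w ` msupp \<nu>)" using sub Z finite_subset by blast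
      then have "finite (msupp \<nu>)" using inj by (rule finite_imageD)
      then have "n \<le> card (w ` msupp \<nu>)" using n(2) card_image[OF inj] by simp
      also have "\<dots> \<le> card Z" using sub Z by (intro card_mono) auto
      finally show False using Z by simp
    qed
  qed auto
  then have "pos_functional (N \<nu>) (w a) (w b) (\<lambda>S. finite S \<and> card S < n)"
    unfolding N_def by simp
  then show ?thesis
    using cauchy_kernel_axioms be_less unfolding kernel_pair_def kernel_pair_axioms_def by simp
qed

end

section \<open>The AAA data in the new coordinate\<close>

locale aaa_nodes = np_gap +
  fixes n :: nat and t :: "nat \<Rightarrow> real"
  assumes n_pos: "1 \<le> n" and t_mono: "strict_mono_on {1..n} t" and t_range: "t ` {1..n} \<subseteq> {a..b}"
begin

definition v :: "nat \<Rightarrow> real" where "v i = w (t i)"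

definition V :: "real set" where "V = v ` {1..n}"

text \<open>The weights as a function on the transformed nodes; the factor \<open>u\<close> is the
  \<open>w y\<close> of \<open>loewner_kernel_k\<close>.\<close>

definition D :: "(nat \<Rightarrow> real) \<Rightarrow> real \<Rightarrow> real" where
  "D c u = u * c (the_inv_into {1..n} v u)"

lemma t_interval: "i \<in> {1..n} \<Longrightarrow> t i \<in> {a..b}"
  using t_range by blast

lemma v_inj: "inj_on v {1..n}"
proof (rule inj_onI)
  fix i j assume ij: "i \<in> {1..n}" "j \<in> {1..n}" "v i = v j"
  have "t i = t j" using w_inj w_interval(1) t_interval ij unfolding v_def by blast
  then show "i = j" using strict_mono_on_imp_inj_on[OF t_mono] ij by (auto dest: inj_onD)
qed

lemma D_v: "i \<in> {1..n} \<Longrightarrow> D c (v i) = v i * c i"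
  by (simp only: D_def the_inv_into_f_f[OF v_inj])

lemma v_bounds:
  assumes "i \<in> {1..n}"
  shows "w a \<le> v i" "v i \<le> w b" "0 < v i" "be < v i"
  using w_interval[OF t_interval[OF assms]] by (auto simp: v_def)

lemma V_props: "nodes V" "card V = n" "V \<subseteq> {w a..w b}"
  using v_bounds card_image[OF v_inj] by (auto simp: V_def nodes_def)

lemma sum_V: "(\<Sum>u\<in>V. f u) = (\<Sum>i=1..n. f (v i))"
  unfolding V_def sum.reindex[OF v_inj] o_def ..

definition \<gamma> :: real where "\<gamma> = 1 / (\<Prod>i=1..n. v i)"

lemma \<gamma>_nonzero: "\<gamma> \<noteq> 0"
  using v_bounds(3) by (auto simp: \<gamma>_def) force

text \<open>Each factor \<open>x - t j\<close> equals
  \<open>(x - \<theta>) * (v j - w x) / v j\<close>. The constant \<gamma> collects all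
  \<open>1 / v j\<close>, including the one for \<open>j = i\<close>, and the factor
  \<open>v i\<close> corrects for this.\<close>

lemma aaa_L_real:
  assumes i: "i \<in> {1..n}" and x: "x \<noteq> \<theta>"
  shows "poly (aaa_L n t i) (of_real x)
    = of_real (\<gamma> * (x - \<theta>) ^ (n - 1) * (v i * node_prod (V - {v i}) (w x)))"
proof -
  let ?I = "{1..n} - {i}"
  have "poly (aaa_L n t i) (of_real x) = of_real (\<Prod>j\<in>?I. x - t j)"
    by (simp add: aaa_L_def poly_prod)
  also have "(\<Prod>j\<in>?I. x - t j) = (\<Prod>j\<in>?I. (x - \<theta>) * (v j - w x) / v j)"
  proof (rule prod.cong[OF refl])
    fix j assume "j \<in> ?I"
    then have "t j \<noteq> \<theta>" using w_interval(1)[OF t_interval] by auto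
    then show "x - t j = (x - \<theta>) * (v j - w x) / v j"
      unfolding v_def by (rule diff_eq_w[OF x])
  qed
  also have "\<dots> = (x - \<theta>) ^ (n - 1) * (\<Prod>j\<in>?I. v j - w x) / (\<Prod>j\<in>?I. v j)"
    using i by (simp add: prod_dividef prod.distrib)
  also have "(\<Prod>j\<in>?I. v j - w x) = node_prod (V - {v i}) (w x)"
  proof -
    have "V - {v i} = v ` ?I" unfolding V_def using inj_on_image_set_diff[OF v_inj, of "{1..n}" "{i}"] i by auto
    moreover have "inj_on v ?I" using v_inj by (rule inj_on_subset) auto
    ultimately show ?thesis by (simp add: node_prod_def prod.reindex)
  qed
  also have "(\<Prod>j\<in>?I. v j) = 1 / (\<gamma> * v i)"
  proof -
    have "(\<Prod>j=1..n. v j) = v i * (\<Prod>j\<in>?I. v j)" using i by (intro prod.remove) auto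
    moreover have "v i \<noteq> 0" using v_bounds(3)[OF i] by simp
    ultimately show ?thesis by (simp add: \<gamma>_def)
  qed
  finally show ?thesis by (simp add: mult_ac)
qed

lemma node_poly_V:
  "poly (node_poly V f) u = (\<Sum>i=1..n. f (v i) * node_prod (V - {v i}) u)"
  unfolding poly_node_poly sum_V ..

lemma aaa_P_real:
  assumes "x \<noteq> \<theta>"
  shows "poly (aaa_P n t c) (of_real x)
    = of_real (\<gamma> * (x - \<theta>) ^ (n - 1) * poly (node_poly V (D c)) (w x))"
proof -
  have "poly (aaa_P n t c) (of_real x) = (\<Sum>i=1..n. of_real (c i) * poly (aaa_L n t i) (of_real x))"
    by (simp add: aaa_P_def poly_sum)
  also have "\<dots> = (\<Sum>i=1..n. of_real (\<gamma> * (x - \<theta>) ^ (n - 1) * (D c (v i) * node_prod (V - {v i}) (w x))))"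
    by (rule sum.cong[OF refl])
      (simp add: aaa_L_real[OF _ assms] D_v mult_ac del: of_real_power of_real_diff)
  finally show ?thesis unfolding node_poly_V sum_distrib_left of_real_sum .
qed

lemma aaa_Q_real:
  assumes "x \<noteq> \<theta>"
  shows "poly (aaa_Q F n t c) (of_real x)
    = of_real (\<gamma> * (x - \<theta>) ^ (n - 1) * poly (node_poly V (\<lambda>u. D c u * \<Phi> u)) (w x))"
proof -
  have F: "F (of_real (t i)) = of_real (\<Phi> (v i))" if "i \<in> {1..n}" for i
    using F_real[OF interval_msupp[OF t_interval[OF that]]] \<Phi>_w w_interval(1)[OF t_interval[OF that]]
    by (simp add: v_def)
  have "poly (aaa_Q F n t c) (of_real x)
      = (\<Sum>i=1..n. of_real (c i) * F (of_real (t i)) * poly (aaa_L n t i) (of_real x))"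
    by (simp add: aaa_Q_def poly_sum)
  also have "\<dots> = (\<Sum>i=1..n. of_real (\<gamma> * (x - \<theta>) ^ (n - 1)
      * (D c (v i) * \<Phi> (v i) * node_prod (V - {v i}) (w x))))"
    by (rule sum.cong[OF refl])
      (simp add: aaa_L_real[OF _ assms] D_v F mult_ac del: of_real_power of_real_diff)
  finally show ?thesis unfolding node_poly_V sum_distrib_left of_real_sum .
qed

lemma objective_eq: "aaa_objective F a b n \<nu> t c = N \<nu> (\<lambda>u. (tr V (D c) u)\<^sup>2)"
  unfolding aaa_objective_def N_def set_lebesgue_integral_def
proof (rule Bochner_Integration.integral_cong[OF refl])
  fix x
  have "(\<Sum>i=1..n. c i * loewner_kernel F x (t i))\<^sup>2 = (tr V (D c) (w x))\<^sup>2 * (w x)\<^sup>2"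
    if x: "x \<in> {a..b}"
  proof -
    have "(\<Sum>i=1..n. c i * loewner_kernel F x (t i)) = (\<Sum>i=1..n. w x * (D c (v i) * k (w x) (v i)))"
      by (rule sum.cong[OF refl]) (simp add: loewner_kernel_k[OF x t_interval] D_v, simp add: v_def)
    also have "\<dots> = w x * tr V (D c) (w x)" unfolding tr_def sum_V sum_distrib_left ..
    finally show ?thesis by (simp add: power_mult_distrib)
  qed
  then show "indicator {a..b} x *\<^sub>R (\<Sum>i=1..n. c i * loewner_kernel F x (t i))\<^sup>2
      = indicator {a..b} x *\<^sub>R ((tr V (D c) (w x))\<^sup>2 * (w x)\<^sup>2)"
    by (auto simp: indicator_def)
qed

text \<open>Since \<open>D c (v i) = v i * c i\<close>, the Euclidean sphere of the weights becomes
  the sphere of the norm with weights \<open>1 / u\<^sup>2\<close>. This is the reason for the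
  weight \<open>W\<close> in \<open>minimiser_trace_zeros\<close>.\<close>

lemma weights_trace_zeros:
  assumes \<nu>: "finite_borel_measure \<nu>" "msupp \<nu> \<subseteq> {a..b}" "infinite (msupp \<nu>) \<or> n \<le> card (msupp \<nu>)"
    and c: "aaa_weights F a b n \<nu> t c"
  obtains X where "nodes X" "card V = Suc (card X)" "\<And>x. x \<in> X \<Longrightarrow> tr V (D c) x = 0"
    "\<exists>u\<in>V. D c u \<noteq> 0"
proof -
  interpret kernel_pair Lam al be "N \<nu>" "w a" "w b" n
    by (rule kernel_pair_N[OF \<nu>(1,2) n_pos \<nu>(3)])
  let ?W = "\<lambda>u. 1 / u\<^sup>2"
  have WD: "(\<Sum>u\<in>V. ?W u * (D c u)\<^sup>2) = (\<Sum>i=1..n. (c i)\<^sup>2)" for c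
    unfolding sum_V
  proof (rule sum.cong[OF refl])
    fix i assume i: "i \<in> {1..n}"
    then have "v i \<noteq> 0" using v_bounds(3)[OF i] by simp
    then show "1 / (v i)\<^sup>2 * (D c (v i))\<^sup>2 = (c i)\<^sup>2" using i by (simp add: D_v power_mult_distrib)
  qed
  have W: "0 < ?W u" if "u \<in> V" for u
  proof -
    have "0 < u" using that v_bounds(3) unfolding V_def by blast
    then show ?thesis by simp
  qed
  have norm: "(\<Sum>u\<in>V. ?W u * (D c u)\<^sup>2) = 1" using c by (simp only: WD aaa_weights_def)
  have min: "N \<nu> (\<lambda>u. (tr V (D c) u)\<^sup>2) \<le> N \<nu> (\<lambda>u. (tr V e u)\<^sup>2)"
    if e: "(\<Sum>u\<in>V. ?W u * (e u)\<^sup>2) = 1" for e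
  proof -
    define c' where "c' = (\<lambda>i. e (v i) / v i)"
    have De: "D c' u = e u" if u: "u \<in> V" for u
    proof -
      obtain i where i: "i \<in> {1..n}" "u = v i" using u unfolding V_def by blast
      then show ?thesis using v_bounds(3)[OF i(1)] by (simp add: D_v[OF i(1)] c'_def)
    qed
    have "(\<Sum>i=1..n. (c' i)\<^sup>2) = (\<Sum>u\<in>V. ?W u * (e u)\<^sup>2)"
      unfolding WD[symmetric] by (rule sum.cong) (auto simp: De)
    then have "aaa_objective F a b n \<nu> t c \<le> aaa_objective F a b n \<nu> t c'"
      using c e by (simp add: aaa_weights_def)
    moreover have "tr V (D c') u = tr V e u" for u
      unfolding tr_def by (rule sum.cong) (auto simp: De)
    ultimately show ?thesis by (simp add: objective_eq)
  qed
  obtain X where X: "X \<subseteq> {w a..w b}" "finite X" "card V = Suc (card X)"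
      "\<And>x. x \<in> X \<Longrightarrow> tr V (D c) x = 0"
    by (rule minimiser_trace_zeros[OF V_props(1,2) W norm min]) (assumption | rule that)+
  have "nodes X" using X(1,2) be_less by (auto simp: nodes_def)
  moreover have "\<exists>u\<in>V. D c u \<noteq> 0"
  proof (rule ccontr)
    assume "\<not> ?thesis"
    then have "(\<Sum>u\<in>V. ?W u * (D c u)\<^sup>2) = 0" by simp
    then show False using norm by simp
  qed
  ultimately show ?thesis using X(3,4) by (intro that)
qed

definition lin_prod :: "real set \<Rightarrow> complex \<Rightarrow> complex" where
  "lin_prod S z = (\<Prod>\<zeta>\<in>S. lin \<zeta> z)"

lemma lin_prod_real:
  assumes "x \<noteq> \<theta>"
  shows "lin_prod S (of_real x) = of_real ((x - \<theta>) ^ card S * node_prod S (w x))"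
proof -
  have "lin_prod S (of_real x) = of_real (\<Prod>\<zeta>\<in>S. (x - \<theta>) * (\<zeta> - w x))"
    unfolding lin_prod_def of_real_prod lin_real[OF assms] ..
  then show ?thesis by (simp add: prod.distrib node_prod_def)
qed

lemma lin_poly: "lin \<zeta> z = poly [:1 - of_real (\<zeta> * \<theta>), of_real \<zeta>:] z"
  by (simp add: lin_def algebra_simps)

lemma lin_prod_poly: "lin_prod S z = poly (\<Prod>\<zeta>\<in>S. [:1 - of_real (\<zeta> * \<theta>), of_real \<zeta>:]) z"
  unfolding lin_prod_def lin_poly poly_prod ..

text \<open>\<open>interpolant_structure\<close> carried back to polynomials in \<open>z\<close>: a
  zero \<zeta> in the coordinate becomes the factor \<open>lin \<zeta>\<close>. If 0 lies in
  \<open>Z\<close>, that zero sits at infinity and the degree of the denominator drops, whence the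
  restriction to nonzero \<zeta>.\<close>

lemma aaa_structure:
  assumes \<nu>: "finite_borel_measure \<nu>" "msupp \<nu> \<subseteq> {a..b}" "infinite (msupp \<nu>) \<or> n \<le> card (msupp \<nu>)"
    and c: "aaa_weights F a b n \<nu> t c"
    and C: "0 \<le> C" "\<And>u v. u \<in> {w a..w b} \<Longrightarrow> v \<in> {w a..w b} \<Longrightarrow> (u - al) * k u v \<le> C"
  obtains Z \<kappa> where "Z \<subseteq> {al..be}" "finite Z" "\<kappa> \<noteq> 0"
    "\<And>z. poly (aaa_P n t c) z = of_real \<kappa> * lin_prod Z z"
    "\<And>\<zeta>. \<zeta> \<in> Z \<Longrightarrow> \<zeta> \<noteq> 0 \<Longrightarrow> poly (aaa_Q F n t c) (of_real (\<theta> - 1 / \<zeta>)) \<noteq> 0"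
    "\<And>i. i \<in> {1..n} \<Longrightarrow> \<exists>mu. (\<forall>\<zeta>\<in>Z. 0 \<le> mu \<zeta>) \<and> (\<Sum>\<zeta>\<in>Z. mu \<zeta>) \<le> C \<and>
      (\<forall>z. poly (aaa_Q F n t c) z = of_real \<kappa> * (F (of_real (t i)) * lin_prod Z z
        + lin (v i) z * (\<Sum>\<zeta>\<in>Z. of_real (mu \<zeta>) * lin_prod (Z - {\<zeta>}) z)))"
proof -
  obtain X where X: "nodes X" "card V = Suc (card X)" "\<And>x. x \<in> X \<Longrightarrow> tr V (D c) x = 0"
      "\<exists>u\<in>V. D c u \<noteq> 0"
    by (rule weights_trace_zeros[OF \<nu> c]) (rule that)
  have \<Phi>d: "\<Phi> x - \<Phi> y = (x - y) * k x y" if "x \<in> V" "y \<in> V" for x y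
    using that \<Phi>_diff t_interval unfolding V_def v_def by blast
  have bound: "(x - al) * k x y \<le> C" if "x \<in> V" "y \<in> V" for x y
    using that V_props(3) by (intro C(2)) auto
  let ?q = "node_poly V (\<lambda>v. D c v * \<Phi> v)"
  obtain Z \<kappa> where Z: "Z \<subseteq> {al..be}" "finite Z" "card Z = card X" "\<kappa> \<noteq> 0"
      "node_poly V (D c) = smult \<kappa> (\<Prod>z\<in>Z. [:z, -1:])"
      "\<And>z. z \<in> Z \<Longrightarrow> poly ?q z \<noteq> 0"
      "\<And>y. y \<in> V \<Longrightarrow> \<exists>mu. (\<forall>z\<in>Z. 0 \<le> mu z) \<and> (\<Sum>z\<in>Z. mu z) \<le> C \<and>
        ?q = smult \<kappa> (smult (\<Phi> y) (\<Prod>z\<in>Z. [:z, -1:]) - [:- y, 1:] * node_poly Z mu)"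
    by (rule interpolant_structure[OF X(1) V_props(1) X(2,3,4) \<Phi>d bound C(1)])
      (assumption | rule that)+
  have cardZ: "card Z = n - 1" using Z(3) X(2) V_props(2) by simp
  show ?thesis
  proof (rule that[of Z "\<gamma> * \<kappa>"])
    show "Z \<subseteq> {al..be}" "finite Z" "\<gamma> * \<kappa> \<noteq> 0" using Z \<gamma>_nonzero by auto
  next
    fix z
    have "aaa_P n t c
        = smult (of_real (\<gamma> * \<kappa>)) (\<Prod>\<zeta>\<in>Z. [:1 - of_real (\<zeta> * \<theta>), of_real \<zeta>:])"
    proof (rule complex_poly_eqI_reals)
      fix x assume x: "x \<noteq> \<theta>"
      show "poly (aaa_P n t c) (of_real x)
          = poly (smult (of_real (\<gamma> * \<kappa>)) (\<Prod>\<zeta>\<in>Z. [:1 - of_real (\<zeta> * \<theta>), of_real \<zeta>:])) (of_real x)"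
        unfolding aaa_P_real[OF x] poly_smult lin_prod_poly[symmetric] lin_prod_real[OF x] Z(5) cardZ
          poly_prod_node by (simp add: mult_ac)
    qed
    then show "poly (aaa_P n t c) z = of_real (\<gamma> * \<kappa>) * lin_prod Z z"
      by (simp add: lin_prod_poly)
  next
    fix \<zeta> assume \<zeta>: "\<zeta> \<in> Z" "\<zeta> \<noteq> 0"
    have "\<theta> - 1 / \<zeta> \<noteq> \<theta>" using \<zeta>(2) by simp
    then show "poly (aaa_Q F n t c) (of_real (\<theta> - 1 / \<zeta>)) \<noteq> 0"
      unfolding aaa_Q_real[OF \<open>\<theta> - 1 / \<zeta> \<noteq> \<theta>\<close>] using Z(6)[OF \<zeta>(1)] \<gamma>_nonzero \<zeta>(2)
      by (simp add: w_def)
  next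
    fix i assume i: "i \<in> {1..n}"
    then have "v i \<in> V" by (simp add: V_def)
    from Z(7)[OF this] obtain mu where mu: "\<forall>z\<in>Z. 0 \<le> mu z" "(\<Sum>z\<in>Z. mu z) \<le> C"
        "?q = smult \<kappa> (smult (\<Phi> (v i)) (\<Prod>z\<in>Z. [:z, -1:]) - [:- v i, 1:] * node_poly Z mu)" by blast
    have Fi: "F (of_real (t i)) = of_real (\<Phi> (v i))"
      using F_real[OF interval_msupp[OF t_interval[OF i]]] \<Phi>_w w_interval(1)[OF t_interval[OF i]]
      by (simp add: v_def)
    let ?lp = "\<lambda>S. \<Prod>\<zeta>\<in>S. [:1 - complex_of_real (\<zeta> * \<theta>), of_real \<zeta>:]"
    let ?T = "smult (of_real (\<gamma> * \<kappa>)) (smult (F (of_real (t i))) (?lp Z)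
      + [:1 - of_real (v i * \<theta>), of_real (v i):] * (\<Sum>\<zeta>\<in>Z. smult (of_real (mu \<zeta>)) (?lp (Z - {\<zeta>}))))"
    have T: "poly ?T z = of_real (\<gamma> * \<kappa>) * (F (of_real (t i)) * lin_prod Z z
        + lin (v i) z * (\<Sum>\<zeta>\<in>Z. of_real (mu \<zeta>) * lin_prod (Z - {\<zeta>}) z))" for z
      unfolding lin_prod_poly lin_poly poly_smult poly_add poly_mult poly_sum ..
    have "aaa_Q F n t c = ?T"
    proof (rule complex_poly_eqI_reals)
      fix x assume x: "x \<noteq> \<theta>"
      note lin_x = lin_real[OF x, of "v i"]
      \<comment> \<open>Each \<open>lin_prod (Z - {\<zeta>})\<close> has one power of
        \<open>x - \<theta>\<close> less than \<open>lin_prod Z\<close>; the factor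
        \<open>lin (v i)\<close> makes up for it.\<close>
      have sum: "(x - \<theta>) * (\<Sum>\<zeta>\<in>Z. mu \<zeta> * ((x - \<theta>) ^ card (Z - {\<zeta>}) * node_prod (Z - {\<zeta>}) (w x)))
          = (x - \<theta>) ^ (n - 1) * poly (node_poly Z mu) (w x)"
        unfolding poly_node_poly sum_distrib_left
      proof (rule sum.cong[OF refl])
        fix \<zeta> assume "\<zeta> \<in> Z"
        then have "n - 1 = Suc (card (Z - {\<zeta>}))" using Z(2) cardZ by (metis card_Suc_Diff1)
        then show "(x - \<theta>) * (mu \<zeta> * ((x - \<theta>) ^ card (Z - {\<zeta>}) * node_prod (Z - {\<zeta>}) (w x)))
            = (x - \<theta>) ^ (n - 1) * (mu \<zeta> * node_prod (Z - {\<zeta>}) (w x))"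
          by simp
      qed
      have "poly ?T (of_real x) = of_real (\<gamma> * \<kappa> * (\<Phi> (v i) * ((x - \<theta>) ^ (n - 1) * node_prod Z (w x))
          + (v i - w x) * ((x - \<theta>) * (\<Sum>\<zeta>\<in>Z. mu \<zeta> *
              ((x - \<theta>) ^ card (Z - {\<zeta>}) * node_prod (Z - {\<zeta>}) (w x))))))"
        unfolding T[of "of_real x"]
        unfolding lin_prod_real[OF x] lin_x Fi cardZ of_real_mult[symmetric] of_real_sum[symmetric] of_real_add[symmetric] of_real_eq_iff by (simp only: mult_ac)
      also have "\<dots> = of_real (\<gamma> * (x - \<theta>) ^ (n - 1) * poly ?q (w x))"
        unfolding sum unfolding mu(3) by (simp add: poly_prod_node algebra_simps)
      finally show "poly (aaa_Q F n t c) (of_real x) = poly ?T (of_real x)"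
        unfolding aaa_Q_real[OF x] ..
    qed
    then show "\<exists>mu. (\<forall>\<zeta>\<in>Z. 0 \<le> mu \<zeta>) \<and> (\<Sum>\<zeta>\<in>Z. mu \<zeta>) \<le> C \<and>
      (\<forall>z. poly (aaa_Q F n t c) z = of_real (\<gamma> * \<kappa>) * (F (of_real (t i)) * lin_prod Z z
        + lin (v i) z * (\<Sum>\<zeta>\<in>Z. of_real (mu \<zeta>) * lin_prod (Z - {\<zeta>}) z)))"
      using mu(1,2) T by (intro exI[of _ mu]) simp
  qed
qed

end

section \<open>Poles, and an error bound with uniform constants\<close>

context aaa_nodes
begin

lemma lin_prod_eq_0: "finite S \<Longrightarrow> lin_prod S z = 0 \<longleftrightarrow> (\<exists>\<zeta>\<in>S. lin \<zeta> z = 0)"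
  by (simp add: lin_prod_def)

lemma aaa_zeros_and_poles:
  assumes \<nu>: "finite_borel_measure \<nu>" "msupp \<nu> \<subseteq> {a..b}" "infinite (msupp \<nu>) \<or> n \<le> card (msupp \<nu>)"
    and c: "aaa_weights F a b n \<nu> t c"
    and C: "0 \<le> C" "\<And>u v. u \<in> {w a..w b} \<Longrightarrow> v \<in> {w a..w b} \<Longrightarrow> (u - al) * k u v \<le> C"
  shows "\<not> (\<exists>z. poly (aaa_P n t c) z = 0 \<and> poly (aaa_Q F n t c) z = 0)"
    and "{z. poly (aaa_P n t c) z = 0} = {z. is_pole (aaa_R F n t c) z}"
    and "{z. poly (aaa_P n t c) z = 0} \<subseteq> rays a\<^sub>m b\<^sub>m"
proof -
  let ?P = "aaa_P n t c" and ?Q = "aaa_Q F n t c"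
  obtain Z \<kappa> where Z: "Z \<subseteq> {al..be}" "finite Z" "\<kappa> \<noteq> 0"
    "\<And>z. poly ?P z = of_real \<kappa> * lin_prod Z z"
    "\<And>\<zeta>. \<zeta> \<in> Z \<Longrightarrow> \<zeta> \<noteq> 0 \<Longrightarrow> poly ?Q (of_real (\<theta> - 1 / \<zeta>)) \<noteq> 0"
    by (rule aaa_structure[OF \<nu> c C]) (assumption | rule that)+
  have zero: "poly ?Q z \<noteq> 0 \<and> z \<in> rays a\<^sub>m b\<^sub>m" if "poly ?P z = 0" for z
  proof -
    have "lin_prod Z z = 0" using that Z(3,4) by simp
    then obtain \<zeta> where \<zeta>: "\<zeta> \<in> Z" "lin \<zeta> z = 0" using lin_prod_eq_0[OF Z(2)] by blast
    note 0 = lin_eq_0[OF \<zeta>(2)]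
    have "\<zeta> \<in> {al..be}" using Z(1) \<zeta>(1) by blast
    then show ?thesis unfolding 0(2) using Z(5)[OF \<zeta>(1) 0(1)] ray_of_coordinate 0(1) by blast
  qed
  then show "\<not> (\<exists>z. poly ?P z = 0 \<and> poly ?Q z = 0)" "{z. poly ?P z = 0} \<subseteq> rays a\<^sub>m b\<^sub>m" by blast+
  \<comment> \<open>The test point is \<theta>, where every factor \<open>lin \<zeta>\<close> equals
    1.\<close>
  have "?P \<noteq> 0"
  proof
    assume "?P = 0"
    then have "of_real \<theta> \<in> rays a\<^sub>m b\<^sub>m" using zero[of "of_real \<theta>"] by simp
    then have "lin_prod Z (of_real \<theta>) = 0" using \<open>?P = 0\<close> Z(3) Z(4)[of "of_real \<theta>"] by simp
    then show False using lin_prod_eq_0[OF Z(2)] by (simp add: lin_def)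
  qed
  have "is_pole (aaa_R F n t c) z \<longleftrightarrow> poly ?P z = 0" for z
  proof
    assume P: "poly ?P z = 0"
    have "\<forall>\<^sub>F x in at z. poly ?P x \<noteq> 0"
    proof -
      have "finite {x. poly ?P x = 0}" by (rule poly_roots_finite[OF \<open>?P \<noteq> 0\<close>])
      then have "\<not> z islimpt {x. poly ?P x = 0}" by (rule islimpt_finite)
      then show ?thesis by (simp add: islimpt_iff_eventually)
    qed
    moreover have "(poly ?P \<longlongrightarrow> poly ?P z) (at z)" by (rule isContD) simp
    then have "(poly ?P \<longlongrightarrow> 0) (at z)" unfolding P .
    ultimately have "filterlim (poly ?P) (at 0) (at z)" by (simp add: filterlim_at)
    then have "is_pole (\<lambda>x. poly ?Q x / poly ?P x) z"
      using zero[OF P] by (intro is_pole_divide) auto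
    then show "is_pole (aaa_R F n t c) z" unfolding aaa_R_def .
  next
    assume pole: "is_pole (aaa_R F n t c) z"
    show "poly ?P z = 0"
    proof (rule ccontr)
      assume "poly ?P z \<noteq> 0"
      then have "isCont (aaa_R F n t c) z" unfolding aaa_R_def by (intro continuous_intros) auto
      then have "(aaa_R F n t c \<longlongrightarrow> aaa_R F n t c z) (at z)" by (rule isContD)
      then show False using pole not_tendsto_and_filterlim_at_infinity[of "at z"]
        unfolding is_pole_def by auto
    qed
  qed
  then show "{z. poly ?P z = 0} = {z. is_pole (aaa_R F n t c) z}" by simp
qed

text \<open>After division by \<open>lin_prod Z\<close> the difference is \<open>lin (v i) z\<close>
  times the sum of \<open>mu \<zeta> / lin \<zeta> z\<close>, with nonnegative masses of total at
  most \<open>C\<close>. Besides \<open>v i\<close>, the right-hand side contains nothing tied to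
  \<open>n\<close> or \<nu>.\<close>

lemma aaa_R_bound:
  assumes \<nu>: "finite_borel_measure \<nu>" "msupp \<nu> \<subseteq> {a..b}" "infinite (msupp \<nu>) \<or> n \<le> card (msupp \<nu>)"
    and c: "aaa_weights F a b n \<nu> t c"
    and C: "0 \<le> C" "\<And>u v. u \<in> {w a..w b} \<Longrightarrow> v \<in> {w a..w b} \<Longrightarrow> (u - al) * k u v \<le> C"
    and i: "i \<in> {1..n}"
    and \<delta>: "0 < \<delta>" "\<And>\<zeta>. \<zeta> \<in> {al..be} \<Longrightarrow> \<delta> \<le> cmod (lin \<zeta> z)"
  shows "cmod (aaa_R F n t c z - F (of_real (t i))) \<le> cmod (lin (v i) z) * (C / \<delta>)"
proof -
  let ?P = "aaa_P n t c" and ?Q = "aaa_Q F n t c"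
  obtain Z \<kappa> where Z: "Z \<subseteq> {al..be}" "finite Z" "\<kappa> \<noteq> 0"
    "\<And>z. poly ?P z = of_real \<kappa> * lin_prod Z z"
    "\<And>i. i \<in> {1..n} \<Longrightarrow> \<exists>mu. (\<forall>\<zeta>\<in>Z. 0 \<le> mu \<zeta>) \<and> (\<Sum>\<zeta>\<in>Z. mu \<zeta>) \<le> C \<and>
      (\<forall>z. poly ?Q z = of_real \<kappa> * (F (of_real (t i)) * lin_prod Z z
        + lin (v i) z * (\<Sum>\<zeta>\<in>Z. of_real (mu \<zeta>) * lin_prod (Z - {\<zeta>}) z)))"
    by (rule aaa_structure[OF \<nu> c C]) (assumption | rule that)+
  obtain mu where mu: "\<forall>\<zeta>\<in>Z. 0 \<le> mu \<zeta>" "(\<Sum>\<zeta>\<in>Z. mu \<zeta>) \<le> C"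
      "\<forall>z. poly ?Q z = of_real \<kappa> * (F (of_real (t i)) * lin_prod Z z
        + lin (v i) z * (\<Sum>\<zeta>\<in>Z. of_real (mu \<zeta>) * lin_prod (Z - {\<zeta>}) z))"
    using Z(5)[OF i] by blast
  have d: "\<delta> \<le> cmod (lin \<zeta> z)" if "\<zeta> \<in> Z" for \<zeta> using \<delta>(2) Z(1) that by blast
  have nz: "lin \<zeta> z \<noteq> 0" if "\<zeta> \<in> Z" for \<zeta> using d[OF that] \<delta>(1) by auto
  have LP: "lin_prod Z z \<noteq> 0" unfolding lin_prod_eq_0[OF Z(2)] using nz by blast
  have "(\<Sum>\<zeta>\<in>Z. of_real (mu \<zeta>) * lin_prod (Z - {\<zeta>}) z) = (\<Sum>\<zeta>\<in>Z. of_real (mu \<zeta>) / lin \<zeta> z) * lin_prod Z z"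
    unfolding sum_distrib_right
  proof (rule sum.cong[OF refl])
    fix \<zeta> assume \<zeta>: "\<zeta> \<in> Z"
    have "lin_prod Z z = lin \<zeta> z * lin_prod (Z - {\<zeta>}) z"
      unfolding lin_prod_def by (rule prod.remove[OF Z(2) \<zeta>])
    then show "of_real (mu \<zeta>) * lin_prod (Z - {\<zeta>}) z = of_real (mu \<zeta>) / lin \<zeta> z * lin_prod Z z"
      using nz[OF \<zeta>] by simp
  qed
  then have "poly ?Q z = of_real \<kappa> * lin_prod Z z *
      (F (of_real (t i)) + lin (v i) z * (\<Sum>\<zeta>\<in>Z. of_real (mu \<zeta>) / lin \<zeta> z))"
    using mu(3) by (simp add: algebra_simps)
  then have "aaa_R F n t c z - F (of_real (t i)) = lin (v i) z * (\<Sum>\<zeta>\<in>Z. of_real (mu \<zeta>) / lin \<zeta> z)"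
    unfolding aaa_R_def Z(4) using LP Z(3) by simp
  moreover have "cmod (\<Sum>\<zeta>\<in>Z. of_real (mu \<zeta>) / lin \<zeta> z) \<le> C / \<delta>"
  proof -
    have "cmod (\<Sum>\<zeta>\<in>Z. of_real (mu \<zeta>) / lin \<zeta> z) \<le> (\<Sum>\<zeta>\<in>Z. mu \<zeta> / \<delta>)"
    proof (rule sum_norm_le)
      fix \<zeta> assume \<zeta>: "\<zeta> \<in> Z"
      then have "mu \<zeta> / cmod (lin \<zeta> z) \<le> mu \<zeta> / \<delta>"
        using mu(1) d[OF \<zeta>] \<delta>(1) by (intro divide_left_mono mult_pos_pos) auto
      then show "cmod (of_real (mu \<zeta>) / lin \<zeta> z) \<le> mu \<zeta> / \<delta>"
        using mu(1) \<zeta> by (simp add: norm_divide)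
    qed
    also have "\<dots> \<le> C / \<delta>"
      unfolding sum_divide_distrib[symmetric] using mu(2) \<delta>(1) by (intro divide_right_mono) auto
    finally show ?thesis .
  qed
  ultimately show ?thesis by (simp only: norm_mult mult_left_mono norm_ge_zero)
qed

end

section \<open>Convergence away from the rays\<close>

lemma closed_rays: "closed (rays a\<^sub>m b\<^sub>m)"
proof -
  have "closed {x. ereal x \<le> a\<^sub>m}" "closed {x. b\<^sub>m \<le> ereal x}"
    by (intro closed_Collect_le continuous_intros)+
  then show ?thesis unfolding rays_def
    by (intro closed_injective_linear_image linear_of_real) (auto simp: inj_on_def)
qed

context np_gap
begin

lemma msupp_rays: "complex_of_real ` msupp \<mu> \<subseteq> rays a\<^sub>m b\<^sub>m"
  unfolding rays_def using msupp_cases by blast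

lemma interval_rays: "x \<in> {a..b} \<Longrightarrow> of_real x \<notin> rays a\<^sub>m b\<^sub>m"
  using gap(1) by (auto simp: rays_def einterval_def)

text \<open>A plane slit along one or two rays; a point of the support excludes the case without
  rays.\<close>

lemma simply_connected_compl_rays: "simply_connected (- rays a\<^sub>m b\<^sub>m)"
proof -
  obtain s where s: "s \<in> msupp \<mu>" using infinite_msupp by fastforce
  show ?thesis
  proof (cases rule: be_cases)
    case 1
    show ?thesis
    proof (cases rule: al_cases)
      case 1
      then show ?thesis using msupp_cases[OF s] \<open>a\<^sub>m = - \<infinity>\<close> by simp
    next
      case (2 r)
      then have "rays a\<^sub>m b\<^sub>m = complex_of_real ` {r..}"
        using \<open>a\<^sub>m = - \<infinity>\<close> by (auto simp: rays_def)
      then show ?thesis by (simp add: simply_connected_slotted_complex_plane_right)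
    qed
  next
    case (2 q)
    show ?thesis
    proof (cases rule: al_cases)
      case 1
      then have "rays a\<^sub>m b\<^sub>m = complex_of_real ` {..q}"
        using \<open>a\<^sub>m = ereal q\<close> by (auto simp: rays_def)
      then show ?thesis by (simp add: simply_connected_slotted_complex_plane_left)
    next
      case (2 r)
      then have "rays a\<^sub>m b\<^sub>m = complex_of_real ` ({..q} \<union> {r..})"
        using \<open>a\<^sub>m = ereal q\<close> by (auto simp: rays_def)
      moreover have "q < r" using \<open>q < a\<close> a_less_b \<theta>(1) \<open>\<theta> < r\<close> by simp
      ultimately show ?thesis by (simp add: simply_connected_doubly_slotted_complex_plane)
    qed
  qed
qed

lemma kernel_constant:
  obtains C where "0 \<le> C" "\<And>u v. u \<in> {w a..w b} \<Longrightarrow> v \<in> {w a..w b} \<Longrightarrow> (u - al) * k u v \<le> C"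
proof -
  obtain C where C: "\<And>u v. w a \<le> u \<Longrightarrow> w a \<le> v \<Longrightarrow> k u v \<le> C"
    by (rule k_bounded[OF be_less]) (rule that)
  have bound: "0 \<le> (u - al) * k u v \<and> (u - al) * k u v \<le> (w b - al) * C"
    if uv: "u \<in> {w a..w b}" "v \<in> {w a..w b}" for u v
  proof -
    have "be < u" "be < v" using uv be_less by auto
    then have "0 < k u v" "0 \<le> u - al" using al_be_0 by (auto intro: k_pos)
    then show ?thesis using C[of u v] uv by (auto intro: mult_mono)
  qed
  have "w a \<in> {w a..w b}" using w_interval[of a] a_less_b by auto
  then have "0 \<le> (w b - al) * C" using bound[of "w a" "w a"] by linarith
  then show ?thesis using bound by (intro that) blast+
qed

lemma lin_bounded_below:
  assumes "compact K" "K \<subseteq> - rays a\<^sub>m b\<^sub>m"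
  obtains \<delta> where "0 < \<delta>" "\<And>\<zeta> z. \<zeta> \<in> {al..be} \<Longrightarrow> z \<in> K \<Longrightarrow> \<delta> \<le> cmod (lin \<zeta> z)"
proof (cases "K = {}")
  case True
  then show ?thesis by (intro that[of 1]) auto
next
  case False
  let ?f = "\<lambda>(\<zeta>, z). cmod (lin \<zeta> z)"
  have "continuous_on ({al..be} \<times> K) ?f"
    unfolding lin_def case_prod_beta by (intro continuous_intros)
  moreover have "{al..be} \<times> K \<noteq> {}" using False al_be_0 by auto
  moreover have "compact ({al..be} \<times> K)" using assms(1) by (intro compact_Times) auto
  ultimately obtain p where p: "p \<in> {al..be} \<times> K" "\<And>q. q \<in> {al..be} \<times> K \<Longrightarrow> ?f p \<le> ?f q"
    using continuous_attains_inf by metis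
  have "0 < ?f p" using p(1) lin_nonzero[of "fst p" "snd p"] assms(2) by auto
  then show ?thesis using p(2) by (intro that[of "?f p"]) auto
qed

lemma aaa_nodesI:
  assumes "1 \<le> n" "aaa_pair a b n \<nu> t"
  shows "aaa_nodes F A B \<mu> a b a\<^sub>m b\<^sub>m \<theta> n t"
  using assms np_gap_axioms by (auto simp: aaa_nodes_def aaa_nodes_axioms_def aaa_pair_def)

lemma aaa_approximant_zeros:
  assumes n: "1 \<le> n" and pair: "aaa_pair a b n \<nu> t" and c: "aaa_weights F a b n \<nu> t c"
  shows "\<not> (\<exists>z. poly (aaa_P n t c) z = 0 \<and> poly (aaa_Q F n t c) z = 0)"
    and "{z. poly (aaa_P n t c) z = 0} = {z. is_pole (aaa_R F n t c) z}"
    and "{z. poly (aaa_P n t c) z = 0} \<subseteq> rays a\<^sub>m b\<^sub>m"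
proof -
  interpret aaa_nodes F A B \<mu> a b a\<^sub>m b\<^sub>m \<theta> n t by (rule aaa_nodesI[OF n pair])
  obtain C where C: "0 \<le> C" "\<And>u v. u \<in> {w a..w b} \<Longrightarrow> v \<in> {w a..w b} \<Longrightarrow> (u - al) * k u v \<le> C"
    by (rule kernel_constant) (rule that)
  have \<nu>: "finite_borel_measure \<nu>" "msupp \<nu> \<subseteq> {a..b}" "infinite (msupp \<nu>) \<or> n \<le> card (msupp \<nu>)"
    using pair by (auto simp: aaa_pair_def)
  show "\<not> (\<exists>z. poly (aaa_P n t c) z = 0 \<and> poly (aaa_Q F n t c) z = 0)"
    "{z. poly (aaa_P n t c) z = 0} = {z. is_pole (aaa_R F n t c) z}"
    "{z. poly (aaa_P n t c) z = 0} \<subseteq> rays a\<^sub>m b\<^sub>m"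
    by (rule aaa_zeros_and_poles[OF \<nu> c C]; assumption)+
qed

text \<open>Read off from \<open>aaa_R_bound\<close>: at \<open>t i\<close> the factor
  \<open>lin (v i)\<close> vanishes, while the denominators stay away from 0 because
  \<open>t i\<close> lies off the rays.\<close>

lemma aaa_error_interpolates:
  assumes n: "1 \<le> n" and pair: "aaa_pair a b n \<nu> t" and c: "aaa_weights F a b n \<nu> t c"
    and i: "i \<in> {1..n}"
  shows "aaa_R F n t c (of_real (t i)) = F (of_real (t i))"
proof -
  interpret aaa_nodes F A B \<mu> a b a\<^sub>m b\<^sub>m \<theta> n t by (rule aaa_nodesI[OF n pair])
  obtain C where C: "0 \<le> C" "\<And>u v. u \<in> {w a..w b} \<Longrightarrow> v \<in> {w a..w b} \<Longrightarrow> (u - al) * k u v \<le> C"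
    by (rule kernel_constant) (rule that)
  have \<nu>: "finite_borel_measure \<nu>" "msupp \<nu> \<subseteq> {a..b}" "infinite (msupp \<nu>) \<or> n \<le> card (msupp \<nu>)"
    using pair by (auto simp: aaa_pair_def)
  let ?z = "complex_of_real (t i)"
  have "{?z} \<subseteq> - rays a\<^sub>m b\<^sub>m" using interval_rays t_interval[OF i] by auto
  then obtain \<delta> where \<delta>: "0 < \<delta>" "\<And>\<zeta> z. \<zeta> \<in> {al..be} \<Longrightarrow> z \<in> {?z} \<Longrightarrow> \<delta> \<le> cmod (lin \<zeta> z)"
    by (rule lin_bounded_below[rotated]) (auto intro: that)
  have "cmod (aaa_R F n t c ?z - F ?z) \<le> cmod (lin (v i) ?z) * (C / \<delta>)"
    by (rule aaa_R_bound[OF \<nu> c C i \<delta>(1)]) (assumption | rule \<delta>(2) singletonI)+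
  also have "lin (v i) ?z = 0"
    using lin_real[OF w_interval(1)[OF t_interval[OF i]]] by (simp add: v_def)
  finally show ?thesis by simp
qed

text \<open>\<open>M\<close> is fixed before \<open>n\<close>, \<nu>, the nodes and the weights. It
  adds bounds of \<open>F\<close> at \<open>z\<close> and at the first node, both at most
  \<open>D\<close>, to \<open>aaa_R_bound\<close> at that node, whose coordinate is at most
  \<open>w b\<close>.\<close>

lemma aaa_error_bounded:
  assumes K: "compact K" "K \<subseteq> - rays a\<^sub>m b\<^sub>m"
  obtains M where "\<And>n \<nu> t c z. 1 \<le> n \<Longrightarrow> aaa_pair a b n \<nu> t \<Longrightarrow> aaa_weights F a b n \<nu> t c \<Longrightarrow>
    z \<in> K \<Longrightarrow> cmod (F z - aaa_R F n t c z) \<le> M"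
proof -
  obtain C where C: "0 \<le> C" "\<And>u v. u \<in> {w a..w b} \<Longrightarrow> v \<in> {w a..w b} \<Longrightarrow> (u - al) * k u v \<le> C"
    by (rule kernel_constant) (rule that)
  obtain \<delta> where \<delta>: "0 < \<delta>" "\<And>\<zeta> z. \<zeta> \<in> {al..be} \<Longrightarrow> z \<in> K \<Longrightarrow> \<delta> \<le> cmod (lin \<zeta> z)"
    by (rule lin_bounded_below[OF K]) (rule that)
  have F_cont: "continuous_on (- rays a\<^sub>m b\<^sub>m) F"
    using F_holomorphic msupp_rays
    by (intro holomorphic_on_imp_continuous_on) (blast intro: holomorphic_on_subset)
  have "compact (F ` (K \<union> of_real ` {a..b}))"
    using K interval_rays
    by (intro compact_continuous_image continuous_on_subset[OF F_cont] compact_Un) auto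
  then have "bounded (F ` (K \<union> of_real ` {a..b}))" by (rule compact_imp_bounded)
  then obtain D where D: "\<forall>y\<in>F ` (K \<union> of_real ` {a..b}). cmod y \<le> D"
    unfolding bounded_iff by (elim exE)
  obtain E where E: "\<forall>z\<in>K. cmod z \<le> E" using compact_imp_bounded[OF K(1)] unfolding bounded_iff by blast
  show ?thesis
  proof (rule that[of "2 * D + (1 + w b * (\<bar>\<theta>\<bar> + E)) * (C / \<delta>)"])
    fix n :: nat and \<nu> t c z
    assume n: "1 \<le> n" and pair: "aaa_pair a b n \<nu> t" and c: "aaa_weights F a b n \<nu> t c" and z: "z \<in> K"
    interpret aaa_nodes F A B \<mu> a b a\<^sub>m b\<^sub>m \<theta> n t by (rule aaa_nodesI[OF n pair])
    have \<nu>: "finite_borel_measure \<nu>" "msupp \<nu> \<subseteq> {a..b}" "infinite (msupp \<nu>) \<or> n \<le> card (msupp \<nu>)"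
      using pair by (auto simp: aaa_pair_def)
    have i: "1 \<in> {1..n}" using n by simp
    have R: "cmod (aaa_R F n t c z - F (of_real (t 1))) \<le> cmod (lin (v 1) z) * (C / \<delta>)"
      by (rule aaa_R_bound[OF \<nu> c C i \<delta>(1)]) (assumption | rule \<delta>(2) z)+
    have "cmod (lin (v 1) z) \<le> 1 + v 1 * cmod (of_real \<theta> - z)"
      unfolding lin_def using norm_triangle_ineq4[of 1 "of_real (v 1) * (of_real \<theta> - z)"] v_bounds(3)[OF i]
      by (simp add: norm_mult)
    also have "cmod (of_real \<theta> - z) \<le> \<bar>\<theta>\<bar> + E"
      using norm_triangle_ineq4[of "of_real \<theta>" z] E z by force
    then have "1 + v 1 * cmod (of_real \<theta> - z) \<le> 1 + w b * (\<bar>\<theta>\<bar> + E)"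
      using v_bounds(2,3)[OF i] by (intro add_left_mono mult_mono) auto
    finally have "cmod (lin (v 1) z) * (C / \<delta>) \<le> (1 + w b * (\<bar>\<theta>\<bar> + E)) * (C / \<delta>)"
      using C(1) \<delta>(1) by (intro mult_right_mono) auto
    moreover have "cmod (F z) \<le> D" using D z by blast
    moreover have "cmod (F (of_real (t 1))) \<le> D" using D t_interval[OF i] by blast
    moreover have "cmod (F z - aaa_R F n t c z) \<le> cmod (F z) + cmod (F (of_real (t 1)))
        + cmod (aaa_R F n t c z - F (of_real (t 1)))"
      using norm_triangle_ineq4[of "F z - F (of_real (t 1))" "aaa_R F n t c z - F (of_real (t 1))"]
        norm_triangle_ineq4[of "F z" "F (of_real (t 1))"] by simp
    ultimately show "cmod (F z - aaa_R F n t c z) \<le> 2 * D + (1 + w b * (\<bar>\<theta>\<bar> + E)) * (C / \<delta>)"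
      using R by linarith
  qed
qed

lemma aaa_geometric_convergence:
  assumes seq: "\<And>n. 1 \<le> n \<Longrightarrow> aaa_pair a b n (\<nu> n) (t n) \<and> aaa_weights F a b n (\<nu> n) (t n) (c n)"
    and K: "compact K" "K \<subseteq> - rays a\<^sub>m b\<^sub>m"
  shows "\<exists>q. 0 < q \<and> q < 1 \<and> (\<forall>\<^sub>F n in sequentially. \<forall>z\<in>K. cmod (F z - aaa_R F n (t n) (c n) z) \<le> q ^ n)"
proof -
  let ?f = "\<lambda>n z. F z - aaa_R F n (t n) (c n) z"
  have F_hol: "F holomorphic_on - rays a\<^sub>m b\<^sub>m"
    using F_holomorphic by (rule holomorphic_on_subset) (use msupp_rays in blast)
  obtain s where s: "s \<in> msupp \<mu>" using infinite_msupp by fastforce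
  have W: "of_real ` t n ` {1..n} \<subseteq> complex_of_real ` {a..b} \<and> finite (complex_of_real ` t n ` {1..n})
      \<and> card (complex_of_real ` t n ` {1..n}) = n \<and> (\<forall>u\<in>of_real ` t n ` {1..n}. ?f n u = 0)"
    if n: "1 \<le> n" for n
  proof -
    have mono: "strict_mono_on {1..n} (t n)" and range: "t n ` {1..n} \<subseteq> {a..b}"
      using seq[OF n] by (auto simp: aaa_pair_def)
    have "card (complex_of_real ` t n ` {1..n}) = card (t n ` {1..n})"
      by (rule card_image) (auto simp: inj_on_def)
    also have "\<dots> = n" using card_image[OF strict_mono_on_imp_inj_on[OF mono]] by simp
    finally have "card (complex_of_real ` t n ` {1..n}) = n" .
    moreover have "?f n (of_real (t n i)) = 0" if "i \<in> {1..n}" for i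
      using aaa_error_interpolates[OF n _ _ that, of "\<nu> n" "t n" "c n"] seq[OF n] by simp
    then have "\<forall>u\<in>of_real ` t n ` {1..n}. ?f n u = 0" unfolding ball_simps by blast
    ultimately show ?thesis by (intro conjI image_mono[OF range] finite_imageI finite_atLeastAtMost)
  qed
  obtain q where "0 < q" "q < 1" "\<forall>\<^sub>F n in sequentially. \<forall>z\<in>K. cmod (?f n z) \<le> q ^ n"
  proof (rule geometric_convergence[of "- rays a\<^sub>m b\<^sub>m" ?f "complex_of_real ` {a..b}"
        "\<lambda>n. complex_of_real ` t n ` {1..n}" K])
    show "open (- rays a\<^sub>m b\<^sub>m)" using closed_rays by (rule open_Compl)
    show "simply_connected (- rays a\<^sub>m b\<^sub>m)" by (rule simply_connected_compl_rays)
    show "- rays a\<^sub>m b\<^sub>m \<noteq> UNIV" using msupp_rays s by blast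
    show "?f n holomorphic_on - rays a\<^sub>m b\<^sub>m" if n: "1 \<le> n" for n
    proof -
      have "poly (aaa_P n (t n) (c n)) z \<noteq> 0" if "z \<in> - rays a\<^sub>m b\<^sub>m" for z
        using aaa_approximant_zeros(3)[OF n] seq[OF n] that by blast
      then show ?thesis unfolding aaa_R_def by (intro holomorphic_intros F_hol)
    qed
    show "\<exists>M. \<forall>n\<ge>1. \<forall>z\<in>K'. cmod (?f n z) \<le> M" if K': "compact K'" "K' \<subseteq> - rays a\<^sub>m b\<^sub>m" for K'
    proof -
      obtain M where "\<And>n \<nu> t c z. 1 \<le> n \<Longrightarrow> aaa_pair a b n \<nu> t \<Longrightarrow> aaa_weights F a b n \<nu> t c \<Longrightarrow>
          z \<in> K' \<Longrightarrow> cmod (F z - aaa_R F n t c z) \<le> M"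
        by (rule aaa_error_bounded[OF K']) (rule that)
      then show ?thesis using seq by blast
    qed
    show "compact (complex_of_real ` {a..b})" by (intro compact_continuous_image continuous_intros) auto
    show "complex_of_real ` {a..b} \<subseteq> - rays a\<^sub>m b\<^sub>m" using interval_rays by blast
  qed (use W K in blast)+
  then show ?thesis by blast
qed

end

theorem corollary2:
  fixes F :: "complex \<Rightarrow> complex" and A B a b :: real and \<mu> :: "real measure"
    and a\<^sub>m b\<^sub>m :: ereal
  assumes "nevanlinna_pick F"
    and "np_representation F A B \<mu>"
    and "\<not> rational_on F (- (complex_of_real ` msupp \<mu>))"
    and "a < b"
    and "{a..b} \<inter> msupp \<mu> = {}"
    and "largest_gap \<mu> a b a\<^sub>m b\<^sub>m"
  shows "(\<forall>(n::nat) \<nu> t w. n \<ge> 1 \<longrightarrow> aaa_pair a b n \<nu> t \<longrightarrow> aaa_weights F a b n \<nu> t w \<longrightarrow>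
            (\<not> (\<exists>z. poly (aaa_P n t w) z = 0 \<and> poly (aaa_Q F n t w) z = 0)) \<and>
            {z. poly (aaa_P n t w) z = 0} = {z. is_pole (aaa_R F n t w) z} \<and>
            {z. poly (aaa_P n t w) z = 0} \<subseteq> rays a\<^sub>m b\<^sub>m)
       \<and> (\<forall>(\<nu> :: nat \<Rightarrow> real measure) (t :: nat \<Rightarrow> nat \<Rightarrow> real) (w :: nat \<Rightarrow> nat \<Rightarrow> real).
            (\<forall>n\<ge>1. aaa_pair a b n (\<nu> n) (t n) \<and> aaa_weights F a b n (\<nu> n) (t n) (w n)) \<longrightarrow>
            (\<forall>K. compact K \<longrightarrow> K \<subseteq> - rays a\<^sub>m b\<^sub>m \<longrightarrow>
              (\<exists>q::real. 0 < q \<and> q < 1 \<and>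
                (\<forall>\<^sub>F n in sequentially. \<forall>z\<in>K.
                   cmod (F z - aaa_R F n (t n) (w n) z) \<le> q ^ n))))"
proof -
  interpret np_function F A B \<mu> by standard (rule assms(2))
  have "{a..b} \<subseteq> einterval a\<^sub>m b\<^sub>m" and gap: "einterval a\<^sub>m b\<^sub>m \<inter> msupp \<mu> = {}"
    using assms(6) by (simp_all add: largest_gap_def)
  then have "b \<in> einterval a\<^sub>m b\<^sub>m" using assms(4) by auto
  then have "ereal b < b\<^sub>m" by (simp add: einterval_def)
  then obtain \<theta> where \<theta>: "ereal b < ereal \<theta>" "ereal \<theta> < b\<^sub>m" using ereal_dense2 by blast
  have "infinite (msupp \<mu>)" using finite_msupp_imp_rational assms(3) by blast
  then interpret np_gap F A B \<mu> a b a\<^sub>m b\<^sub>m \<theta>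
    using assms(4) \<open>{a..b} \<subseteq> einterval a\<^sub>m b\<^sub>m\<close> gap \<theta> by unfold_locales auto
  show ?thesis
    by (intro conjI allI impI aaa_approximant_zeros aaa_geometric_convergence) blast+
qed

end
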